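(* Let $\mathcal{S}$ be a rigid semigroup category and let $F\in\mathcal{S}$ be such that the functor $F\boxtimes-:\mathcal{S}\to\mathcal{S}$ is liberal. Then the unit object of the monoidal category $[\mathcal{S}^{\mathrm{op}},\mathbf{Vec}_{\Bbbk}]$ (with Day convolution) is isomorphic to the coequalizer of the parallel pair $$\operatorname{Hom}_{\mathcal{S}}(-,\varepsilon^{F,r}_{F}\boxtimes F^{\diamond}),\ \operatorname{Hom}_{\mathcal{S}}(-,F\boxtimes\varepsilon^{F,l}_{F^{\diamond}}):\ \operatorname{Hom}_{\mathcal{S}}(-,FF^{\diamond}FF^{\diamond})\rightrightarrows\operatorname{Hom}_{\mathcal{S}}(-,FF^{\diamond}).$$
   Context: $\Bbbk$ is a field; all categories and functors are $\Bbbk$-linear, $\mathcal{S}$ small. A *semigroup category* is a category $\mathcal{S}$ with a bilinear functor $\boxtimes$ and an associativity isomorphism satisfying the pentagon axiom; no unit object is required. Module functors and transformations are defined as for monoidal categories, dropping unit data. Associators are suppressed and $\boxtimes$ is often written as juxtaposition. An *adjunction* in $\mathcal{S}$ is a tuple $(F,F^{\diamond},\eta^{F,l},\eta^{F,r},\varepsilon^{F,l},\varepsilon^{F,r})$ with $F,F^{\diamond}\in\mathcal{S}$, left $\mathcal{S}$-module transformations $\eta^{F,l}:\mathrm{Id}\to -\boxtimes(F^{\diamond}\boxtimes F)$, $\varepsilon^{F,l}:-\boxtimes(F\boxtimes F^{\diamond})\to\mathrm{Id}$, and right $\mathcal{S}$-module transformations $\eta^{F,r}:\mathrm{Id}\to(F^{\diamond}\boxtimes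 F)\boxtimes-$, $\varepsilon^{F,r}:(F\boxtimes F^{\diamond})\boxtimes-\to\mathrm{Id}$, such that: (I) $(-\boxtimes F^{\diamond},-\boxtimes F,\eta^{F,l},\varepsilon^{F,l})$ is an adjunction (left adjoint first) of left $\mathcal{S}$-module endofunctors of $\mathcal{S}$; (II) $(F\boxtimes-,F^{\diamond}\boxtimes-,\eta^{F,r},\varepsilon^{F,r})$ is an adjunction of right $\mathcal{S}$-module endofunctors; (III) $\varepsilon^{F,r}_{F}\circ\eta^{F,l}_{F}=\mathrm{id}_{F}$ and $\varepsilon^{F,l}_{F^{\diamond}}\circ\eta^{F,r}_{F^{\diamond}}=\mathrm{id}_{F^{\diamond}}$; (IV) for all $H,K$, $H\boxtimes\eta^{F,r}_{K}=\eta^{F,l}_{H}\boxtimes K$ and $H\boxtimes\varepsilon^{F,r}_{K}=\varepsilon^{F,l}_{H}\boxtimes K$. Then $F^{\diamond}$ is a right dual of $F$ and $F$ a left dual of $F^{\diamond}$. $\mathcal{S}$ is *rigid* if every object has both a left and a right dual; an adjunction is fixed for the given $F$. A $\Bbbk$-linear functor $E:\mathcal{A}\to\mathcal{B}$ is *liberal* if every object of $\mathcal{B}$ is a direct summand of a finite direct sum of objects of the form $E(X)$, $X\in\mathcal{A}$. Day convolution on presheaves: $(P\circledast Q)(-)=\int^{H,K}\operatorname{Hom}_{\mathcal{S}}(-,H\boxtimes K)\otimes P(H)\otimes Q(K)$; for $\mathcal{S}$ rigid, $[\mathcal{S}^{\mathrm{op}},\mathbf{Vec}_{\Bbbk}]$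 is monoidal (has a unit object). *)

theory Defs
  imports "HOL-Algebra.Module"
begin

section \<open>Linear categories and linear functors\<close>

definition linear_map ::
  "('k, 'r) ring_scheme \<Rightarrow> ('k, 'a, 'm) module_scheme \<Rightarrow> ('k, 'b, 'n) module_scheme \<Rightarrow> ('a \<Rightarrow> 'b) \<Rightarrow> bool"
  where
  "linear_map K M N t \<longleftrightarrow>
     t \<in> carrier M \<rightarrow> carrier N \<and>
     (\<forall>x\<in>carrier M. \<forall>y\<in>carrier M. t (x \<oplus>\<^bsub>M\<^esub> y) = t x \<oplus>\<^bsub>N\<^esub> t y) \<and>
     (\<forall>c\<in>carrier K. \<forall>x\<in>carrier M. t (c \<odot>\<^bsub>M\<^esub> x) = c \<odot>\<^bsub>N\<^esub> t x)"

text \<open>Morphisms know their source and target: distinct hom-spaces are required to be disjoint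
  (see \<^emph>\<open>hom_disjoint\<close> below), so composition and the tensor product of morphisms need
  no object arguments.\<close>

record ('o, 'k, 'a) lincat =
  Obj :: "'o set"
  Hom :: "'o \<Rightarrow> 'o \<Rightarrow> ('k, 'a) module"
  Comp :: "'a \<Rightarrow> 'a \<Rightarrow> 'a"  (infixl \<open>\<cdot>\<index>\<close> 70)
  Ident :: "'o \<Rightarrow> 'a"

abbreviation arr :: "('o, 'k, 'a, 'z) lincat_scheme \<Rightarrow> 'o \<Rightarrow> 'o \<Rightarrow> 'a set" where
  "arr C X Y \<equiv> carrier (Hom C X Y)"

locale linear_category = field K
  for K :: "'k ring" and C :: "('o, 'k, 'a, 'z) lincat_scheme" +
  assumes hom_module: "\<lbrakk>X \<in> Obj C; Y \<in> Obj C\<rbrakk> \<Longrightarrow> module K (Hom C X Y)"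
    and hom_disjoint:
      "\<lbrakk>X \<in> Obj C; Y \<in> Obj C; X' \<in> Obj C; Y' \<in> Obj C; f \<in> arr C X Y; f \<in> arr C X' Y'\<rbrakk>
        \<Longrightarrow> X = X' \<and> Y = Y'"
    and ident_arr: "X \<in> Obj C \<Longrightarrow> Ident C X \<in> arr C X X"
    and comp_ident_right:
      "\<lbrakk>X \<in> Obj C; Y \<in> Obj C; f \<in> arr C X Y\<rbrakk> \<Longrightarrow> f \<cdot>\<^bsub>C\<^esub> Ident C X = f"
    and comp_ident_left:
      "\<lbrakk>X \<in> Obj C; Y \<in> Obj C; f \<in> arr C X Y\<rbrakk> \<Longrightarrow> Ident C Y \<cdot>\<^bsub>C\<^esub> f = f"
    and comp_linear_left:
      "\<lbrakk>X \<in> Obj C; Y \<in> Obj C; Z \<in> Obj C; f \<in> arr C X Y\<rbrakk>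
        \<Longrightarrow> linear_map K (Hom C Y Z) (Hom C X Z) (\<lambda>g. g \<cdot>\<^bsub>C\<^esub> f)"
    and comp_linear_right:
      "\<lbrakk>X \<in> Obj C; Y \<in> Obj C; Z \<in> Obj C; g \<in> arr C Y Z\<rbrakk>
        \<Longrightarrow> linear_map K (Hom C X Y) (Hom C X Z) (\<lambda>f. g \<cdot>\<^bsub>C\<^esub> f)"
    and comp_assoc:
      "\<lbrakk>W \<in> Obj C; X \<in> Obj C; Y \<in> Obj C; Z \<in> Obj C; f \<in> arr C W X; g \<in> arr C X Y; h \<in> arr C Y Z\<rbrakk>
        \<Longrightarrow> (h \<cdot>\<^bsub>C\<^esub> g) \<cdot>\<^bsub>C\<^esub> f = h \<cdot>\<^bsub>C\<^esub> (g \<cdot>\<^bsub>C\<^esub> f)"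

definition inverse_arrows :: "('o, 'k, 'a, 'z) lincat_scheme \<Rightarrow> 'o \<Rightarrow> 'o \<Rightarrow> 'a \<Rightarrow> 'a \<Rightarrow> bool" where
  "inverse_arrows C X Y f g \<longleftrightarrow>
     f \<in> arr C X Y \<and> g \<in> arr C Y X \<and> g \<cdot>\<^bsub>C\<^esub> f = Ident C X \<and> f \<cdot>\<^bsub>C\<^esub> g = Ident C Y"

definition is_iso :: "('o, 'k, 'a, 'z) lincat_scheme \<Rightarrow> 'o \<Rightarrow> 'o \<Rightarrow> 'a \<Rightarrow> bool" where
  "is_iso C X Y f \<longleftrightarrow> (\<exists>g. inverse_arrows C X Y f g)"

definition inv_arr :: "('o, 'k, 'a, 'z) lincat_scheme \<Rightarrow> 'a \<Rightarrow> 'a" where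
  "inv_arr C f = (THE g. \<exists>X\<in>Obj C. \<exists>Y\<in>Obj C. inverse_arrows C X Y f g)"

definition isomorphic :: "('o, 'k, 'a, 'z) lincat_scheme \<Rightarrow> 'o \<Rightarrow> 'o \<Rightarrow> bool" where
  "isomorphic C X Y \<longleftrightarrow> (\<exists>f. is_iso C X Y f)"

definition is_coequalizer ::
  "('o, 'k, 'a, 'z) lincat_scheme \<Rightarrow> 'o \<Rightarrow> 'o \<Rightarrow> 'a \<Rightarrow> 'a \<Rightarrow> 'o \<Rightarrow> 'a \<Rightarrow> bool" where
  "is_coequalizer C X Y f g Q q \<longleftrightarrow>
     Q \<in> Obj C \<and> q \<in> arr C Y Q \<and> f \<in> arr C X Y \<and> g \<in> arr C X Y \<and>
     q \<cdot>\<^bsub>C\<^esub> f = q \<cdot>\<^bsub>C\<^esub> g \<and>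
     (\<forall>Z\<in>Obj C. \<forall>h\<in>arr C Y Z. h \<cdot>\<^bsub>C\<^esub> f = h \<cdot>\<^bsub>C\<^esub> g \<longrightarrow> (\<exists>!u. u \<in> arr C Q Z \<and> u \<cdot>\<^bsub>C\<^esub> q = h))"

definition is_direct_sum :: "('o, 'k, 'a, 'z) lincat_scheme \<Rightarrow> 'o list \<Rightarrow> 'o \<Rightarrow> bool" where
  "is_direct_sum C Xs D \<longleftrightarrow>
     D \<in> Obj C \<and>
     (\<exists>\<iota> \<pi>. (\<forall>i<length Xs. \<iota> i \<in> arr C (Xs ! i) D \<and> \<pi> i \<in> arr C D (Xs ! i)) \<and>
        (\<forall>i<length Xs. \<forall>j<length Xs.
           \<pi> i \<cdot>\<^bsub>C\<^esub> \<iota> j = (if i = j then Ident C (Xs ! i) else \<zero>\<^bsub>Hom C (Xs ! j) (Xs ! i)\<^esub>)) \<and>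
        (\<Oplus>\<^bsub>Hom C D D\<^esub>i\<in>{..<length Xs}. \<iota> i \<cdot>\<^bsub>C\<^esub> \<pi> i) = Ident C D)"

text \<open>Categories are not assumed idempotent complete; a direct summand is a retract, i.e. the
  image of a split idempotent, and no complementary object is required.\<close>

definition is_direct_summand :: "('o, 'k, 'a, 'z) lincat_scheme \<Rightarrow> 'o \<Rightarrow> 'o \<Rightarrow> bool" where
  "is_direct_summand C Y D \<longleftrightarrow>
     (\<exists>i\<in>arr C Y D. \<exists>p\<in>arr C D Y. p \<cdot>\<^bsub>C\<^esub> i = Ident C Y)"

record ('o, 'a, 'p, 'b) func =
  FObj :: "'o \<Rightarrow> 'p"
  FArr :: "'a \<Rightarrow> 'b"

definition id_func :: "('o, 'a, 'o, 'a) func" where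
  "id_func = \<lparr>FObj = (\<lambda>X. X), FArr = (\<lambda>f. f)\<rparr>"

definition comp_func ::
  "('p, 'b, 'q, 'c) func \<Rightarrow> ('o, 'a, 'p, 'b) func \<Rightarrow> ('o, 'a, 'q, 'c) func" where
  "comp_func G E = \<lparr>FObj = (\<lambda>X. FObj G (FObj E X)), FArr = (\<lambda>f. FArr G (FArr E f))\<rparr>"

definition linear_functor ::
  "'k ring \<Rightarrow> ('o, 'k, 'a, 'y) lincat_scheme \<Rightarrow> ('p, 'k, 'b, 'z) lincat_scheme \<Rightarrow>
    ('o, 'a, 'p, 'b) func \<Rightarrow> bool" where
  "linear_functor K A B E \<longleftrightarrow>
     (\<forall>X\<in>Obj A. FObj E X \<in> Obj B \<and> FArr E (Ident A X) = Ident B (FObj E X)) \<and>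
     (\<forall>X\<in>Obj A. \<forall>Y\<in>Obj A. linear_map K (Hom A X Y) (Hom B (FObj E X) (FObj E Y)) (FArr E)) \<and>
     (\<forall>X\<in>Obj A. \<forall>Y\<in>Obj A. \<forall>Z\<in>Obj A. \<forall>f\<in>arr A X Y. \<forall>g\<in>arr A Y Z.
        FArr E (g \<cdot>\<^bsub>A\<^esub> f) = FArr E g \<cdot>\<^bsub>B\<^esub> FArr E f)"

definition liberal ::
  "'k ring \<Rightarrow> ('o, 'k, 'a, 'y) lincat_scheme \<Rightarrow> ('p, 'k, 'b, 'z) lincat_scheme \<Rightarrow>
    ('o, 'a, 'p, 'b) func \<Rightarrow> bool" where
  "liberal K A B E \<longleftrightarrow>
     linear_functor K A B E \<and>
     (\<forall>Y\<in>Obj B. \<exists>Xs D. set Xs \<subseteq> Obj A \<and> is_direct_sum B (map (FObj E) Xs) D \<and>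
        is_direct_summand B Y D)"

definition nat_trans ::
  "('o, 'k, 'a, 'y) lincat_scheme \<Rightarrow> ('p, 'k, 'b, 'z) lincat_scheme \<Rightarrow>
    ('o, 'a, 'p, 'b) func \<Rightarrow> ('o, 'a, 'p, 'b) func \<Rightarrow> ('o \<Rightarrow> 'b) \<Rightarrow> bool" where
  "nat_trans A B E E' \<tau> \<longleftrightarrow>
     (\<forall>X\<in>Obj A. \<tau> X \<in> arr B (FObj E X) (FObj E' X)) \<and>
     (\<forall>X\<in>Obj A. \<forall>Y\<in>Obj A. \<forall>f\<in>arr A X Y. \<tau> Y \<cdot>\<^bsub>B\<^esub> FArr E f = FArr E' f \<cdot>\<^bsub>B\<^esub> \<tau> X)"

text \<open>\<open>L\<close> is left adjoint to \<open>R\<close>, with unit \<open>\<eta>\<close> and counit \<open>\<epsilon>\<close>.\<close>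

definition functor_adjunction ::
  "('o, 'k, 'a, 'y) lincat_scheme \<Rightarrow> ('p, 'k, 'b, 'z) lincat_scheme \<Rightarrow>
    ('o, 'a, 'p, 'b) func \<Rightarrow> ('p, 'b, 'o, 'a) func \<Rightarrow> ('o \<Rightarrow> 'a) \<Rightarrow> ('p \<Rightarrow> 'b) \<Rightarrow> bool" where
  "functor_adjunction A B L R \<eta> \<epsilon> \<longleftrightarrow>
     nat_trans A A id_func (comp_func R L) \<eta> \<and>
     nat_trans B B (comp_func L R) id_func \<epsilon> \<and>
     (\<forall>X\<in>Obj A. \<epsilon> (FObj L X) \<cdot>\<^bsub>B\<^esub> FArr L (\<eta> X) = Ident B (FObj L X)) \<and>
     (\<forall>Y\<in>Obj B. FArr R (\<epsilon> Y) \<cdot>\<^bsub>A\<^esub> \<eta> (FObj R Y) = Ident A (FObj R Y))"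


section \<open>Semigroup categories\<close>

record ('o, 'k, 'a) semicat = "('o, 'k, 'a) lincat" +
  TObj :: "'o \<Rightarrow> 'o \<Rightarrow> 'o"  (infixl \<open>\<boxtimes>\<index>\<close> 75)
  TArr :: "'a \<Rightarrow> 'a \<Rightarrow> 'a"  (infixl \<open>\<boxdot>\<index>\<close> 75)
  Assoc :: "'o \<Rightarrow> 'o \<Rightarrow> 'o \<Rightarrow> 'a"  \<comment> \<open>\<open>(X \<boxtimes> Y) \<boxtimes> Z \<rightarrow> X \<boxtimes> (Y \<boxtimes> Z)\<close>\<close>

locale semigroup_category = linear_category K S
  for K :: "'k ring" and S :: "('o, 'k, 'a, 'z) semicat_scheme" +
  assumes tensor_obj: "\<lbrakk>X \<in> Obj S; Y \<in> Obj S\<rbrakk> \<Longrightarrow> X \<boxtimes>\<^bsub>S\<^esub> Y \<in> Obj S"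
    and tensor_ident:
      "\<lbrakk>X \<in> Obj S; Y \<in> Obj S\<rbrakk> \<Longrightarrow> Ident S X \<boxdot>\<^bsub>S\<^esub> Ident S Y = Ident S (X \<boxtimes>\<^bsub>S\<^esub> Y)"
    and tensor_comp:
      "\<lbrakk>X \<in> Obj S; X' \<in> Obj S; X'' \<in> Obj S; Y \<in> Obj S; Y' \<in> Obj S; Y'' \<in> Obj S;
        f \<in> arr S X X'; f' \<in> arr S X' X''; g \<in> arr S Y Y'; g' \<in> arr S Y' Y''\<rbrakk>
        \<Longrightarrow> (f' \<cdot>\<^bsub>S\<^esub> f) \<boxdot>\<^bsub>S\<^esub> (g' \<cdot>\<^bsub>S\<^esub> g) = (f' \<boxdot>\<^bsub>S\<^esub> g') \<cdot>\<^bsub>S\<^esub> (f \<boxdot>\<^bsub>S\<^esub> g)"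
    and tensor_linear_left:
      "\<lbrakk>X \<in> Obj S; X' \<in> Obj S; Y \<in> Obj S; Y' \<in> Obj S; g \<in> arr S Y Y'\<rbrakk>
        \<Longrightarrow> linear_map K (Hom S X X') (Hom S (X \<boxtimes>\<^bsub>S\<^esub> Y) (X' \<boxtimes>\<^bsub>S\<^esub> Y')) (\<lambda>f. f \<boxdot>\<^bsub>S\<^esub> g)"
    and tensor_linear_right:
      "\<lbrakk>X \<in> Obj S; X' \<in> Obj S; Y \<in> Obj S; Y' \<in> Obj S; f \<in> arr S X X'\<rbrakk>
        \<Longrightarrow> linear_map K (Hom S Y Y') (Hom S (X \<boxtimes>\<^bsub>S\<^esub> Y) (X' \<boxtimes>\<^bsub>S\<^esub> Y')) (\<lambda>g. f \<boxdot>\<^bsub>S\<^esub> g)"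
    and assoc_iso:
      "\<lbrakk>X \<in> Obj S; Y \<in> Obj S; Z \<in> Obj S\<rbrakk>
        \<Longrightarrow> is_iso S (X \<boxtimes>\<^bsub>S\<^esub> Y \<boxtimes>\<^bsub>S\<^esub> Z) (X \<boxtimes>\<^bsub>S\<^esub> (Y \<boxtimes>\<^bsub>S\<^esub> Z)) (Assoc S X Y Z)"
    and assoc_natural:
      "\<lbrakk>X \<in> Obj S; X' \<in> Obj S; Y \<in> Obj S; Y' \<in> Obj S; Z \<in> Obj S; Z' \<in> Obj S;
        f \<in> arr S X X'; g \<in> arr S Y Y'; h \<in> arr S Z Z'\<rbrakk>
        \<Longrightarrow> Assoc S X' Y' Z' \<cdot>\<^bsub>S\<^esub> (f \<boxdot>\<^bsub>S\<^esub> g \<boxdot>\<^bsub>S\<^esub> h) = (f \<boxdot>\<^bsub>S\<^esub> (g \<boxdot>\<^bsub>S\<^esub> h)) \<cdot>\<^bsub>S\<^esub> Assoc S X Y Z"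
    and pentagon:
      "\<lbrakk>W \<in> Obj S; X \<in> Obj S; Y \<in> Obj S; Z \<in> Obj S\<rbrakk>
        \<Longrightarrow> (Ident S W \<boxdot>\<^bsub>S\<^esub> Assoc S X Y Z) \<cdot>\<^bsub>S\<^esub> Assoc S W (X \<boxtimes>\<^bsub>S\<^esub> Y) Z
              \<cdot>\<^bsub>S\<^esub> (Assoc S W X Y \<boxdot>\<^bsub>S\<^esub> Ident S Z)
            = Assoc S W X (Y \<boxtimes>\<^bsub>S\<^esub> Z) \<cdot>\<^bsub>S\<^esub> Assoc S (W \<boxtimes>\<^bsub>S\<^esub> X) Y Z"

definition is_unit_object :: "('o, 'k, 'a, 'z) semicat_scheme \<Rightarrow> 'o \<Rightarrow> bool" where
  "is_unit_object M U \<longleftrightarrow>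
     U \<in> Obj M \<and>
     (\<exists>lu \<rho>.
        (\<forall>X\<in>Obj M. is_iso M (U \<boxtimes>\<^bsub>M\<^esub> X) X (lu X) \<and> is_iso M (X \<boxtimes>\<^bsub>M\<^esub> U) X (\<rho> X)) \<and>
        (\<forall>X\<in>Obj M. \<forall>Y\<in>Obj M. \<forall>f\<in>arr M X Y.
           lu Y \<cdot>\<^bsub>M\<^esub> (Ident M U \<boxdot>\<^bsub>M\<^esub> f) = f \<cdot>\<^bsub>M\<^esub> lu X \<and>
           \<rho> Y \<cdot>\<^bsub>M\<^esub> (f \<boxdot>\<^bsub>M\<^esub> Ident M U) = f \<cdot>\<^bsub>M\<^esub> \<rho> X) \<and>
        (\<forall>X\<in>Obj M. \<forall>Y\<in>Obj M.
           (Ident M X \<boxdot>\<^bsub>M\<^esub> lu Y) \<cdot>\<^bsub>M\<^esub> Assoc M X U Y = \<rho> X \<boxdot>\<^bsub>M\<^esub> Ident M Y))"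

definition left_tensor :: "('o, 'k, 'a, 'z) semicat_scheme \<Rightarrow> 'o \<Rightarrow> ('o, 'a, 'o, 'a) func" where
  "left_tensor S G = \<lparr>FObj = (\<lambda>X. G \<boxtimes>\<^bsub>S\<^esub> X), FArr = (\<lambda>f. Ident S G \<boxdot>\<^bsub>S\<^esub> f)\<rparr>"

definition right_tensor :: "('o, 'k, 'a, 'z) semicat_scheme \<Rightarrow> 'o \<Rightarrow> ('o, 'a, 'o, 'a) func" where
  "right_tensor S G = \<lparr>FObj = (\<lambda>X. X \<boxtimes>\<^bsub>S\<^esub> G), FArr = (\<lambda>f. f \<boxdot>\<^bsub>S\<^esub> Ident S G)\<rparr>"

text \<open>Transformations of endofunctors of the regular left module category \<open>S\<close>. The module
  structures of the functors \<open>E\<close>, \<open>E'\<close> are \<open>\<phi> X Y : E (X \<boxtimes> Y) \<rightarrow> X \<boxtimes> E Y\<close> and likewise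
  \<open>\<phi>'\<close>; for \<open>- \<boxtimes> G\<close> the structure is the associator. Right modules are dual, with structures
  \<open>\<psi> X Y : E X \<boxtimes> Y \<rightarrow> E (X \<boxtimes> Y)\<close>.\<close>

definition left_module_trans ::
  "('o, 'k, 'a, 'z) semicat_scheme \<Rightarrow> ('o, 'a, 'o, 'a) func \<Rightarrow> ('o \<Rightarrow> 'o \<Rightarrow> 'a) \<Rightarrow>
    ('o, 'a, 'o, 'a) func \<Rightarrow> ('o \<Rightarrow> 'o \<Rightarrow> 'a) \<Rightarrow> ('o \<Rightarrow> 'a) \<Rightarrow> bool" where
  "left_module_trans S E \<phi> E' \<phi>' \<tau> \<longleftrightarrow>
     nat_trans S S E E' \<tau> \<and>
     (\<forall>X\<in>Obj S. \<forall>Y\<in>Obj S.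
        \<phi>' X Y \<cdot>\<^bsub>S\<^esub> \<tau> (X \<boxtimes>\<^bsub>S\<^esub> Y) = (Ident S X \<boxdot>\<^bsub>S\<^esub> \<tau> Y) \<cdot>\<^bsub>S\<^esub> \<phi> X Y)"

definition right_module_trans ::
  "('o, 'k, 'a, 'z) semicat_scheme \<Rightarrow> ('o, 'a, 'o, 'a) func \<Rightarrow> ('o \<Rightarrow> 'o \<Rightarrow> 'a) \<Rightarrow>
    ('o, 'a, 'o, 'a) func \<Rightarrow> ('o \<Rightarrow> 'o \<Rightarrow> 'a) \<Rightarrow> ('o \<Rightarrow> 'a) \<Rightarrow> bool" where
  "right_module_trans S E \<psi> E' \<psi>' \<tau> \<longleftrightarrow>
     nat_trans S S E E' \<tau> \<and>
     (\<forall>X\<in>Obj S. \<forall>Y\<in>Obj S.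
        \<tau> (X \<boxtimes>\<^bsub>S\<^esub> Y) \<cdot>\<^bsub>S\<^esub> \<psi> X Y = \<psi>' X Y \<cdot>\<^bsub>S\<^esub> (\<tau> X \<boxdot>\<^bsub>S\<^esub> Ident S Y))"

abbreviation (input) id_structure :: "('o, 'k, 'a, 'z) semicat_scheme \<Rightarrow> 'o \<Rightarrow> 'o \<Rightarrow> 'a" where
  "id_structure S \<equiv> \<lambda>X Y. Ident S (X \<boxtimes>\<^bsub>S\<^esub> Y)"

abbreviation (input) right_tensor_structure ::
  "('o, 'k, 'a, 'z) semicat_scheme \<Rightarrow> 'o \<Rightarrow> 'o \<Rightarrow> 'o \<Rightarrow> 'a" where
  "right_tensor_structure S G \<equiv> \<lambda>X Y. Assoc S X Y G"

abbreviation (input) left_tensor_structure ::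
  "('o, 'k, 'a, 'z) semicat_scheme \<Rightarrow> 'o \<Rightarrow> 'o \<Rightarrow> 'o \<Rightarrow> 'a" where
  "left_tensor_structure S G \<equiv> \<lambda>X Y. Assoc S G X Y"

text \<open>Adjunctions in a semigroup category: \<open>Fd\<close> stands for \<open>F\<^sup>\<diamond>\<close>, and \<open>\<eta>l\<close>, \<open>\<eta>r\<close>, \<open>\<epsilon>l\<close>,
  \<open>\<epsilon>r\<close> for the units and counits. The associators, usually suppressed, are inserted as forced
  by sources and targets.\<close>

definition adjunction ::
  "('o, 'k, 'a, 'z) semicat_scheme \<Rightarrow> 'o \<Rightarrow> 'o \<Rightarrow>
    ('o \<Rightarrow> 'a) \<Rightarrow> ('o \<Rightarrow> 'a) \<Rightarrow> ('o \<Rightarrow> 'a) \<Rightarrow> ('o \<Rightarrow> 'a) \<Rightarrow> bool" where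
  "adjunction S F Fd \<eta>l \<eta>r \<epsilon>l \<epsilon>r \<longleftrightarrow>
     F \<in> Obj S \<and> Fd \<in> Obj S \<and>
     left_module_trans S id_func (id_structure S)
       (right_tensor S (Fd \<boxtimes>\<^bsub>S\<^esub> F)) (right_tensor_structure S (Fd \<boxtimes>\<^bsub>S\<^esub> F)) \<eta>l \<and>
     left_module_trans S (right_tensor S (F \<boxtimes>\<^bsub>S\<^esub> Fd)) (right_tensor_structure S (F \<boxtimes>\<^bsub>S\<^esub> Fd))
       id_func (id_structure S) \<epsilon>l \<and>
     right_module_trans S id_func (id_structure S)
       (left_tensor S (Fd \<boxtimes>\<^bsub>S\<^esub> F)) (left_tensor_structure S (Fd \<boxtimes>\<^bsub>S\<^esub> F)) \<eta>r \<and>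
     right_module_trans S (left_tensor S (F \<boxtimes>\<^bsub>S\<^esub> Fd)) (left_tensor_structure S (F \<boxtimes>\<^bsub>S\<^esub> Fd))
       id_func (id_structure S) \<epsilon>r \<and>
     \<comment> \<open>(I)\<close>
     functor_adjunction S S (right_tensor S Fd) (right_tensor S F)
       (\<lambda>X. inv_arr S (Assoc S X Fd F) \<cdot>\<^bsub>S\<^esub> \<eta>l X) (\<lambda>X. \<epsilon>l X \<cdot>\<^bsub>S\<^esub> Assoc S X F Fd) \<and>
     \<comment> \<open>(II)\<close>
     functor_adjunction S S (left_tensor S F) (left_tensor S Fd)
       (\<lambda>X. Assoc S Fd F X \<cdot>\<^bsub>S\<^esub> \<eta>r X) (\<lambda>X. \<epsilon>r X \<cdot>\<^bsub>S\<^esub> inv_arr S (Assoc S F Fd X)) \<and>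
     \<comment> \<open>(III)\<close>
     \<epsilon>r F \<cdot>\<^bsub>S\<^esub> inv_arr S (Assoc S F Fd F) \<cdot>\<^bsub>S\<^esub> \<eta>l F = Ident S F \<and>
     \<epsilon>l Fd \<cdot>\<^bsub>S\<^esub> Assoc S Fd F Fd \<cdot>\<^bsub>S\<^esub> \<eta>r Fd = Ident S Fd \<and>
     \<comment> \<open>(IV)\<close>
     (\<forall>H\<in>Obj S. \<forall>L\<in>Obj S.
        Ident S H \<boxdot>\<^bsub>S\<^esub> \<eta>r L = Assoc S H (Fd \<boxtimes>\<^bsub>S\<^esub> F) L \<cdot>\<^bsub>S\<^esub> (\<eta>l H \<boxdot>\<^bsub>S\<^esub> Ident S L) \<and>
        (Ident S H \<boxdot>\<^bsub>S\<^esub> \<epsilon>r L) \<cdot>\<^bsub>S\<^esub> Assoc S H (F \<boxtimes>\<^bsub>S\<^esub> Fd) L = \<epsilon>l H \<boxdot>\<^bsub>S\<^esub> Ident S L)"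

definition is_right_dual :: "('o, 'k, 'a, 'z) semicat_scheme \<Rightarrow> 'o \<Rightarrow> 'o \<Rightarrow> bool" where
  "is_right_dual S F Fd \<longleftrightarrow> (\<exists>\<eta>l \<eta>r \<epsilon>l \<epsilon>r. adjunction S F Fd \<eta>l \<eta>r \<epsilon>l \<epsilon>r)"

abbreviation is_left_dual :: "('o, 'k, 'a, 'z) semicat_scheme \<Rightarrow> 'o \<Rightarrow> 'o \<Rightarrow> bool" where
  "is_left_dual S F G \<equiv> is_right_dual S G F"

definition rigid :: "('o, 'k, 'a, 'z) semicat_scheme \<Rightarrow> bool" where
  "rigid S \<longleftrightarrow> (\<forall>F\<in>Obj S. (\<exists>Fd. is_right_dual S F Fd) \<and> (\<exists>G. is_left_dual S F G))"


section \<open>Presheaves\<close>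

text \<open>The type \<open>'u\<close> plays the role of the universe: \<open>Vec\<close> consists of the \<open>K\<close>-vector spaces
  with carrier in \<open>'u\<close>, and the hom-spaces of the small category \<open>S\<close> are among them, so that
  representable presheaves are \<open>Vec\<close>-valued. Once \<open>'u\<close> is infinite, this universe is large
  enough for all coends below: disjointness of the hom-spaces bounds the number of objects
  of \<open>S\<close> by the cardinality of \<open>'u\<close>, and either some hom-space is nonzero, which bounds the
  cardinality of \<open>K\<close>, or all presheaves vanish.

  \<open>PAct P f : P Y \<rightarrow> P X\<close> is the action of \<open>f : X \<rightarrow> Y\<close>.\<close>

record ('o, 'k, 'u) presheaf =
  PVal :: "'o \<Rightarrow> ('k, 'u) module"
  PAct :: "'u \<Rightarrow> 'u \<Rightarrow> 'u"

definition is_presheaf ::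
  "'k ring \<Rightarrow> ('o, 'k, 'u, 'z) lincat_scheme \<Rightarrow> ('o, 'k, 'u) presheaf \<Rightarrow> bool" where
  "is_presheaf K S P \<longleftrightarrow>
     (\<forall>X\<in>Obj S. module K (PVal P X)) \<and>
     (\<forall>X\<in>Obj S. \<forall>Y\<in>Obj S. \<forall>f\<in>arr S X Y. linear_map K (PVal P Y) (PVal P X) (PAct P f)) \<and>
     (\<forall>X\<in>Obj S. \<forall>Y\<in>Obj S. \<forall>p\<in>carrier (PVal P Y).
        linear_map K (Hom S X Y) (PVal P X) (\<lambda>f. PAct P f p)) \<and>
     (\<forall>X\<in>Obj S. \<forall>p\<in>carrier (PVal P X). PAct P (Ident S X) p = p) \<and>
     (\<forall>X\<in>Obj S. \<forall>Y\<in>Obj S. \<forall>Z\<in>Obj S. \<forall>f\<in>arr S X Y. \<forall>g\<in>arr S Y Z. \<forall>p\<in>carrier (PVal P Z).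
        PAct P (g \<cdot>\<^bsub>S\<^esub> f) p = PAct P f (PAct P g p))"

text \<open>Morphisms of presheaves carry their source and target; the components are extensional, so
  that equality of morphisms is equality of all components on all elements.\<close>

type_synonym ('o, 'k, 'u) presheaf_arr =
  "('o, 'k, 'u) presheaf \<times> ('o, 'k, 'u) presheaf \<times> ('o \<Rightarrow> 'u \<Rightarrow> 'u)"

definition presheaf_arr ::
  "('o, 'k, 'u, 'z) lincat_scheme \<Rightarrow> ('o, 'k, 'u) presheaf \<Rightarrow> ('o, 'k, 'u) presheaf \<Rightarrow>
    ('o \<Rightarrow> 'u \<Rightarrow> 'u) \<Rightarrow> ('o, 'k, 'u) presheaf_arr" where
  "presheaf_arr S P Q \<theta> = (P, Q, \<lambda>X\<in>Obj S. \<lambda>p\<in>carrier (PVal P X). \<theta> X p)"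

abbreviation component :: "('o, 'k, 'u) presheaf_arr \<Rightarrow> 'o \<Rightarrow> 'u \<Rightarrow> 'u" where
  "component \<theta> \<equiv> snd (snd \<theta>)"

definition presheaf_nat ::
  "'k ring \<Rightarrow> ('o, 'k, 'u, 'z) lincat_scheme \<Rightarrow> ('o, 'k, 'u) presheaf \<Rightarrow> ('o, 'k, 'u) presheaf \<Rightarrow>
    ('o \<Rightarrow> 'u \<Rightarrow> 'u) \<Rightarrow> bool" where
  "presheaf_nat K S P Q \<theta> \<longleftrightarrow>
     (\<forall>X\<in>Obj S. linear_map K (PVal P X) (PVal Q X) (\<theta> X)) \<and>
     (\<forall>X\<in>Obj S. \<forall>Y\<in>Obj S. \<forall>f\<in>arr S X Y. \<forall>p\<in>carrier (PVal P Y).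
        \<theta> X (PAct P f p) = PAct Q f (\<theta> Y p))"

definition presheaf_Hom ::
  "'k ring \<Rightarrow> ('o, 'k, 'u, 'z) lincat_scheme \<Rightarrow> ('o, 'k, 'u) presheaf \<Rightarrow> ('o, 'k, 'u) presheaf \<Rightarrow>
    ('k, ('o, 'k, 'u) presheaf_arr) module" where
  "presheaf_Hom K S P Q =
     \<lparr>carrier = {presheaf_arr S P Q \<theta> | \<theta>. presheaf_nat K S P Q \<theta>},
      mult = undefined, one = undefined,
      zero = presheaf_arr S P Q (\<lambda>X p. \<zero>\<^bsub>PVal Q X\<^esub>),
      add = (\<lambda>\<theta> \<theta>'. presheaf_arr S P Q (\<lambda>X p. component \<theta> X p \<oplus>\<^bsub>PVal Q X\<^esub> component \<theta>' X p)),
      smult = (\<lambda>c \<theta>. presheaf_arr S P Q (\<lambda>X p. c \<odot>\<^bsub>PVal Q X\<^esub> component \<theta> X p))\<rparr>"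

definition yoneda :: "('o, 'k, 'u, 'z) lincat_scheme \<Rightarrow> 'o \<Rightarrow> ('o, 'k, 'u) presheaf" where
  "yoneda S X = \<lparr>PVal = (\<lambda>W. Hom S W X), PAct = (\<lambda>f g. g \<cdot>\<^bsub>S\<^esub> f)\<rparr>"

definition yoneda_arr ::
  "('o, 'k, 'u, 'z) lincat_scheme \<Rightarrow> 'o \<Rightarrow> 'o \<Rightarrow> 'u \<Rightarrow> ('o, 'k, 'u) presheaf_arr" where
  "yoneda_arr S X Y h = presheaf_arr S (yoneda S X) (yoneda S Y) (\<lambda>W g. h \<cdot>\<^bsub>S\<^esub> g)"


section \<open>Day convolution\<close>

text \<open>A cowedge from the functor \<open>(H, L) \<mapsto> Hom(X, H \<boxtimes> L) \<otimes> P H \<otimes> Q L\<close> of the coend to a vector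
  space \<open>W\<close>. A linear map out of the triple tensor product is given by the corresponding
  trilinear map; the last conjunct is dinaturality in \<open>(H, L)\<close>.\<close>

definition day_cowedge ::
  "'k ring \<Rightarrow> ('o, 'k, 'u, 'z) semicat_scheme \<Rightarrow> ('o, 'k, 'u) presheaf \<Rightarrow> ('o, 'k, 'u) presheaf \<Rightarrow>
    'o \<Rightarrow> ('k, 'u) module \<Rightarrow> ('o \<Rightarrow> 'o \<Rightarrow> 'u \<Rightarrow> 'u \<Rightarrow> 'u \<Rightarrow> 'u) \<Rightarrow> bool" where
  "day_cowedge K S P Q X W w \<longleftrightarrow>
     (\<forall>H\<in>Obj S. \<forall>L\<in>Obj S. \<forall>p\<in>carrier (PVal P H). \<forall>q\<in>carrier (PVal Q L).
        linear_map K (Hom S X (H \<boxtimes>\<^bsub>S\<^esub> L)) W (\<lambda>f. w H L f p q)) \<and>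
     (\<forall>H\<in>Obj S. \<forall>L\<in>Obj S. \<forall>f\<in>arr S X (H \<boxtimes>\<^bsub>S\<^esub> L). \<forall>q\<in>carrier (PVal Q L).
        linear_map K (PVal P H) W (\<lambda>p. w H L f p q)) \<and>
     (\<forall>H\<in>Obj S. \<forall>L\<in>Obj S. \<forall>f\<in>arr S X (H \<boxtimes>\<^bsub>S\<^esub> L). \<forall>p\<in>carrier (PVal P H).
        linear_map K (PVal Q L) W (\<lambda>q. w H L f p q)) \<and>
     (\<forall>H\<in>Obj S. \<forall>H'\<in>Obj S. \<forall>L\<in>Obj S. \<forall>L'\<in>Obj S. \<forall>h\<in>arr S H H'. \<forall>l\<in>arr S L L'.
        \<forall>f\<in>arr S X (H \<boxtimes>\<^bsub>S\<^esub> L). \<forall>p\<in>carrier (PVal P H'). \<forall>q\<in>carrier (PVal Q L').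
          w H' L' ((h \<boxdot>\<^bsub>S\<^esub> l) \<cdot>\<^bsub>S\<^esub> f) p q = w H L f (PAct P h p) (PAct Q l q))"

text \<open>\<open>R\<close> is the coend of \<open>P\<close> and \<open>Q\<close>, with universal cowedge \<open>\<kappa>\<close>; its presheaf structure comes
  from \<open>Hom(-, H \<boxtimes> L)\<close>.\<close>

definition is_day_convolution ::
  "'k ring \<Rightarrow> ('o, 'k, 'u, 'z) semicat_scheme \<Rightarrow> ('o, 'k, 'u) presheaf \<Rightarrow> ('o, 'k, 'u) presheaf \<Rightarrow>
    ('o, 'k, 'u) presheaf \<Rightarrow> ('o \<Rightarrow> 'o \<Rightarrow> 'u \<Rightarrow> 'u \<Rightarrow> 'u \<Rightarrow> 'u) \<Rightarrow> bool" where
  "is_day_convolution K S P Q R \<kappa> \<longleftrightarrow>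
     is_presheaf K S R \<and>
     (\<forall>X\<in>Obj S. day_cowedge K S P Q X (PVal R X) \<kappa> \<and>
        (\<forall>W w. module K W \<and> day_cowedge K S P Q X W w \<longrightarrow>
           (\<exists>!t. t \<in> extensional (carrier (PVal R X)) \<and> linear_map K (PVal R X) W t \<and>
              (\<forall>H\<in>Obj S. \<forall>L\<in>Obj S. \<forall>f\<in>arr S X (H \<boxtimes>\<^bsub>S\<^esub> L).
                 \<forall>p\<in>carrier (PVal P H). \<forall>q\<in>carrier (PVal Q L). t (\<kappa> H L f p q) = w H L f p q)))) \<and>
     (\<forall>X\<in>Obj S. \<forall>Y\<in>Obj S. \<forall>g\<in>arr S X Y. \<forall>H\<in>Obj S. \<forall>L\<in>Obj S. \<forall>f\<in>arr S Y (H \<boxtimes>\<^bsub>S\<^esub> L).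
        \<forall>p\<in>carrier (PVal P H). \<forall>q\<in>carrier (PVal Q L).
          PAct R g (\<kappa> H L f p q) = \<kappa> H L (f \<cdot>\<^bsub>S\<^esub> g) p q)"

text \<open>A choice of coends, determined up to unique isomorphism.\<close>

definition day_choice ::
  "'k ring \<Rightarrow> ('o, 'k, 'u, 'z) semicat_scheme \<Rightarrow> ('o, 'k, 'u) presheaf \<Rightarrow> ('o, 'k, 'u) presheaf \<Rightarrow>
    ('o, 'k, 'u) presheaf \<times> ('o \<Rightarrow> 'o \<Rightarrow> 'u \<Rightarrow> 'u \<Rightarrow> 'u \<Rightarrow> 'u)" where
  "day_choice K S P Q = (SOME (R, \<kappa>). is_day_convolution K S P Q R \<kappa>)"

definition day ::
  "'k ring \<Rightarrow> ('o, 'k, 'u, 'z) semicat_scheme \<Rightarrow> ('o, 'k, 'u) presheaf \<Rightarrow> ('o, 'k, 'u) presheaf \<Rightarrow>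
    ('o, 'k, 'u) presheaf" where
  "day K S P Q = fst (day_choice K S P Q)"

definition day_in ::
  "'k ring \<Rightarrow> ('o, 'k, 'u, 'z) semicat_scheme \<Rightarrow> ('o, 'k, 'u) presheaf \<Rightarrow> ('o, 'k, 'u) presheaf \<Rightarrow>
    'o \<Rightarrow> 'o \<Rightarrow> 'u \<Rightarrow> 'u \<Rightarrow> 'u \<Rightarrow> 'u" where
  "day_in K S P Q = snd (day_choice K S P Q)"

text \<open>The morphisms induced on coends: on generators, functoriality is
  \<open>f \<otimes> p \<otimes> q \<mapsto> f \<otimes> \<theta> p \<otimes> \<theta>' q\<close>, and the associator is
  \<open>f \<otimes> (g \<otimes> p \<otimes> q) \<otimes> r \<mapsto> (a \<circ> (g \<boxtimes> L) \<circ> f) \<otimes> p \<otimes> (id \<otimes> q \<otimes> r)\<close>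
  for \<open>f : X \<rightarrow> H \<boxtimes> L\<close> and \<open>g : H \<rightarrow> A \<boxtimes> B\<close>, where \<open>a\<close> is the associator of \<open>S\<close>.\<close>

definition day_arr ::
  "'k ring \<Rightarrow> ('o, 'k, 'u, 'z) semicat_scheme \<Rightarrow> ('o, 'k, 'u) presheaf_arr \<Rightarrow>
    ('o, 'k, 'u) presheaf_arr \<Rightarrow> ('o, 'k, 'u) presheaf_arr" where
  "day_arr K S \<theta> \<theta>' =
     (let P = fst \<theta>; P' = fst (snd \<theta>); Q = fst \<theta>'; Q' = fst (snd \<theta>') in
      THE \<tau>. \<tau> \<in> carrier (presheaf_Hom K S (day K S P Q) (day K S P' Q')) \<and>
        (\<forall>X\<in>Obj S. \<forall>H\<in>Obj S. \<forall>L\<in>Obj S. \<forall>f\<in>arr S X (H \<boxtimes>\<^bsub>S\<^esub> L).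
           \<forall>p\<in>carrier (PVal P H). \<forall>q\<in>carrier (PVal Q L).
             component \<tau> X (day_in K S P Q H L f p q)
               = day_in K S P' Q' H L f (component \<theta> H p) (component \<theta>' L q)))"

definition day_assoc ::
  "'k ring \<Rightarrow> ('o, 'k, 'u, 'z) semicat_scheme \<Rightarrow> ('o, 'k, 'u) presheaf \<Rightarrow> ('o, 'k, 'u) presheaf \<Rightarrow>
    ('o, 'k, 'u) presheaf \<Rightarrow> ('o, 'k, 'u) presheaf_arr" where
  "day_assoc K S P Q R =
     (THE \<tau>. \<tau> \<in> carrier (presheaf_Hom K S (day K S (day K S P Q) R) (day K S P (day K S Q R))) \<and>
        (\<forall>X\<in>Obj S. \<forall>H\<in>Obj S. \<forall>L\<in>Obj S. \<forall>A\<in>Obj S. \<forall>B\<in>Obj S.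
           \<forall>f\<in>arr S X (H \<boxtimes>\<^bsub>S\<^esub> L). \<forall>g\<in>arr S H (A \<boxtimes>\<^bsub>S\<^esub> B).
           \<forall>p\<in>carrier (PVal P A). \<forall>q\<in>carrier (PVal Q B). \<forall>r\<in>carrier (PVal R L).
             component \<tau> X (day_in K S (day K S P Q) R H L f (day_in K S P Q A B g p q) r)
               = day_in K S P (day K S Q R) A (B \<boxtimes>\<^bsub>S\<^esub> L)
                   (Assoc S A B L \<cdot>\<^bsub>S\<^esub> (g \<boxdot>\<^bsub>S\<^esub> Ident S L) \<cdot>\<^bsub>S\<^esub> f)
                   p (day_in K S Q R B L (Ident S (B \<boxtimes>\<^bsub>S\<^esub> L)) q r)))"

definition presheaf_category ::
  "'k ring \<Rightarrow> ('o, 'k, 'u, 'z) semicat_scheme \<Rightarrow>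
    (('o, 'k, 'u) presheaf, 'k, ('o, 'k, 'u) presheaf_arr) semicat" where
  "presheaf_category K S =
     \<lparr>Obj = {P. is_presheaf K S P},
      Hom = presheaf_Hom K S,
      Comp = (\<lambda>\<theta>' \<theta>. presheaf_arr S (fst \<theta>) (fst (snd \<theta>'))
                (\<lambda>X p. component \<theta>' X (component \<theta> X p))),
      Ident = (\<lambda>P. presheaf_arr S P P (\<lambda>X p. p)),
      TObj = day K S,
      TArr = day_arr K S,
      Assoc = day_assoc K S\<rparr>"

end

theory Submission
  imports Defs
begin

text \<open>
  Write \<open>T = FF\<^sup>\<diamond>\<close>. Up to an associator the two parallel maps are \<open>\<epsilon>\<^sup>r\<^sub>T\<close> and \<open>\<epsilon>\<^sup>l\<^sub>T\<close>. Liberality of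
  \<open>F \<boxtimes> -\<close> and the triangle identities split every counit \<open>\<epsilon>\<^sup>r\<^sub>X : TX \<rightarrow> X\<close>, and taking mates at a left
  dual splits every \<open>\<epsilon>\<^sup>l\<^sub>X : XT \<rightarrow> X\<close>; no naturality of the sections is needed. Hence the image \<open>U\<close> of
  \<open>Hom(-, T) \<rightarrow> Hom(T \<boxtimes> -, T)\<close>, \<open>a \<mapsto> \<epsilon>\<^sup>l\<^sub>T (T \<boxtimes> a)\<close>, is a coequalizer: \<open>a = \<epsilon>\<^sup>r\<^sub>T h\<close> for
  \<open>h = (T \<boxtimes> a) s\<close>, while \<open>\<epsilon>\<^sup>l\<^sub>T h\<close> only depends on the image of \<open>a\<close>. Moreover every presheaf \<open>P\<close> is
  itself a Day convolution of \<open>U\<close> and \<open>P\<close>, with cowedge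
  \<open>f \<otimes> [a] \<otimes> p \<mapsto> P (\<epsilon>\<^sup>r\<^sub>L (a \<boxtimes> L) f) p\<close> for \<open>f : X \<rightarrow> H \<boxtimes> L\<close>: a cowedge \<open>w\<close> factors uniquely
  through \<open>p \<mapsto> w (s\<^sub>X \<otimes> [id] \<otimes> p)\<close>. The other side is the same statement for the reversed tensor
  product, and the triangle axiom is axiom (IV). Units and coequalizers are unique up to isomorphism.
\<close>

section \<open>Linear maps\<close>

text \<open>The formula for \<open>U\<close> is best read in the monoidal case. With a unit
  \<open>I\<close>, the counit is a map \<epsilon> from T to \<open>I\<close>, and both counit
  transformations tensor with it. Splitting at \<open>I\<close> makes \<epsilon> a split
  epimorphism, and \<open>a\<close> goes to T tensored with \<epsilon> a, so the image is a copy of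
  Hom(-, \<open>I\<close>). The formula still makes sense when \<open>I\<close> is absent.

  Two obstacles shape the rest. The tensor product, its action on morphisms and the associator of
  \<open>PSh\<close> are given by \<open>SOME\<close> and \<open>THE\<close>, so nothing is known of
  them until coends have been built inside the type of arrows and shown to determine maps by their
  values on generators; after that, each identity of presheaf morphisms becomes one between arrows
  of \<open>S\<close>. Moreover \<open>U\<close> is described one-sidedly, yet must be a unit on
  both sides. The link is that the pair \<open>a\<close>, \<open>\<sigma> H (q H a)\<close> has the
  form \<open>e \<cdot> h\<close>, \<open>e' \<cdot> h\<close>, a relation that survives the
  exchange of left and right.\<close>

lemma linear_mapI:
  assumes "\<And>x. x \<in> carrier M \<Longrightarrow> t x \<in> carrier N"
    and "\<And>x y. x \<in> carrier M \<Longrightarrow> y \<in> carrier M \<Longrightarrow> t (x \<oplus>\<^bsub>M\<^esub> y) = t x \<oplus>\<^bsub>N\<^esub> t y"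
    and "\<And>c x. c \<in> carrier K \<Longrightarrow> x \<in> carrier M \<Longrightarrow> t (c \<odot>\<^bsub>M\<^esub> x) = c \<odot>\<^bsub>N\<^esub> t x"
  shows "linear_map K M N t"
  using assms unfolding linear_map_def by auto

lemma linear_map_closed: "linear_map K M N t \<Longrightarrow> x \<in> carrier M \<Longrightarrow> t x \<in> carrier N"
  unfolding linear_map_def by auto

lemma linear_map_add:
  "linear_map K M N t \<Longrightarrow> x \<in> carrier M \<Longrightarrow> y \<in> carrier M \<Longrightarrow> t (x \<oplus>\<^bsub>M\<^esub> y) = t x \<oplus>\<^bsub>N\<^esub> t y"
  unfolding linear_map_def by auto

lemma linear_map_smult:
  "linear_map K M N t \<Longrightarrow> c \<in> carrier K \<Longrightarrow> x \<in> carrier M \<Longrightarrow> t (c \<odot>\<^bsub>M\<^esub> x) = c \<odot>\<^bsub>N\<^esub> t x"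
  unfolding linear_map_def by auto

lemma linear_map_compose:
  assumes "linear_map K M N s" "linear_map K N L t"
  shows "linear_map K M L (\<lambda>x. t (s x))"
  using assms unfolding linear_map_def by (auto simp: Pi_iff)

lemma linear_map_cong:
  assumes "module K M" "linear_map K M N s" "\<And>x. x \<in> carrier M \<Longrightarrow> s x = t x"
  shows "linear_map K M N t"
proof -
  interpret M: module K M by fact
  show ?thesis using assms(2,3) unfolding linear_map_def by (auto simp: Pi_iff)
qed

lemma linear_map_sum:
  assumes "module K N" "linear_map K M N s" "linear_map K M N t"
  shows "linear_map K M N (\<lambda>x. s x \<oplus>\<^bsub>N\<^esub> t x)"
proof -
  interpret N: module K N by fact
  note st = linear_map_closed[OF assms(2)] linear_map_closed[OF assms(3)]
  show ?thesis
    by (rule linear_mapI)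
      (auto simp: st linear_map_add[OF assms(2)] linear_map_add[OF assms(3)]
        linear_map_smult[OF assms(2)] linear_map_smult[OF assms(3)] N.smult_r_distr N.a_ac)
qed

lemma linear_map_scale:
  assumes "module K N" "linear_map K M N s" "c \<in> carrier K"
  shows "linear_map K M N (\<lambda>x. c \<odot>\<^bsub>N\<^esub> s x)"
proof -
  interpret N: module K N by fact
  note s = linear_map_closed[OF assms(2)]
  show ?thesis
    by (rule linear_mapI)
      (auto simp: s assms(3) linear_map_add[OF assms(2)] linear_map_smult[OF assms(2)]
        N.smult_r_distr N.smult_assoc1[symmetric] N.m_comm)
qed

lemma linear_map_id: "linear_map K M M (\<lambda>x. x)"
  by (rule linear_mapI) auto

lemma linear_map_zero:
  assumes "module K M" "module K N" "linear_map K M N t"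
  shows "t \<zero>\<^bsub>M\<^esub> = \<zero>\<^bsub>N\<^esub>"
proof -
  interpret M: module K M by fact
  interpret N: module K N by fact
  have "t \<zero>\<^bsub>M\<^esub> \<oplus>\<^bsub>N\<^esub> t \<zero>\<^bsub>M\<^esub> = t \<zero>\<^bsub>M\<^esub>"
    using linear_map_add[OF assms(3) M.zero_closed M.zero_closed] by simp
  moreover have "t \<zero>\<^bsub>M\<^esub> \<in> carrier N" by (simp add: linear_map_closed[OF assms(3)])
  ultimately show ?thesis
    using N.add.l_cancel_one' by metis
qed

lemma linear_map_finsum:
  assumes "module K M" "module K N" "linear_map K M N t" "finite A" "g \<in> A \<rightarrow> carrier M"
  shows "t (\<Oplus>\<^bsub>M\<^esub>i\<in>A. g i) = (\<Oplus>\<^bsub>N\<^esub>i\<in>A. t (g i))"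
proof -
  interpret M: module K M by fact
  interpret N: module K N by fact
  show ?thesis using assms(4,5)
  proof (induction A rule: finite_induct)
    case empty
    then show ?case by (simp add: linear_map_zero[OF assms(1-3)])
  next
    case (insert a A)
    then have "g \<in> A \<rightarrow> carrier M" "g a \<in> carrier M" by auto
    moreover have "(\<lambda>i. t (g i)) \<in> A \<rightarrow> carrier N" "t (g a) \<in> carrier N"
      using calculation linear_map_closed[OF assms(3)] by (auto simp: Pi_iff)
    ultimately show ?case using insert
      by (simp add: M.finsum_insert N.finsum_insert linear_map_add[OF assms(3)])
  qed
qed

lemma module_restrict_carrier:
  assumes "module K M" "A \<subseteq> carrier M" "\<zero>\<^bsub>M\<^esub> \<in> A"
    and "\<And>x y. x \<in> A \<Longrightarrow> y \<in> A \<Longrightarrow> x \<oplus>\<^bsub>M\<^esub> y \<in> A"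
    and smult: "\<And>c x. c \<in> carrier K \<Longrightarrow> x \<in> A \<Longrightarrow> c \<odot>\<^bsub>M\<^esub> x \<in> A"
  shows "module K (M\<lparr>carrier := A\<rparr>)"
proof -
  interpret M: module K M by fact
  have "\<ominus>\<^bsub>M\<^esub> x \<in> A" if "x \<in> A" for x
  proof -
    have "\<ominus>\<^bsub>M\<^esub> x = (\<ominus>\<^bsub>K\<^esub> \<one>\<^bsub>K\<^esub>) \<odot>\<^bsub>M\<^esub> x"
      using that assms(2) by (simp add: M.smult_l_minus subset_iff)
    then show ?thesis using smult[of "\<ominus>\<^bsub>K\<^esub> \<one>\<^bsub>K\<^esub>" x] that by simp
  qed
  then have "submodule A K M" by (intro M.submoduleI assms) auto
  then show ?thesis using submodule.submodule_is_module assms(1) by blast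
qed

lemma linear_map_restrict_carrier:
  assumes "linear_map K M N t" "A \<subseteq> carrier M"
  shows "linear_map K (M\<lparr>carrier := A\<rparr>) N t"
  using assms unfolding linear_map_def by (auto simp: subset_iff)


section \<open>Linear categories and presheaves\<close>

context linear_category
begin

lemma comp_closed [intro]:
  assumes "X \<in> Obj C" "Y \<in> Obj C" "Z \<in> Obj C" "f \<in> arr C X Y" "g \<in> arr C Y Z"
  shows "g \<cdot>\<^bsub>C\<^esub> f \<in> arr C X Z"
  using comp_linear_right[of X Y Z g] assms linear_map_closed by fastforce

text \<open>The description in \<open>inv_arr\<close> ranges over all pairs of objects, so
  uniqueness of inverses alone does not suffice: disjointness of the hom-spaces first pins the pair
  down.\<close>

lemma inv_arr_inverse:
  assumes "X \<in> Obj C" "Y \<in> Obj C" "is_iso C X Y f"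
  shows "inverse_arrows C X Y f (inv_arr C f)"
proof -
  obtain g where g: "inverse_arrows C X Y f g" using assms unfolding is_iso_def by blast
  have "g' = g" if X': "X' \<in> Obj C" "Y' \<in> Obj C" and g': "inverse_arrows C X' Y' f g'" for X' Y' g'
  proof -
    have f: "f \<in> arr C X Y" "f \<in> arr C X' Y'" using g g' unfolding inverse_arrows_def by auto
    have XY: "X' = X" "Y' = Y" using hom_disjoint[OF assms(1,2) X' f] by auto
    have "g' = g' \<cdot>\<^bsub>C\<^esub> (f \<cdot>\<^bsub>C\<^esub> g)"
      using g g' assms comp_ident_right[of Y X g'] unfolding inverse_arrows_def XY by auto
    also have "\<dots> = (g' \<cdot>\<^bsub>C\<^esub> f) \<cdot>\<^bsub>C\<^esub> g"
      using g g' assms comp_assoc[of Y X Y X g f g'] unfolding inverse_arrows_def XY by auto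
    also have "\<dots> = g"
      using g g' assms comp_ident_left[of Y X g] unfolding inverse_arrows_def XY by auto
    finally show ?thesis .
  qed
  then have "inv_arr C f = g"
    unfolding inv_arr_def using g assms by (intro the_equality) blast+
  then show ?thesis using g by simp
qed

lemma presheafI:
  assumes "\<And>X. X \<in> Obj C \<Longrightarrow> module K (PVal P X)"
    and "\<And>X Y f. \<lbrakk>X \<in> Obj C; Y \<in> Obj C; f \<in> arr C X Y\<rbrakk> \<Longrightarrow> linear_map K (PVal P Y) (PVal P X) (PAct P f)"
    and "\<And>X Y p. \<lbrakk>X \<in> Obj C; Y \<in> Obj C; p \<in> carrier (PVal P Y)\<rbrakk>
      \<Longrightarrow> linear_map K (Hom C X Y) (PVal P X) (\<lambda>f. PAct P f p)"
    and "\<And>X p. \<lbrakk>X \<in> Obj C; p \<in> carrier (PVal P X)\<rbrakk> \<Longrightarrow> PAct P (Ident C X) p = p"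
    and "\<And>X Y Z f g p. \<lbrakk>X \<in> Obj C; Y \<in> Obj C; Z \<in> Obj C; f \<in> arr C X Y; g \<in> arr C Y Z; p \<in> carrier (PVal P Z)\<rbrakk>
      \<Longrightarrow> PAct P (g \<cdot>\<^bsub>C\<^esub> f) p = PAct P f (PAct P g p)"
  shows "is_presheaf K C P"
  unfolding is_presheaf_def by (intro conjI ballI) (rule assms; assumption)+

lemma presheaf_module: "is_presheaf K C P \<Longrightarrow> X \<in> Obj C \<Longrightarrow> module K (PVal P X)"
  unfolding is_presheaf_def by blast

lemma presheaf_linear:
  "\<lbrakk>is_presheaf K C P; X \<in> Obj C; Y \<in> Obj C; f \<in> arr C X Y\<rbrakk>
    \<Longrightarrow> linear_map K (PVal P Y) (PVal P X) (PAct P f)"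
  unfolding is_presheaf_def by blast

lemma presheaf_linear_arr:
  "\<lbrakk>is_presheaf K C P; X \<in> Obj C; Y \<in> Obj C; p \<in> carrier (PVal P Y)\<rbrakk>
    \<Longrightarrow> linear_map K (Hom C X Y) (PVal P X) (\<lambda>f. PAct P f p)"
  unfolding is_presheaf_def by blast

lemma presheaf_closed:
  "\<lbrakk>is_presheaf K C P; X \<in> Obj C; Y \<in> Obj C; f \<in> arr C X Y; p \<in> carrier (PVal P Y)\<rbrakk>
    \<Longrightarrow> PAct P f p \<in> carrier (PVal P X)"
  using presheaf_linear linear_map_closed by metis

lemma presheaf_ident:
  "\<lbrakk>is_presheaf K C P; X \<in> Obj C; p \<in> carrier (PVal P X)\<rbrakk> \<Longrightarrow> PAct P (Ident C X) p = p"
  unfolding is_presheaf_def by blast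

lemma presheaf_comp:
  "\<lbrakk>is_presheaf K C P; X \<in> Obj C; Y \<in> Obj C; Z \<in> Obj C; f \<in> arr C X Y; g \<in> arr C Y Z; p \<in> carrier (PVal P Z)\<rbrakk>
    \<Longrightarrow> PAct P (g \<cdot>\<^bsub>C\<^esub> f) p = PAct P f (PAct P g p)"
  unfolding is_presheaf_def by blast

lemma presheaf_natI:
  assumes "\<And>X. X \<in> Obj C \<Longrightarrow> linear_map K (PVal P X) (PVal Q X) (\<theta> X)"
    and "\<And>X Y f p. \<lbrakk>X \<in> Obj C; Y \<in> Obj C; f \<in> arr C X Y; p \<in> carrier (PVal P Y)\<rbrakk>
      \<Longrightarrow> \<theta> X (PAct P f p) = PAct Q f (\<theta> Y p)"
  shows "presheaf_nat K C P Q \<theta>"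
  unfolding presheaf_nat_def using assms by blast

lemma presheaf_nat_linear:
  "presheaf_nat K C P Q \<theta> \<Longrightarrow> X \<in> Obj C \<Longrightarrow> linear_map K (PVal P X) (PVal Q X) (\<theta> X)"
  unfolding presheaf_nat_def by blast

lemma presheaf_nat_closed:
  "presheaf_nat K C P Q \<theta> \<Longrightarrow> X \<in> Obj C \<Longrightarrow> p \<in> carrier (PVal P X) \<Longrightarrow> \<theta> X p \<in> carrier (PVal Q X)"
  using presheaf_nat_linear linear_map_closed by metis

lemma presheaf_nat_natural:
  "\<lbrakk>presheaf_nat K C P Q \<theta>; X \<in> Obj C; Y \<in> Obj C; f \<in> arr C X Y; p \<in> carrier (PVal P Y)\<rbrakk>
    \<Longrightarrow> \<theta> X (PAct P f p) = PAct Q f (\<theta> Y p)"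
  unfolding presheaf_nat_def by blast

lemma presheaf_nat_compose:
  assumes "presheaf_nat K C P Q \<theta>" "presheaf_nat K C Q R \<theta>'"
  shows "presheaf_nat K C P R (\<lambda>X p. \<theta>' X (\<theta> X p))"
proof (rule presheaf_natI)
  fix X assume "X \<in> Obj C"
  then show "linear_map K (PVal P X) (PVal R X) (\<lambda>p. \<theta>' X (\<theta> X p))"
    using linear_map_compose presheaf_nat_linear assms by metis
qed (simp add: presheaf_nat_natural[OF assms(1)] presheaf_nat_natural[OF assms(2)]
    presheaf_nat_closed[OF assms(1)])

lemma presheaf_nat_id: "presheaf_nat K C P P (\<lambda>X p. p)"
  by (rule presheaf_natI) (auto intro: linear_map_id)

end


section \<open>Sources and targets of arrows\<close>

context linear_category
begin

definition arrow :: "'a \<Rightarrow> bool" where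
  "arrow f \<longleftrightarrow> (\<exists>X\<in>Obj C. \<exists>Y\<in>Obj C. f \<in> arr C X Y)"

text \<open>Since hom-spaces are disjoint, an arrow determines its endpoints. Typing conditions
  thereby become equations between objects, which the simplifier can discharge without being told
  the intermediate objects.\<close>

definition src :: "'a \<Rightarrow> 'o" where
  "src f = (SOME X. X \<in> Obj C \<and> (\<exists>Y\<in>Obj C. f \<in> arr C X Y))"

definition trg :: "'a \<Rightarrow> 'o" where
  "trg f = (SOME Y. Y \<in> Obj C \<and> (\<exists>X\<in>Obj C. f \<in> arr C X Y))"

lemma arrowI:
  assumes XY: "X \<in> Obj C" "Y \<in> Obj C" "f \<in> arr C X Y"
  shows "arrow f" "src f = X" "trg f = Y"
proof -
  show "arrow f" unfolding arrow_def by (intro bexI[of _ X] bexI[of _ Y] XY)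
  show "src f = X" unfolding src_def
  proof (rule some_equality)
    fix X' assume "X' \<in> Obj C \<and> (\<exists>Y\<in>Obj C. f \<in> arr C X' Y)"
    then obtain Y' where "X' \<in> Obj C" "Y' \<in> Obj C" "f \<in> arr C X' Y'" by (elim conjE bexE)
    then show "X' = X" using hom_disjoint[of X' Y' X Y f] XY by simp
  qed (intro conjI bexI[of _ Y] XY)
  show "trg f = Y" unfolding trg_def
  proof (rule some_equality)
    fix Y' assume "Y' \<in> Obj C \<and> (\<exists>X\<in>Obj C. f \<in> arr C X Y')"
    then obtain X' where "X' \<in> Obj C" "Y' \<in> Obj C" "f \<in> arr C X' Y'" by (elim conjE bexE)
    then show "Y' = Y" using hom_disjoint[of X' Y' X Y f] XY by simp
  qed (intro conjI bexI[of _ X] XY)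
qed

lemma arrowE:
  assumes "arrow f"
  shows "src f \<in> Obj C" "trg f \<in> Obj C" "f \<in> arr C (src f) (trg f)"
proof -
  obtain X Y where XY: "X \<in> Obj C" "Y \<in> Obj C" "f \<in> arr C X Y"
    using assms unfolding arrow_def by (elim bexE)
  then show "src f \<in> Obj C" "trg f \<in> Obj C" "f \<in> arr C (src f) (trg f)"
    by (simp_all add: arrowI[OF XY])
qed

lemma in_arr_iff:
  assumes "X \<in> Obj C" "Y \<in> Obj C"
  shows "f \<in> arr C X Y \<longleftrightarrow> arrow f \<and> src f = X \<and> trg f = Y"
  using arrowI[OF assms, of f] arrowE[of f] by metis

lemma arrow_comp:
  assumes "arrow f" "arrow g" "src g = trg f"
  shows "arrow (g \<cdot>\<^bsub>C\<^esub> f)" "src (g \<cdot>\<^bsub>C\<^esub> f) = src f" "trg (g \<cdot>\<^bsub>C\<^esub> f) = trg g"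
proof -
  note f = arrowE[OF assms(1)] and g = arrowE[OF assms(2)]
  have "g \<cdot>\<^bsub>C\<^esub> f \<in> arr C (src f) (trg g)"
    by (rule comp_closed[of _ "trg f"]) (use f g assms(3) in simp_all)
  then show "arrow (g \<cdot>\<^bsub>C\<^esub> f)" "src (g \<cdot>\<^bsub>C\<^esub> f) = src f" "trg (g \<cdot>\<^bsub>C\<^esub> f) = trg g"
    using arrowI f g by blast+
qed

lemma arrow_ident:
  assumes "X \<in> Obj C"
  shows "arrow (Ident C X)" "src (Ident C X) = X" "trg (Ident C X) = X"
  using arrowI[OF assms assms ident_arr[OF assms]] .

lemma arrow_comp_ident:
  "arrow f \<Longrightarrow> X = src f \<Longrightarrow> f \<cdot>\<^bsub>C\<^esub> Ident C X = f"
  "arrow f \<Longrightarrow> X = trg f \<Longrightarrow> Ident C X \<cdot>\<^bsub>C\<^esub> f = f"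
  using arrowE comp_ident_right comp_ident_left by blast+

lemma arrow_comp_assoc:
  assumes "arrow f" "arrow g" "arrow h" "src g = trg f" "src h = trg g"
  shows "(h \<cdot>\<^bsub>C\<^esub> g) \<cdot>\<^bsub>C\<^esub> f = h \<cdot>\<^bsub>C\<^esub> (g \<cdot>\<^bsub>C\<^esub> f)"
  by (rule comp_assoc[of "src f" "trg f" "trg g" "trg h"])
    (use arrowE[OF assms(1)] arrowE[OF assms(2)] arrowE[OF assms(3)] assms(4,5) in simp_all)

text \<open>As rewrite rules these bracket composites to the right and erase identities, computing
  endpoints on the way.\<close>

lemmas arrow_simps = arrowE(1,2) arrow_comp arrow_ident arrow_comp_ident arrow_comp_assoc

end


section \<open>The category of presheaves\<close>

text \<open>Composition is left to \<open>presheaf_arr_comp'\<close>, whose naturality premise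
  ensures that the inner family lands where the outer one is not cut off by
  \<open>restrict\<close>.\<close>

lemma presheaf_category_simps [simp]:
  "Obj (presheaf_category K S) = {P. is_presheaf K S P}"
  "Hom (presheaf_category K S) = presheaf_Hom K S"
  "Ident (presheaf_category K S) P = presheaf_arr S P P (\<lambda>X p. p)"
  "P \<boxtimes>\<^bsub>presheaf_category K S\<^esub> Q = day K S P Q"
  "TArr (presheaf_category K S) = day_arr K S"
  "Assoc (presheaf_category K S) = day_assoc K S"
  by (simp_all add: presheaf_category_def)

lemma presheaf_arr_eqI:
  assumes "\<And>X p. X \<in> Obj S \<Longrightarrow> p \<in> carrier (PVal P X) \<Longrightarrow> \<theta> X p = \<theta>' X p"
  shows "presheaf_arr S P Q \<theta> = presheaf_arr S P Q \<theta>'"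
  unfolding presheaf_arr_def using assms by (auto intro!: restrict_ext simp: fun_eq_iff restrict_def)

lemma presheaf_arr_eqD:
  assumes "presheaf_arr S P Q \<theta> = presheaf_arr S P' Q' \<theta>'" "X \<in> Obj S" "p \<in> carrier (PVal P X)"
  shows "\<theta> X p = \<theta>' X p"
proof -
  have "P' = P" using assms(1) unfolding presheaf_arr_def by simp
  then have "(\<lambda>X\<in>Obj S. \<lambda>p\<in>carrier (PVal P X). \<theta> X p) X p = (\<lambda>X\<in>Obj S. \<lambda>p\<in>carrier (PVal P X). \<theta>' X p) X p"
    using assms(1) unfolding presheaf_arr_def by simp
  then show ?thesis using assms(2,3) by simp
qed

lemma fst_presheaf_arr [simp]: "fst (presheaf_arr S P Q \<theta>) = P"
  and fst_snd_presheaf_arr [simp]: "fst (snd (presheaf_arr S P Q \<theta>)) = Q"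
  by (simp_all add: presheaf_arr_def)

lemma component_presheaf_arr [simp]:
  "X \<in> Obj S \<Longrightarrow> p \<in> carrier (PVal P X) \<Longrightarrow> component (presheaf_arr S P Q \<theta>) X p = \<theta> X p"
  by (simp add: presheaf_arr_def)

lemma arr_presheaf_Hom: "carrier (presheaf_Hom K S P Q) = {presheaf_arr S P Q \<theta> | \<theta>. presheaf_nat K S P Q \<theta>}"
  by (simp add: presheaf_Hom_def)

lemma presheaf_arr_in_Hom [intro]:
  "presheaf_nat K S P Q \<theta> \<Longrightarrow> presheaf_arr S P Q \<theta> \<in> carrier (presheaf_Hom K S P Q)"
  by (auto simp: arr_presheaf_Hom)

text \<open>This is the part of a semigroup category that survives reversal of the tensor product:
  \<open>rev_tensor\<close> below does not adapt the associator. Coends and the left unit argument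
  are developed at this level so that they apply to both orders.\<close>

locale tensor_category = linear_category K S
  for K :: "'k ring" and S :: "('o, 'k, 'a, 'z) semicat_scheme" (structure) +
  assumes tensor_obj: "\<lbrakk>X \<in> Obj S; Y \<in> Obj S\<rbrakk> \<Longrightarrow> X \<boxtimes> Y \<in> Obj S"
    and tensor_ident:
      "\<lbrakk>X \<in> Obj S; Y \<in> Obj S\<rbrakk> \<Longrightarrow> Ident S X \<boxdot> Ident S Y = Ident S (X \<boxtimes> Y)"
    and tensor_comp:
      "\<lbrakk>X \<in> Obj S; X' \<in> Obj S; X'' \<in> Obj S; Y \<in> Obj S; Y' \<in> Obj S; Y'' \<in> Obj S;
        f \<in> arr S X X'; f' \<in> arr S X' X''; g \<in> arr S Y Y'; g' \<in> arr S Y' Y''\<rbrakk>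
        \<Longrightarrow> (f' \<cdot> f) \<boxdot> (g' \<cdot> g) = (f' \<boxdot> g') \<cdot> (f \<boxdot> g)"
    and tensor_linear_left:
      "\<lbrakk>X \<in> Obj S; X' \<in> Obj S; Y \<in> Obj S; Y' \<in> Obj S; g \<in> arr S Y Y'\<rbrakk>
        \<Longrightarrow> linear_map K (Hom S X X') (Hom S (X \<boxtimes> Y) (X' \<boxtimes> Y')) (\<lambda>f. f \<boxdot> g)"
    and tensor_linear_right:
      "\<lbrakk>X \<in> Obj S; X' \<in> Obj S; Y \<in> Obj S; Y' \<in> Obj S; f \<in> arr S X X'\<rbrakk>
        \<Longrightarrow> linear_map K (Hom S Y Y') (Hom S (X \<boxtimes> Y) (X' \<boxtimes> Y')) (\<lambda>g. f \<boxdot> g)"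

sublocale semigroup_category \<subseteq> tensor_category
  by unfold_locales (fact tensor_obj tensor_ident tensor_comp tensor_linear_left tensor_linear_right)+

context tensor_category
begin

abbreviation "PSh \<equiv> presheaf_category K S"

lemma presheaf_arr_comp:
  assumes "presheaf_nat K S P Q \<theta>"
  shows "presheaf_arr S Q' R \<theta>' \<cdot>\<^bsub>PSh\<^esub> presheaf_arr S P Q \<theta>
    = presheaf_arr S P R (\<lambda>X p. component (presheaf_arr S Q' R \<theta>') X (\<theta> X p))"
  by (auto simp: presheaf_category_def intro!: presheaf_arr_eqI)

lemma presheaf_arr_comp':
  assumes "presheaf_nat K S P Q \<theta>"
  shows "presheaf_arr S Q R \<theta>' \<cdot>\<^bsub>PSh\<^esub> presheaf_arr S P Q \<theta> = presheaf_arr S P R (\<lambda>X p. \<theta>' X (\<theta> X p))"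
  unfolding presheaf_arr_comp[OF assms]
  by (intro presheaf_arr_eqI) (simp add: presheaf_nat_closed[OF assms])

lemma presheaf_inverse_arrowsI:
  assumes "presheaf_nat K S P Q \<theta>" "presheaf_nat K S Q P \<theta>'"
    and "\<And>X p. X \<in> Obj S \<Longrightarrow> p \<in> carrier (PVal P X) \<Longrightarrow> \<theta>' X (\<theta> X p) = p"
    and "\<And>X p. X \<in> Obj S \<Longrightarrow> p \<in> carrier (PVal Q X) \<Longrightarrow> \<theta> X (\<theta>' X p) = p"
  shows "inverse_arrows PSh P Q (presheaf_arr S P Q \<theta>) (presheaf_arr S Q P \<theta>')"
  unfolding inverse_arrows_def
  using assms by (auto simp: presheaf_arr_comp' intro!: presheaf_arr_eqI)

lemma presheaf_isomorphicE:
  assumes "isomorphic PSh P Q"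
  obtains \<theta> \<theta>' where "presheaf_nat K S P Q \<theta>" "presheaf_nat K S Q P \<theta>'"
    "\<And>X p. X \<in> Obj S \<Longrightarrow> p \<in> carrier (PVal P X) \<Longrightarrow> \<theta>' X (\<theta> X p) = p"
    "\<And>X p. X \<in> Obj S \<Longrightarrow> p \<in> carrier (PVal Q X) \<Longrightarrow> \<theta> X (\<theta>' X p) = p"
proof -
  obtain f g where fg: "inverse_arrows PSh P Q f g"
    using assms unfolding isomorphic_def is_iso_def by blast
  then obtain \<theta> \<theta>' where f: "f = presheaf_arr S P Q \<theta>" "presheaf_nat K S P Q \<theta>"
    and g: "g = presheaf_arr S Q P \<theta>'" "presheaf_nat K S Q P \<theta>'"
    unfolding inverse_arrows_def by (auto simp: arr_presheaf_Hom)
  show ?thesis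
  proof (rule that[OF f(2) g(2)])
    fix X p assume Xp: "X \<in> Obj S" "p \<in> carrier (PVal P X)"
    have "presheaf_arr S P P (\<lambda>X p. \<theta>' X (\<theta> X p)) = presheaf_arr S P P (\<lambda>X p. p)"
      using fg unfolding inverse_arrows_def f(1) g(1) by (simp add: presheaf_arr_comp'[OF f(2)])
    from presheaf_arr_eqD[OF this Xp] show "\<theta>' X (\<theta> X p) = p" .
  next
    fix X p assume Xp: "X \<in> Obj S" "p \<in> carrier (PVal Q X)"
    have "presheaf_arr S Q Q (\<lambda>X p. \<theta> X (\<theta>' X p)) = presheaf_arr S Q Q (\<lambda>X p. p)"
      using fg unfolding inverse_arrows_def f(1) g(1) by (simp add: presheaf_arr_comp'[OF g(2)])
    from presheaf_arr_eqD[OF this Xp] show "\<theta> X (\<theta>' X p) = p" .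
  qed
qed

lemma presheaf_isomorphicI:
  assumes "presheaf_nat K S P Q \<theta>" "presheaf_nat K S Q P \<theta>'"
    and "\<And>X p. X \<in> Obj S \<Longrightarrow> p \<in> carrier (PVal P X) \<Longrightarrow> \<theta>' X (\<theta> X p) = p"
    and "\<And>X p. X \<in> Obj S \<Longrightarrow> p \<in> carrier (PVal Q X) \<Longrightarrow> \<theta> X (\<theta>' X p) = p"
  shows "isomorphic PSh P Q"
  using presheaf_inverse_arrowsI[OF assms] unfolding isomorphic_def is_iso_def by blast

lemma presheaf_isomorphic_sym:
  assumes "isomorphic PSh P Q"
  shows "isomorphic PSh Q P"
  by (rule presheaf_isomorphicE[OF assms]) (rule presheaf_isomorphicI)

lemma presheaf_isomorphic_trans:
  assumes "isomorphic PSh P Q" "isomorphic PSh Q R"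
  shows "isomorphic PSh P R"
proof -
  obtain \<theta> \<theta>' where 1: "presheaf_nat K S P Q \<theta>" "presheaf_nat K S Q P \<theta>'"
    "\<And>X p. X \<in> Obj S \<Longrightarrow> p \<in> carrier (PVal P X) \<Longrightarrow> \<theta>' X (\<theta> X p) = p"
    "\<And>X p. X \<in> Obj S \<Longrightarrow> p \<in> carrier (PVal Q X) \<Longrightarrow> \<theta> X (\<theta>' X p) = p"
    by (rule presheaf_isomorphicE[OF assms(1)]) blast
  obtain \<zeta> \<zeta>' where 2: "presheaf_nat K S Q R \<zeta>" "presheaf_nat K S R Q \<zeta>'"
    "\<And>X p. X \<in> Obj S \<Longrightarrow> p \<in> carrier (PVal Q X) \<Longrightarrow> \<zeta>' X (\<zeta> X p) = p"
    "\<And>X p. X \<in> Obj S \<Longrightarrow> p \<in> carrier (PVal R X) \<Longrightarrow> \<zeta> X (\<zeta>' X p) = p"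
    by (rule presheaf_isomorphicE[OF assms(2)]) blast
  show ?thesis
    by (rule presheaf_isomorphicI[OF presheaf_nat_compose[OF 1(1) 2(1)] presheaf_nat_compose[OF 2(2) 1(2)]])
      (use 1 2 presheaf_nat_closed[OF 1(1)] presheaf_nat_closed[OF 2(2)] in auto)
qed

lemma presheaf_coequalizer_arrE:
  assumes "is_coequalizer PSh A B f g Q q"
  obtains \<xi> where "q = presheaf_arr S B Q \<xi>" "presheaf_nat K S B Q \<xi>"
proof -
  have "q \<in> arr PSh B Q" using assms unfolding is_coequalizer_def by blast
  then show ?thesis using that by (auto simp: arr_presheaf_Hom)
qed

text \<open>The usual argument from the universal property, carried out on component families, since
  \<open>PSh\<close> has not been established as an instance of
  \<open>linear_category\<close>.\<close>

lemma presheaf_coequalizer_unique: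
  assumes "is_coequalizer PSh A B f g Q q" "is_coequalizer PSh A B f g Q' q'"
  shows "isomorphic PSh Q Q'"
proof -
  have half: "\<exists>\<theta>. presheaf_nat K S Q Q' \<theta> \<and> presheaf_arr S Q Q' \<theta> \<cdot>\<^bsub>PSh\<^esub> q = q'"
    if "is_coequalizer PSh A B f g Q q" "is_coequalizer PSh A B f g Q' q'" for Q q Q' q'
  proof -
    have "\<exists>u. u \<in> arr PSh Q Q' \<and> u \<cdot>\<^bsub>PSh\<^esub> q = q'"
      using that unfolding is_coequalizer_def by blast
    then show ?thesis by (auto simp: arr_presheaf_Hom)
  qed
  \<comment> \<open>The universal property applied to \<open>q\<close> itself: an endomorphism of
    the coequalizer that fixes \<open>q\<close> is the identity.\<close>
  have uniq: "\<theta> X p = p" if Q: "is_coequalizer PSh A B f g Q q" and \<theta>: "presheaf_nat K S Q Q \<theta>"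
    "presheaf_arr S Q Q \<theta> \<cdot>\<^bsub>PSh\<^esub> q = q" and Xp: "X \<in> Obj S" "p \<in> carrier (PVal Q X)" for Q q \<theta> X p
  proof -
    obtain \<xi> where \<xi>: "q = presheaf_arr S B Q \<xi>" "presheaf_nat K S B Q \<xi>"
      by (rule presheaf_coequalizer_arrE[OF Q])
    have "presheaf_arr S Q Q (\<lambda>X p. p) \<cdot>\<^bsub>PSh\<^esub> q = q"
      using \<xi> by (simp add: presheaf_arr_comp')
    moreover have "\<exists>!u. u \<in> arr PSh Q Q \<and> u \<cdot>\<^bsub>PSh\<^esub> q = q"
      using Q unfolding is_coequalizer_def by blast
    moreover have "presheaf_arr S Q Q \<theta> \<in> arr PSh Q Q" "presheaf_arr S Q Q (\<lambda>X p. p) \<in> arr PSh Q Q"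
      using \<theta>(1) presheaf_nat_id by auto
    ultimately have "presheaf_arr S Q Q \<theta> = presheaf_arr S Q Q (\<lambda>X p. p)"
      using \<theta>(2) by blast
    from presheaf_arr_eqD[OF this Xp] show ?thesis .
  qed
  obtain \<theta> where \<theta>: "presheaf_nat K S Q Q' \<theta>" "presheaf_arr S Q Q' \<theta> \<cdot>\<^bsub>PSh\<^esub> q = q'"
    using half[OF assms] by blast
  obtain \<theta>' where \<theta>': "presheaf_nat K S Q' Q \<theta>'" "presheaf_arr S Q' Q \<theta>' \<cdot>\<^bsub>PSh\<^esub> q' = q"
    using half[OF assms(2,1)] by blast
  have comp: "presheaf_arr S Q1 Q1 (\<lambda>X p. \<zeta>' X (\<zeta> X p)) \<cdot>\<^bsub>PSh\<^esub> q1 = q1"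
    if q1: "is_coequalizer PSh A B f g Q1 q1"
      and \<zeta>: "presheaf_nat K S Q1 Q2 \<zeta>" "presheaf_arr S Q1 Q2 \<zeta> \<cdot>\<^bsub>PSh\<^esub> q1 = q2"
      and \<zeta>': "presheaf_nat K S Q2 Q1 \<zeta>'" "presheaf_arr S Q2 Q1 \<zeta>' \<cdot>\<^bsub>PSh\<^esub> q2 = q1"
    for Q1 q1 Q2 q2 \<zeta> \<zeta>'
  proof -
    obtain \<xi> where \<xi>: "q1 = presheaf_arr S B Q1 \<xi>" "presheaf_nat K S B Q1 \<xi>"
      by (rule presheaf_coequalizer_arrE[OF q1])
    have q2: "q2 = presheaf_arr S B Q2 (\<lambda>X p. \<zeta> X (\<xi> X p))"
      using \<zeta>(2) \<xi> by (simp add: presheaf_arr_comp')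
    have "q1 = presheaf_arr S B Q1 (\<lambda>X p. \<zeta>' X (\<zeta> X (\<xi> X p)))"
      using \<zeta>'(2) unfolding q2 by (simp add: presheaf_arr_comp'[OF presheaf_nat_compose[OF \<xi>(2) \<zeta>(1)]])
    then show ?thesis using \<xi>(1) presheaf_arr_comp'[OF \<xi>(2)] by simp
  qed
  show ?thesis
    by (rule presheaf_isomorphicI[OF \<theta>(1) \<theta>'(1)
          uniq[OF assms(1) presheaf_nat_compose[OF \<theta>(1) \<theta>'(1)] comp[OF assms(1) \<theta> \<theta>']]
          uniq[OF assms(2) presheaf_nat_compose[OF \<theta>'(1) \<theta>(1)] comp[OF assms(2) \<theta>' \<theta>]]])
qed

end

section \<open>Existence of Day convolutions\<close>

lemma ex1_unique: "\<exists>!x. P x \<Longrightarrow> P a \<Longrightarrow> P b \<Longrightarrow> a = b"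
  by blast

text \<open>An infinite type is in bijection with its square, so a list can be folded into one
  element by nested pairing.\<close>

lemma infinite_inj_list:
  assumes "infinite (UNIV :: 'u set)"
  shows "\<exists>\<phi> :: 'u list \<Rightarrow> 'u. inj \<phi>"
proof -
  have "(card_of (UNIV \<times> UNIV :: ('u \<times> 'u) set), card_of (UNIV :: 'u set)) \<in> ordIso"
    by (rule card_of_Times_same_infinite[OF assms])
  then have "\<exists>pr :: 'u \<times> 'u \<Rightarrow> 'u. bij_betw pr (UNIV \<times> UNIV) UNIV"
    by (rule iffD2[OF card_of_ordIso])
  then obtain pr :: "'u \<times> 'u \<Rightarrow> 'u" where "bij_betw pr (UNIV \<times> UNIV) UNIV"
    by (rule exE)
  then have "inj pr" by (simp add: bij_betw_def)
  then have pr: "pr (a, b) = pr (c, d) \<longleftrightarrow> a = c \<and> b = d" for a b c d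
    by (simp add: inj_eq)
  obtain \<nu> :: "nat \<Rightarrow> 'u" where \<nu>: "inj \<nu>"
    using infinite_countable_subset[OF assms] by blast
  \<comment> \<open>The value \<open>\<nu> 0\<close> is a mere end marker. The folding is compared
    only for lists of equal length, so the final code records the length as well.\<close>
  define enc where "enc = (\<lambda>xs. foldr (\<lambda>x a. pr (x, a)) xs (\<nu> 0))"
  have "xs = ys" if "length xs = length ys" "enc xs = enc ys" for xs ys
    using that by (induction xs ys rule: list_induct2) (auto simp: enc_def pr)
  then have "inj (\<lambda>xs. pr (\<nu> (length xs), enc xs))"
    using \<nu> by (auto simp: inj_on_def pr)
  then show ?thesis by blast
qed

text \<open>The carrier of the quotient consists of codes of representatives, so that the quotient lives in the
  universe \<open>'u\<close> although the elements of \<open>L\<close> need not.\<close>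

lemma joint_quotient_module:
  fixes N :: "'i \<Rightarrow> ('k, 'b) module" and \<phi> :: "'l \<Rightarrow> 'u" and K :: "'k ring"
  assumes K: "cring K" and inj: "inj_on \<phi> L"
    and N: "\<And>i. i \<in> I \<Longrightarrow> module K (N i)"
    and ev: "\<And>i x. i \<in> I \<Longrightarrow> x \<in> L \<Longrightarrow> ev i x \<in> carrier (N i)"
    and zero: "z \<in> L" "\<And>i. i \<in> I \<Longrightarrow> ev i z = \<zero>\<^bsub>N i\<^esub>"
    and add: "\<And>x y. x \<in> L \<Longrightarrow> y \<in> L \<Longrightarrow> \<exists>s\<in>L. \<forall>i\<in>I. ev i s = ev i x \<oplus>\<^bsub>N i\<^esub> ev i y"
    and scale: "\<And>c x. c \<in> carrier K \<Longrightarrow> x \<in> L \<Longrightarrow> \<exists>s\<in>L. \<forall>i\<in>I. ev i s = c \<odot>\<^bsub>N i\<^esub> ev i x"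
  obtains M :: "('k, 'u) module" and \<pi> :: "'l \<Rightarrow> 'u" and t
  where "module K M" "carrier M = \<pi> ` L"
    "\<And>i. i \<in> I \<Longrightarrow> linear_map K M (N i) (t i)"
    "\<And>i x. i \<in> I \<Longrightarrow> x \<in> L \<Longrightarrow> t i (\<pi> x) = ev i x"
    "\<And>u v. \<lbrakk>u \<in> carrier M; v \<in> carrier M; \<And>i. i \<in> I \<Longrightarrow> t i u = t i v\<rbrakk> \<Longrightarrow> u = v"
proof -
  interpret K: cring K by fact
  \<comment> \<open>Elements of \<open>L\<close> with the same evaluations define the same
    predicate, so \<open>SOME\<close> returns the same representative for them; this makes
    \<open>\<pi>\<close> constant on classes.\<close>
  define \<pi> where "\<pi> x = \<phi> (SOME y. y \<in> L \<and> (\<forall>i\<in>I. ev i y = ev i x))" for x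
  have choice: "(SOME y. y \<in> L \<and> (\<forall>i\<in>I. ev i y = ev i x)) \<in> L \<and>
      (\<forall>i\<in>I. ev i (SOME y. y \<in> L \<and> (\<forall>i\<in>I. ev i y = ev i x)) = ev i x)" if "x \<in> L" for x
    by (rule someI[where x = x]) (use that in auto)
  have \<pi>_eq: "\<pi> x = \<pi> y \<longleftrightarrow> (\<forall>i\<in>I. ev i x = ev i y)" if "x \<in> L" "y \<in> L" for x y
  proof
    assume "\<forall>i\<in>I. ev i x = ev i y"
    then have "(\<lambda>w. w \<in> L \<and> (\<forall>i\<in>I. ev i w = ev i x)) = (\<lambda>w. w \<in> L \<and> (\<forall>i\<in>I. ev i w = ev i y))"
      by auto
    then show "\<pi> x = \<pi> y" unfolding \<pi>_def by simp
  next
    assume "\<pi> x = \<pi> y"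
    then show "\<forall>i\<in>I. ev i x = ev i y"
      unfolding \<pi>_def using inj choice[OF that(1)] choice[OF that(2)] by (auto dest!: inj_onD)
  qed
  define dec where "dec v = (SOME x. x \<in> L \<and> \<pi> x = v)" for v
  have dec: "dec (\<pi> x) \<in> L" "\<pi> (dec (\<pi> x)) = \<pi> x" if "x \<in> L" for x
    using someI[of "\<lambda>y. y \<in> L \<and> \<pi> y = \<pi> x" x] that unfolding dec_def by auto
  define t where "t i v = ev i (dec v)" for i v
  have t: "t i (\<pi> x) = ev i x" if "i \<in> I" "x \<in> L" for i x
    unfolding t_def using \<pi>_eq[of "dec (\<pi> x)" x] dec[OF that(2)] that by blast
  obtain pl where pl: "\<And>x y. x \<in> L \<Longrightarrow> y \<in> L \<Longrightarrow> pl x y \<in> L"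
    "\<And>x y i. x \<in> L \<Longrightarrow> y \<in> L \<Longrightarrow> i \<in> I \<Longrightarrow> ev i (pl x y) = ev i x \<oplus>\<^bsub>N i\<^esub> ev i y"
    using add by metis
  obtain sc where sc: "\<And>c x. c \<in> carrier K \<Longrightarrow> x \<in> L \<Longrightarrow> sc c x \<in> L"
    "\<And>c x i. c \<in> carrier K \<Longrightarrow> x \<in> L \<Longrightarrow> i \<in> I \<Longrightarrow> ev i (sc c x) = c \<odot>\<^bsub>N i\<^esub> ev i x"
    using scale by metis
  define M :: "('k, 'u) module" where "M = \<lparr>carrier = \<pi> ` L, mult = undefined, one = undefined,
    zero = \<pi> z, add = (\<lambda>u v. \<pi> (pl (dec u) (dec v))), smult = (\<lambda>c u. \<pi> (sc c (dec u)))\<rparr>"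
  have M: "carrier M = \<pi> ` L" "\<zero>\<^bsub>M\<^esub> = \<pi> z" "u \<oplus>\<^bsub>M\<^esub> v = \<pi> (pl (dec u) (dec v))"
    "c \<odot>\<^bsub>M\<^esub> u = \<pi> (sc c (dec u))" for c u v
    by (simp_all add: M_def)
  have decM: "dec u \<in> L" if "u \<in> carrier M" for u
    using that dec by (auto simp: M)
  \<comment> \<open>The maps \<open>t i\<close> jointly separate points. Every module axiom below is
    therefore checked after applying \<open>t i\<close>, inside the module
    \<open>N i\<close>.\<close>
  have sep: "u = v" if "u \<in> carrier M" "v \<in> carrier M" "\<And>i. i \<in> I \<Longrightarrow> t i u = t i v" for u v
    using that \<pi>_eq by (auto simp: M t)
  have tN: "t i u \<in> carrier (N i)" if "i \<in> I" "u \<in> carrier M" for i u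
    using that ev by (auto simp: M t)
  have closed: "u \<oplus>\<^bsub>M\<^esub> v \<in> carrier M" "\<zero>\<^bsub>M\<^esub> \<in> carrier M"
    if "u \<in> carrier M" "v \<in> carrier M" for u v
    using that decM pl zero by (auto simp: M(1,2,3))
  have closed': "c \<odot>\<^bsub>M\<^esub> u \<in> carrier M" if "u \<in> carrier M" "c \<in> carrier K" for c u
    using that decM sc by (auto simp: M(1,4))
  have t_add: "t i (u \<oplus>\<^bsub>M\<^esub> v) = t i u \<oplus>\<^bsub>N i\<^esub> t i v" if "i \<in> I" "u \<in> carrier M" "v \<in> carrier M" for i u v
    using that decM[OF that(2)] decM[OF that(3)] pl by (simp add: M(3) t) (simp add: t_def)
  have t_smult: "t i (c \<odot>\<^bsub>M\<^esub> u) = c \<odot>\<^bsub>N i\<^esub> t i u" if "i \<in> I" "u \<in> carrier M" "c \<in> carrier K" for i u c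
    using that decM[OF that(2)] sc by (simp add: M(4) t) (simp add: t_def)
  have t_zero: "t i \<zero>\<^bsub>M\<^esub> = \<zero>\<^bsub>N i\<^esub>" if "i \<in> I" for i
    using that zero by (simp add: M t)
  have zM: "\<zero>\<^bsub>M\<^esub> \<in> carrier M" using zero by (auto simp: M)
  have group: "abelian_group M"
  proof (rule abelian_groupI)
    fix u assume u: "u \<in> carrier M"
    show "\<exists>y\<in>carrier M. y \<oplus>\<^bsub>M\<^esub> u = \<zero>\<^bsub>M\<^esub>"
    \<comment> \<open>No negation was assumed on \<open>L\<close>; scaling by minus one supplies
      it.\<close>
    proof (rule bexI[of _ "(\<ominus>\<^bsub>K\<^esub> \<one>\<^bsub>K\<^esub>) \<odot>\<^bsub>M\<^esub> u"])
      show "(\<ominus>\<^bsub>K\<^esub> \<one>\<^bsub>K\<^esub>) \<odot>\<^bsub>M\<^esub> u \<oplus>\<^bsub>M\<^esub> u = \<zero>\<^bsub>M\<^esub>"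
      proof (rule sep)
        fix i assume i: "i \<in> I"
        interpret Ni: module K "N i" using N[OF i] .
        show "t i ((\<ominus>\<^bsub>K\<^esub> \<one>\<^bsub>K\<^esub>) \<odot>\<^bsub>M\<^esub> u \<oplus>\<^bsub>M\<^esub> u) = t i \<zero>\<^bsub>M\<^esub>"
          using i u closed' tN[OF i u] by (simp add: t_add t_smult t_zero Ni.smult_l_minus Ni.l_neg)
      qed (use u closed closed' in auto)
    qed (use u closed' in auto)
  next
    fix u v w assume uvw: "u \<in> carrier M" "v \<in> carrier M" "w \<in> carrier M"
    show "u \<oplus>\<^bsub>M\<^esub> v \<oplus>\<^bsub>M\<^esub> w = u \<oplus>\<^bsub>M\<^esub> (v \<oplus>\<^bsub>M\<^esub> w)"
    proof (rule sep)
      fix i assume i: "i \<in> I"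
      interpret Ni: module K "N i" using N[OF i] .
      show "t i (u \<oplus>\<^bsub>M\<^esub> v \<oplus>\<^bsub>M\<^esub> w) = t i (u \<oplus>\<^bsub>M\<^esub> (v \<oplus>\<^bsub>M\<^esub> w))"
        using i uvw closed tN[OF i] by (simp add: t_add Ni.a_assoc)
    qed (use uvw closed in auto)
  next
    fix u v assume uv: "u \<in> carrier M" "v \<in> carrier M"
    show "u \<oplus>\<^bsub>M\<^esub> v = v \<oplus>\<^bsub>M\<^esub> u"
    proof (rule sep)
      fix i assume i: "i \<in> I"
      interpret Ni: module K "N i" using N[OF i] .
      show "t i (u \<oplus>\<^bsub>M\<^esub> v) = t i (v \<oplus>\<^bsub>M\<^esub> u)"
        using i uv tN[OF i] by (simp add: t_add Ni.a_comm)
    qed (use uv closed in auto)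
  next
    fix u assume u: "u \<in> carrier M"
    show "\<zero>\<^bsub>M\<^esub> \<oplus>\<^bsub>M\<^esub> u = u"
    proof (rule sep)
      fix i assume i: "i \<in> I"
      interpret Ni: module K "N i" using N[OF i] .
      show "t i (\<zero>\<^bsub>M\<^esub> \<oplus>\<^bsub>M\<^esub> u) = t i u"
        using i u zM tN[OF i] by (simp add: t_add t_zero)
    qed (use u zM closed in auto)
  qed (use closed zM in auto)
  have modM: "module K M"
  proof (rule moduleI[OF K group])
    fix a b u assume ab: "a \<in> carrier K" "b \<in> carrier K" and u: "u \<in> carrier M"
    show "(a \<oplus>\<^bsub>K\<^esub> b) \<odot>\<^bsub>M\<^esub> u = a \<odot>\<^bsub>M\<^esub> u \<oplus>\<^bsub>M\<^esub> b \<odot>\<^bsub>M\<^esub> u"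
    proof (rule sep)
      fix i assume i: "i \<in> I"
      interpret Ni: module K "N i" using N[OF i] .
      show "t i ((a \<oplus>\<^bsub>K\<^esub> b) \<odot>\<^bsub>M\<^esub> u) = t i (a \<odot>\<^bsub>M\<^esub> u \<oplus>\<^bsub>M\<^esub> b \<odot>\<^bsub>M\<^esub> u)"
        using i u ab closed' tN[OF i] by (simp add: t_add t_smult Ni.smult_l_distr)
    qed (use u ab closed closed' in auto)
    show "(a \<otimes>\<^bsub>K\<^esub> b) \<odot>\<^bsub>M\<^esub> u = a \<odot>\<^bsub>M\<^esub> (b \<odot>\<^bsub>M\<^esub> u)"
    proof (rule sep)
      fix i assume i: "i \<in> I"
      interpret Ni: module K "N i" using N[OF i] .
      show "t i ((a \<otimes>\<^bsub>K\<^esub> b) \<odot>\<^bsub>M\<^esub> u) = t i (a \<odot>\<^bsub>M\<^esub> (b \<odot>\<^bsub>M\<^esub> u))"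
        using i u ab closed' tN[OF i] by (simp add: t_smult Ni.smult_assoc1)
    qed (use u ab closed closed' in auto)
  next
    fix a u v assume a: "a \<in> carrier K" and u: "u \<in> carrier M" and v: "v \<in> carrier M"
    show "a \<odot>\<^bsub>M\<^esub> (u \<oplus>\<^bsub>M\<^esub> v) = a \<odot>\<^bsub>M\<^esub> u \<oplus>\<^bsub>M\<^esub> a \<odot>\<^bsub>M\<^esub> v"
    proof (rule sep)
      fix i assume i: "i \<in> I"
      interpret Ni: module K "N i" using N[OF i] .
      show "t i (a \<odot>\<^bsub>M\<^esub> (u \<oplus>\<^bsub>M\<^esub> v)) = t i (a \<odot>\<^bsub>M\<^esub> u \<oplus>\<^bsub>M\<^esub> a \<odot>\<^bsub>M\<^esub> v)"
        using i u v a closed closed' tN[OF i] by (simp add: t_add t_smult Ni.smult_r_distr)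
    qed (use u v a closed closed' in auto)
  next
    fix u assume u: "u \<in> carrier M"
    show "\<one>\<^bsub>K\<^esub> \<odot>\<^bsub>M\<^esub> u = u"
    proof (rule sep)
      fix i assume i: "i \<in> I"
      interpret Ni: module K "N i" using N[OF i] .
      show "t i (\<one>\<^bsub>K\<^esub> \<odot>\<^bsub>M\<^esub> u) = t i u"
        using i u tN[OF i] by (simp add: t_smult)
    qed (use u closed' in auto)
  qed (use closed' in auto)
  have lin: "linear_map K M (N i) (t i)" if "i \<in> I" for i
    by (rule linear_mapI) (use that in \<open>auto simp: tN t_add t_smult\<close>)
  show ?thesis by (rule that[OF modM M(1) lin t sep])
qed

section \<open>Tensor products of arrows, cowedges and coends\<close>

context tensor_category
begin

lemma tensor_closed [intro]:
  assumes "X \<in> Obj S" "X' \<in> Obj S" "Y \<in> Obj S" "Y' \<in> Obj S" "f \<in> arr S X X'" "g \<in> arr S Y Y'"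
  shows "f \<boxdot> g \<in> arr S (X \<boxtimes> Y) (X' \<boxtimes> Y')"
  using linear_map_closed[OF tensor_linear_left[of X X' Y Y' g]] assms by blast

lemma arrow_tensor:
  assumes "arrow f" "arrow g"
  shows "arrow (f \<boxdot> g)" "src (f \<boxdot> g) = src f \<boxtimes> src g" "trg (f \<boxdot> g) = trg f \<boxtimes> trg g"
proof -
  note f = arrowE[OF assms(1)] and g = arrowE[OF assms(2)]
  have "f \<boxdot> g \<in> arr S (src f \<boxtimes> src g) (trg f \<boxtimes> trg g)"
    by (rule tensor_closed) (use f g in simp_all)
  then show "arrow (f \<boxdot> g)" "src (f \<boxdot> g) = src f \<boxtimes> src g" "trg (f \<boxdot> g) = trg f \<boxtimes> trg g"
    using arrowI[OF tensor_obj[OF f(1) g(1)] tensor_obj[OF f(2) g(2)]] by blast+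
qed

lemma arrow_interchange:
  assumes "arrow f" "arrow g" "arrow f'" "arrow g'" "src f' = trg f" "src g' = trg g"
  shows "(f' \<boxdot> g') \<cdot> (f \<boxdot> g) = (f' \<cdot> f) \<boxdot> (g' \<cdot> g)"
  by (rule tensor_comp[of "src f" "trg f" "trg f'" "src g" "trg g" "trg g'", symmetric])
    (use arrowE[OF assms(1)] arrowE[OF assms(2)] arrowE[OF assms(3)] arrowE[OF assms(4)] assms(5,6) in simp_all)

lemma arrow_interchange_assoc:
  assumes "arrow f" "arrow g" "arrow f'" "arrow g'" "src f' = trg f" "src g' = trg g"
    "arrow k" "trg k = src f \<boxtimes> src g"
  shows "(f' \<boxdot> g') \<cdot> ((f \<boxdot> g) \<cdot> k) = ((f' \<cdot> f) \<boxdot> (g' \<cdot> g)) \<cdot> k"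
  using arrow_interchange[OF assms(1-6)] assms by (simp add: arrow_tensor flip: arrow_comp_assoc)

lemmas tensor_simps = arrow_simps arrow_tensor tensor_obj tensor_ident
text \<open>Kept apart from \<open>tensor_simps\<close>, so that each calculation decides whether
  composites of tensors are to be merged.\<close>

lemmas interchange_simps = arrow_interchange arrow_interchange_assoc

lemma day_cowedgeI:
  assumes "\<And>H L p q. \<lbrakk>H \<in> Obj S; L \<in> Obj S; p \<in> carrier (PVal P H); q \<in> carrier (PVal Q L)\<rbrakk>
      \<Longrightarrow> linear_map K (Hom S X (H \<boxtimes> L)) W (\<lambda>f. w H L f p q)"
    and "\<And>H L f q. \<lbrakk>H \<in> Obj S; L \<in> Obj S; f \<in> arr S X (H \<boxtimes> L); q \<in> carrier (PVal Q L)\<rbrakk>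
      \<Longrightarrow> linear_map K (PVal P H) W (\<lambda>p. w H L f p q)"
    and "\<And>H L f p. \<lbrakk>H \<in> Obj S; L \<in> Obj S; f \<in> arr S X (H \<boxtimes> L); p \<in> carrier (PVal P H)\<rbrakk>
      \<Longrightarrow> linear_map K (PVal Q L) W (\<lambda>q. w H L f p q)"
    and "\<And>H H' L L' h l f p q. \<lbrakk>H \<in> Obj S; H' \<in> Obj S; L \<in> Obj S; L' \<in> Obj S; h \<in> arr S H H'; l \<in> arr S L L';
        f \<in> arr S X (H \<boxtimes> L); p \<in> carrier (PVal P H'); q \<in> carrier (PVal Q L')\<rbrakk>
      \<Longrightarrow> w H' L' ((h \<boxdot> l) \<cdot> f) p q = w H L f (PAct P h p) (PAct Q l q)"
  shows "day_cowedge K S P Q X W w"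
  unfolding day_cowedge_def by (intro conjI ballI) (rule assms; assumption)+

lemma day_cowedge_linear_arr:
  "\<lbrakk>day_cowedge K S P Q X W w; H \<in> Obj S; L \<in> Obj S; p \<in> carrier (PVal P H); q \<in> carrier (PVal Q L)\<rbrakk>
    \<Longrightarrow> linear_map K (Hom S X (H \<boxtimes> L)) W (\<lambda>f. w H L f p q)"
  unfolding day_cowedge_def by simp

lemma day_cowedge_linear_left:
  "\<lbrakk>day_cowedge K S P Q X W w; H \<in> Obj S; L \<in> Obj S; f \<in> arr S X (H \<boxtimes> L); q \<in> carrier (PVal Q L)\<rbrakk>
    \<Longrightarrow> linear_map K (PVal P H) W (\<lambda>p. w H L f p q)"
  unfolding day_cowedge_def by simp

lemma day_cowedge_linear_right:
  "\<lbrakk>day_cowedge K S P Q X W w; H \<in> Obj S; L \<in> Obj S; f \<in> arr S X (H \<boxtimes> L); p \<in> carrier (PVal P H)\<rbrakk>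
    \<Longrightarrow> linear_map K (PVal Q L) W (\<lambda>q. w H L f p q)"
  unfolding day_cowedge_def by simp

lemma day_cowedge_dinatural:
  "\<lbrakk>day_cowedge K S P Q X W w; H \<in> Obj S; H' \<in> Obj S; L \<in> Obj S; L' \<in> Obj S; h \<in> arr S H H'; l \<in> arr S L L';
    f \<in> arr S X (H \<boxtimes> L); p \<in> carrier (PVal P H'); q \<in> carrier (PVal Q L')\<rbrakk>
    \<Longrightarrow> w H' L' ((h \<boxdot> l) \<cdot> f) p q = w H L f (PAct P h p) (PAct Q l q)"
  unfolding day_cowedge_def by simp

lemma day_cowedge_closed:
  "\<lbrakk>day_cowedge K S P Q X W w; H \<in> Obj S; L \<in> Obj S; f \<in> arr S X (H \<boxtimes> L);
    p \<in> carrier (PVal P H); q \<in> carrier (PVal Q L)\<rbrakk> \<Longrightarrow> w H L f p q \<in> carrier W"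
  using day_cowedge_linear_right linear_map_closed by metis

lemma day_cowedge_compose:
  assumes w: "day_cowedge K S P Q X W w" and t: "linear_map K W W' t"
  shows "day_cowedge K S P Q X W' (\<lambda>H L f p q. t (w H L f p q))"
  by (rule day_cowedgeI)
    (simp_all add: linear_map_compose[OF day_cowedge_linear_arr[OF w] t]
      linear_map_compose[OF day_cowedge_linear_left[OF w] t]
      linear_map_compose[OF day_cowedge_linear_right[OF w] t] day_cowedge_dinatural[OF w])

lemma day_cowedge_precompose:
  assumes w: "day_cowedge K S P Q X W w" and XY: "X \<in> Obj S" "Y \<in> Obj S" "g \<in> arr S X Y"
  shows "day_cowedge K S P Q Y W (\<lambda>H L f p q. w H L (f \<cdot> g) p q)"
proof (rule day_cowedgeI)
  fix H L p q assume a: "H \<in> Obj S" "L \<in> Obj S" "p \<in> carrier (PVal P H)" "q \<in> carrier (PVal Q L)"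
  show "linear_map K (Hom S Y (H \<boxtimes> L)) W (\<lambda>f. w H L (f \<cdot> g) p q)"
    by (rule linear_map_compose[OF comp_linear_left day_cowedge_linear_arr[OF w]])
      (use a XY tensor_obj in auto)
next
  fix H H' L L' h l f p q
  assume a: "H \<in> Obj S" "H' \<in> Obj S" "L \<in> Obj S" "L' \<in> Obj S" "h \<in> arr S H H'" "l \<in> arr S L L'"
    "f \<in> arr S Y (H \<boxtimes> L)" "p \<in> carrier (PVal P H')" "q \<in> carrier (PVal Q L')"
  have "(h \<boxdot> l) \<cdot> f \<cdot> g = (h \<boxdot> l) \<cdot> (f \<cdot> g)"
    by (rule comp_assoc[of X Y "H \<boxtimes> L" "H' \<boxtimes> L'"]) (use a XY tensor_obj in auto)
  then show "w H' L' ((h \<boxdot> l) \<cdot> f \<cdot> g) p q = w H L (f \<cdot> g) (PAct P h p) (PAct Q l q)"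
    using day_cowedge_dinatural[OF w a(1-6) _ a(8,9), of "f \<cdot> g"] a XY tensor_obj
      comp_closed[of X Y "H \<boxtimes> L" g f] by simp
next
  fix H L f q assume a: "H \<in> Obj S" "L \<in> Obj S" "f \<in> arr S Y (H \<boxtimes> L)" "q \<in> carrier (PVal Q L)"
  show "linear_map K (PVal P H) W (\<lambda>p. w H L (f \<cdot> g) p q)"
    by (rule day_cowedge_linear_left[OF w]) (use a XY tensor_obj in auto)
next
  fix H L f p assume a: "H \<in> Obj S" "L \<in> Obj S" "f \<in> arr S Y (H \<boxtimes> L)" "p \<in> carrier (PVal P H)"
  show "linear_map K (PVal Q L) W (\<lambda>q. w H L (f \<cdot> g) p q)"
    by (rule day_cowedge_linear_right[OF w]) (use a XY tensor_obj in auto)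
qed

abbreviation agree where
  "agree P Q X t \<kappa> w \<equiv> \<forall>H\<in>Obj S. \<forall>L\<in>Obj S. \<forall>f\<in>arr S X (H \<boxtimes> L).
     \<forall>p\<in>carrier (PVal P H). \<forall>q\<in>carrier (PVal Q L). t (\<kappa> H L f p q) = w H L f p q"

text \<open>The unique existence among extensional maps is separated into existence of a lift and
  pointwise uniqueness on the carrier. Lifts can then be given by plain formulas whose values off
  the carrier are irrelevant.\<close>

definition is_coend ::
  "('o, 'k, 'a) presheaf \<Rightarrow> ('o, 'k, 'a) presheaf \<Rightarrow> 'o \<Rightarrow> ('k, 'a) module \<Rightarrow>
    ('o \<Rightarrow> 'o \<Rightarrow> 'a \<Rightarrow> 'a \<Rightarrow> 'a \<Rightarrow> 'a) \<Rightarrow> bool" where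
  "is_coend P Q X M \<kappa> \<longleftrightarrow>
     module K M \<and> day_cowedge K S P Q X M \<kappa> \<and>
     (\<forall>(W :: ('k, 'a) module) w. module K W \<and> day_cowedge K S P Q X W w \<longrightarrow>
        (\<exists>t. linear_map K M W t \<and> agree P Q X t \<kappa> w)) \<and>
     (\<forall>(W :: ('k, 'a) module) t t'. module K W \<and> linear_map K M W t \<and> linear_map K M W t' \<and>
        agree P Q X t \<kappa> (\<lambda>H L f p q. t' (\<kappa> H L f p q))
        \<longrightarrow> (\<forall>m\<in>carrier M. t m = t' m))"

lemma coend_lift:
  assumes "is_coend P Q X M \<kappa>" "module K W" "day_cowedge K S P Q X W w"
  obtains t where "linear_map K M W t"
    "\<And>H L f p q. \<lbrakk>H \<in> Obj S; L \<in> Obj S; f \<in> arr S X (H \<boxtimes> L); p \<in> carrier (PVal P H); q \<in> carrier (PVal Q L)\<rbrakk>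
      \<Longrightarrow> t (\<kappa> H L f p q) = w H L f p q"
proof -
  have "\<exists>t. linear_map K M W t \<and> agree P Q X t \<kappa> w"
    using assms unfolding is_coend_def by simp
  then show ?thesis using that by metis
qed

lemma coend_unique:
  fixes W :: "('k, 'a) module"
  assumes "is_coend P Q X M \<kappa>" "module K W" "linear_map K M W t" "linear_map K M W t'"
    and "\<And>H L f p q. \<lbrakk>H \<in> Obj S; L \<in> Obj S; f \<in> arr S X (H \<boxtimes> L); p \<in> carrier (PVal P H); q \<in> carrier (PVal Q L)\<rbrakk>
      \<Longrightarrow> t (\<kappa> H L f p q) = t' (\<kappa> H L f p q)"
    and "m \<in> carrier M"
  shows "t m = t' m"
proof -
  have "\<forall>(W :: ('k, 'a) module) t t'. module K W \<and> linear_map K M W t \<and> linear_map K M W t' \<and>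
        agree P Q X t \<kappa> (\<lambda>H L f p q. t' (\<kappa> H L f p q))
        \<longrightarrow> (\<forall>m\<in>carrier M. t m = t' m)"
    using assms(1) unfolding is_coend_def by (elim conjE)
  from this[rule_format, of W t t'] show ?thesis using assms by simp
qed

text \<open>Restricting a map to the carrier makes it extensional and changes neither linearity nor
  its values on generators.\<close>

lemma is_day_convolution_iff_coend:
  "is_day_convolution K S P Q R \<kappa> \<longleftrightarrow>
     is_presheaf K S R \<and> (\<forall>X\<in>Obj S. is_coend P Q X (PVal R X) \<kappa>) \<and>
     (\<forall>X\<in>Obj S. \<forall>Y\<in>Obj S. \<forall>g\<in>arr S X Y. \<forall>H\<in>Obj S. \<forall>L\<in>Obj S. \<forall>f\<in>arr S Y (H \<boxtimes> L).
        \<forall>p\<in>carrier (PVal P H). \<forall>q\<in>carrier (PVal Q L).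
          PAct R g (\<kappa> H L f p q) = \<kappa> H L (f \<cdot> g) p q)"
  (is "?L = ?R")
proof -
  have "(day_cowedge K S P Q X M \<kappa> \<and>
      (\<forall>W w. module K W \<and> day_cowedge K S P Q X W w \<longrightarrow>
        (\<exists>!t. t \<in> extensional (carrier M) \<and> linear_map K M W t \<and> agree P Q X t \<kappa> w)))
    \<longleftrightarrow> is_coend P Q X M \<kappa>" (is "_ \<and> ?U \<longleftrightarrow> _") if M: "module K M" and X: "X \<in> Obj S" for X M
  proof (intro iffI; (elim conjE)?)
    assume cw: "day_cowedge K S P Q X M \<kappa>" and U: ?U
    show "is_coend P Q X M \<kappa>"
      unfolding is_coend_def
    proof (intro conjI allI impI ballI M cw; (elim conjE)?)
      fix W w assume "module K W" "day_cowedge K S P Q X W w"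
      then have "\<exists>t. t \<in> extensional (carrier M) \<and> linear_map K M W t \<and> agree P Q X t \<kappa> w"
        by (intro ex1_implies_ex[OF U[rule_format, of W w]] conjI)
      then show "\<exists>t. linear_map K M W t \<and> agree P Q X t \<kappa> w"
        by (rule ex_forward) (rule conjunct2)
    next
      fix W :: "('k, 'a) module" and t t' m
      assume W: "module K W" and t: "linear_map K M W t" and t': "linear_map K M W t'" and m: "m \<in> carrier M"
        and eq: "agree P Q X t \<kappa> (\<lambda>H L f p q. t' (\<kappa> H L f p q))"
      \<comment> \<open>Composing the universal cowedge with \<open>t\<close> gives a cowedge
        through which the restrictions of \<open>t\<close> and of \<open>t'\<close> both factor;
        uniqueness identifies them.\<close>
      let ?Q = "\<lambda>s. s \<in> extensional (carrier M) \<and> linear_map K M W s \<and> agree P Q X s \<kappa> (\<lambda>H L f p q. t (\<kappa> H L f p q))"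
      have ex1: "\<exists>!s. ?Q s"
        by (rule U[rule_format, of W "\<lambda>H L f p q. t (\<kappa> H L f p q)"]) (intro conjI W day_cowedge_compose[OF cw t])
      have Qt: "?Q (restrict t (carrier M))"
        using linear_map_cong[OF M t, of "restrict t (carrier M)"] by (simp add: day_cowedge_closed[OF cw])
      have Qt': "?Q (restrict t' (carrier M))"
        using linear_map_cong[OF M t', of "restrict t' (carrier M)"] eq by (simp add: day_cowedge_closed[OF cw])
      have "restrict t (carrier M) = restrict t' (carrier M)"
        by (rule ex1_unique[where P = ?Q, OF ex1 Qt Qt'])
      then show "t m = t' m" using m by (metis restrict_apply')
    qed
  next
    assume co: "is_coend P Q X M \<kappa>"
    then have cw: "day_cowedge K S P Q X M \<kappa>" unfolding is_coend_def by (elim conjE)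
    have ?U
    proof (intro allI impI; elim conjE)
      fix W w assume W: "module K W" "day_cowedge K S P Q X W w"
      obtain t where t: "linear_map K M W t"
        "\<And>H L f p q. \<lbrakk>H \<in> Obj S; L \<in> Obj S; f \<in> arr S X (H \<boxtimes> L); p \<in> carrier (PVal P H); q \<in> carrier (PVal Q L)\<rbrakk>
          \<Longrightarrow> t (\<kappa> H L f p q) = w H L f p q"
        using coend_lift[OF co W] by blast
      show "\<exists>!t. t \<in> extensional (carrier M) \<and> linear_map K M W t \<and> agree P Q X t \<kappa> w"
      proof (rule ex1I[of _ "restrict t (carrier M)"])
        show "restrict t (carrier M) \<in> extensional (carrier M) \<and> linear_map K M W (restrict t (carrier M)) \<and>
          (\<forall>H\<in>Obj S. \<forall>L\<in>Obj S. \<forall>f\<in>arr S X (H \<boxtimes> L).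
             \<forall>p\<in>carrier (PVal P H). \<forall>q\<in>carrier (PVal Q L). restrict t (carrier M) (\<kappa> H L f p q) = w H L f p q)"
          using linear_map_cong[OF M t(1), of "restrict t (carrier M)"] t(2) by (simp add: day_cowedge_closed[OF cw])
      next
        fix s assume s: "s \<in> extensional (carrier M) \<and> linear_map K M W s \<and> agree P Q X s \<kappa> w"
        then have ls: "linear_map K M W s" by blast
        have "s m = t m" if "m \<in> carrier M" for m
          by (rule coend_unique[OF co W(1) ls t(1) _ that]) (use s t(2) in simp)
        then show "s = restrict t (carrier M)"
          using s by (intro extensionalityI[of s "carrier M"]) auto
      qed
    qed
    then show "day_cowedge K S P Q X M \<kappa> \<and> ?U" using cw by blast
  qed
  note coend_iff = this
  show ?thesis
    unfolding is_day_convolution_def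
  proof (rule conj_cong[OF refl], rule conj_cong[OF ball_cong[OF refl] refl])
    fix X assume "is_presheaf K S R" "X \<in> Obj S"
    then show "(day_cowedge K S P Q X (PVal R X) \<kappa> \<and>
      (\<forall>W w. module K W \<and> day_cowedge K S P Q X W w \<longrightarrow>
        (\<exists>!t. t \<in> extensional (carrier (PVal R X)) \<and> linear_map K (PVal R X) W t \<and>
          agree P Q X t \<kappa> w)))
      \<longleftrightarrow> is_coend P Q X (PVal R X) \<kappa>"
      by (intro coend_iff presheaf_module)
  qed
qed

end

context tensor_category
begin

lemma coendI:
  assumes "module K M" "day_cowedge K S P Q X M \<kappa>"
    and "\<And>(W :: ('k, 'a) module) w. \<lbrakk>module K W; day_cowedge K S P Q X W w\<rbrakk> \<Longrightarrow>
      \<exists>t. linear_map K M W t \<and> agree P Q X t \<kappa> w"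
    and "\<And>(W :: ('k, 'a) module) t t' m. \<lbrakk>module K W; linear_map K M W t; linear_map K M W t';
        agree P Q X t \<kappa> (\<lambda>H L f p q. t' (\<kappa> H L f p q));
        m \<in> carrier M\<rbrakk> \<Longrightarrow> t m = t' m"
  shows "is_coend P Q X M \<kappa>"
  unfolding is_coend_def
  by (intro conjI allI impI ballI; (elim conjE)?) (rule assms; assumption)+

lemma coend_module: "is_coend P Q X M \<kappa> \<Longrightarrow> module K M"
  unfolding is_coend_def by (elim conjE)

lemma coend_cowedge: "is_coend P Q X M \<kappa> \<Longrightarrow> day_cowedge K S P Q X M \<kappa>"
  unfolding is_coend_def by (elim conjE)

text \<open>Objects embed into the type of arrows through their identities. This is how the objects
  in a generator can be coded by elements of the universe.\<close>

lemma Ident_inj: "inj_on (Ident S) (Obj S)"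
  using hom_disjoint ident_arr by (intro inj_onI) metis

text \<open>A list of generators \<open>f \<otimes> p \<otimes> q\<close> stands for their sum, and two lists are identified when all
  cowedges with values in the universe agree on them. Scalars are absorbed in \<open>f\<close>, so the cardinality
  of \<open>K\<close> does not enter.\<close>

lemma coend_exists:
  assumes inf: "infinite (UNIV :: 'a set)"
    and X: "X \<in> Obj S" and P: "is_presheaf K S P" and Q: "is_presheaf K S Q"
  shows "\<exists>M \<kappa>. is_coend P Q X M \<kappa>"
proof -
  define G where "G = {(H, L, f, p, q). H \<in> Obj S \<and> L \<in> Obj S \<and> f \<in> arr S X (H \<boxtimes> L) \<and>
    p \<in> carrier (PVal P H) \<and> q \<in> carrier (PVal Q L)}"
  \<comment> \<open>All cowedges with values in the universe, taken together as the index set of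
    evaluations. The coend is the quotient of formal sums by the relations that hold under every one
    of them.\<close>
  define I :: "(('k, 'a) module \<times> ('o \<Rightarrow> 'o \<Rightarrow> 'a \<Rightarrow> 'a \<Rightarrow> 'a \<Rightarrow> 'a)) set"
    where "I = {i. module K (fst i) \<and> day_cowedge K S P Q X (fst i) (snd i)}"
  define val where "val i g = (case g of (H, L, f, p, q) \<Rightarrow> snd i H L f p q)"
    for i :: "('k, 'a) module \<times> ('o \<Rightarrow> 'o \<Rightarrow> 'a \<Rightarrow> 'a \<Rightarrow> 'a \<Rightarrow> 'a)" and g
  define ev where "ev i xs = foldr (\<lambda>g a. val i g \<oplus>\<^bsub>fst i\<^esub> a) xs \<zero>\<^bsub>fst i\<^esub>" for i xs
  define sc where "sc c g = (case g of (H, L, f, p, q) \<Rightarrow> (H, L, c \<odot>\<^bsub>Hom S X (H \<boxtimes> L)\<^esub> f, p, q))"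
    for c and g :: "'o \<times> 'o \<times> 'a \<times> 'a \<times> 'a"
  have I_mod: "module K (fst i)" and I_cow: "day_cowedge K S P Q X (fst i) (snd i)" if "i \<in> I" for i
    using that by (auto simp: I_def)
  have val_closed: "val i g \<in> carrier (fst i)" if "i \<in> I" "g \<in> G" for i g
    using that day_cowedge_closed[OF I_cow[OF that(1)]] by (auto simp: val_def G_def)
  have sc_closed: "sc c g \<in> G" if "c \<in> carrier K" "g \<in> G" for c g
    using that module.smult_closed[OF hom_module[OF X tensor_obj]] by (auto simp: sc_def G_def)
  have val_sc: "val i (sc c g) = c \<odot>\<^bsub>fst i\<^esub> val i g" if "i \<in> I" "c \<in> carrier K" "g \<in> G" for i c g
    using that linear_map_smult[OF day_cowedge_linear_arr[OF I_cow[OF that(1)]]]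
    by (auto simp: val_def sc_def G_def)
  have ev_Nil: "ev i [] = \<zero>\<^bsub>fst i\<^esub>" and ev_Cons: "ev i (g # xs) = val i g \<oplus>\<^bsub>fst i\<^esub> ev i xs" for i g xs
    by (simp_all add: ev_def)
  have ev_closed: "ev i xs \<in> carrier (fst i)" if i: "i \<in> I" and "xs \<in> lists G" for i xs
  proof -
    interpret W: module K "fst i" by (rule I_mod[OF i])
    show ?thesis using that(2) by (induction xs) (auto simp: ev_Nil ev_Cons val_closed[OF i])
  qed
  have ev_append: "ev i (xs @ ys) = ev i xs \<oplus>\<^bsub>fst i\<^esub> ev i ys"
    if i: "i \<in> I" and "xs \<in> lists G" "ys \<in> lists G" for i xs ys
  proof -
    interpret W: module K "fst i" by (rule I_mod[OF i])
    show ?thesis using that(2) ev_closed[OF i that(3)]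
      by (induction xs) (auto simp: ev_Nil ev_Cons val_closed[OF i] ev_closed[OF i] W.a_assoc)
  qed
  have ev_scale: "ev i (map (sc c) xs) = c \<odot>\<^bsub>fst i\<^esub> ev i xs"
    if i: "i \<in> I" and c: "c \<in> carrier K" and "xs \<in> lists G" for i c xs
  proof -
    interpret W: module K "fst i" by (rule I_mod[OF i])
    show ?thesis using that(3)
      by (induction xs) (auto simp: ev_Nil ev_Cons val_closed[OF i] ev_closed[OF i] c val_sc[OF i c] W.smult_r_distr)
  qed
  obtain \<phi> :: "'a list \<Rightarrow> 'a" where \<phi>: "inj \<phi>" using infinite_inj_list[OF inf] by blast
  \<comment> \<open>Codes of generators are single elements of \<open>'a\<close>, so a list of
    generators becomes a list over \<open>'a\<close>, to which \<open>\<phi>\<close> applies a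
    second time.\<close>
  define code where "code g = (case g of (H, L, f, p, q) \<Rightarrow> \<phi> [Ident S H, Ident S L, f, p, q])" for g
  have "inj_on code G"
    using inj_onD[OF Ident_inj] by (intro inj_onI) (auto simp: code_def G_def inj_eq[OF \<phi>])
  then have "inj_on (map code) (lists G)"
    by (intro inj_on_mapI) (auto simp: inj_on_def lists_eq_set)
  then have inj: "inj_on (\<lambda>xs. \<phi> (map code xs)) (lists G)"
    using \<phi> by (auto simp: inj_on_def)
  have sums: "\<exists>s\<in>lists G. \<forall>i\<in>I. ev i s = ev i x \<oplus>\<^bsub>fst i\<^esub> ev i y" if "x \<in> lists G" "y \<in> lists G" for x y
    using that ev_append by (intro bexI[of _ "x @ y"]) auto
  have scales: "\<exists>s\<in>lists G. \<forall>i\<in>I. ev i s = c \<odot>\<^bsub>fst i\<^esub> ev i x" if "c \<in> carrier K" "x \<in> lists G" for c x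
    using that ev_scale sc_closed by (intro bexI[of _ "map (sc c) x"]) auto
  have cring: "cring K" by unfold_locales
  have Nil: "[] \<in> lists G" by simp
  obtain M :: "('k, 'a) module" and \<pi> t where M: "module K M" "carrier M = \<pi> ` lists G"
    and t_lin: "\<And>i. i \<in> I \<Longrightarrow> linear_map K M (fst i) (t i)"
    and t_\<pi>: "\<And>i x. i \<in> I \<Longrightarrow> x \<in> lists G \<Longrightarrow> t i (\<pi> x) = ev i x"
    and sep: "\<And>u v. \<lbrakk>u \<in> carrier M; v \<in> carrier M; \<And>i. i \<in> I \<Longrightarrow> t i u = t i v\<rbrakk> \<Longrightarrow> u = v"
  proof (rule joint_quotient_module[where N = fst, OF cring inj I_mod ev_closed Nil ev_Nil sums scales])
    fix M :: "('k, 'a) module" and \<pi> t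
    assume "module K M" "carrier M = \<pi> ` lists G" "\<And>i. i \<in> I \<Longrightarrow> linear_map K M (fst i) (t i)"
      "\<And>i x. i \<in> I \<Longrightarrow> x \<in> lists G \<Longrightarrow> t i (\<pi> x) = ev i x"
      "\<And>u v. \<lbrakk>u \<in> carrier M; v \<in> carrier M; \<And>i. i \<in> I \<Longrightarrow> t i u = t i v\<rbrakk> \<Longrightarrow> u = v"
    then show thesis by (rule that)
  qed assumption+
  interpret M: module K M by (rule M(1))
  define \<kappa> where "\<kappa> H L f p q = \<pi> [(H, L, f, p, q)]" for H L f p q
  have \<pi>_closed: "\<pi> xs \<in> carrier M" if "xs \<in> lists G" for xs
    using that M(2) by auto
  have \<kappa>_closed: "\<kappa> H L f p q \<in> carrier M" and t_\<kappa>: "i \<in> I \<Longrightarrow> t i (\<kappa> H L f p q) = snd i H L f p q"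
    if "(H, L, f, p, q) \<in> G" for H L f p q i
  proof -
    show "\<kappa> H L f p q \<in> carrier M" unfolding \<kappa>_def using that by (intro \<pi>_closed) auto
    assume i: "i \<in> I"
    interpret W: module K "fst i" by (rule I_mod[OF i])
    have "t i (\<kappa> H L f p q) = ev i [(H, L, f, p, q)]"
      unfolding \<kappa>_def by (rule t_\<pi>[OF i]) (use that in auto)
    also have "\<dots> = val i (H, L, f, p, q)" using val_closed[OF i that] by (simp add: ev_Nil ev_Cons)
    finally show "t i (\<kappa> H L f p q) = snd i H L f p q" by (simp add: val_def)
  qed
  \<comment> \<open>As the maps \<open>t i\<close> separate points, a map into \<open>M\<close> is
    linear as soon as its composites with all of them are.\<close>
  have lin: "linear_map K N M h" if N: "module K N" and h: "\<And>n. n \<in> carrier N \<Longrightarrow> h n \<in> carrier M"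
    and th: "\<And>i. i \<in> I \<Longrightarrow> linear_map K N (fst i) (\<lambda>n. t i (h n))" for N :: "('k, 'a) module" and h
  proof (rule linear_mapI)
    interpret N: module K N by (rule N)
    fix x y assume xy: "x \<in> carrier N" "y \<in> carrier N"
    show "h (x \<oplus>\<^bsub>N\<^esub> y) = h x \<oplus>\<^bsub>M\<^esub> h y"
      by (rule sep) (use xy h in \<open>simp_all add: linear_map_add[OF th] linear_map_add[OF t_lin]\<close>)
  next
    interpret N: module K N by (rule N)
    fix c x assume cx: "c \<in> carrier K" "x \<in> carrier N"
    show "h (c \<odot>\<^bsub>N\<^esub> x) = c \<odot>\<^bsub>M\<^esub> h x"
      by (rule sep) (use cx h in \<open>simp_all add: linear_map_smult[OF th] linear_map_smult[OF t_lin]\<close>)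
  qed (rule h)
  have cow: "day_cowedge K S P Q X M \<kappa>"
  proof (rule day_cowedgeI)
    fix H L p q assume a: "H \<in> Obj S" "L \<in> Obj S" "p \<in> carrier (PVal P H)" "q \<in> carrier (PVal Q L)"
    have N: "module K (Hom S X (H \<boxtimes> L))" by (rule hom_module[OF X tensor_obj[OF a(1,2)]])
    show "linear_map K (Hom S X (H \<boxtimes> L)) M (\<lambda>f. \<kappa> H L f p q)"
    proof (rule lin[OF N])
      fix i assume i: "i \<in> I"
      show "linear_map K (Hom S X (H \<boxtimes> L)) (fst i) (\<lambda>f. t i (\<kappa> H L f p q))"
        by (rule linear_map_cong[OF N day_cowedge_linear_arr[OF I_cow[OF i] a]])
          (use a in \<open>simp add: t_\<kappa> i G_def\<close>)
    qed (use a in \<open>simp add: \<kappa>_closed G_def\<close>)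
  next
    fix H L f q assume a: "H \<in> Obj S" "L \<in> Obj S" "f \<in> arr S X (H \<boxtimes> L)" "q \<in> carrier (PVal Q L)"
    have N: "module K (PVal P H)" by (rule presheaf_module[OF P a(1)])
    show "linear_map K (PVal P H) M (\<lambda>p. \<kappa> H L f p q)"
    proof (rule lin[OF N])
      fix i assume i: "i \<in> I"
      show "linear_map K (PVal P H) (fst i) (\<lambda>p. t i (\<kappa> H L f p q))"
        by (rule linear_map_cong[OF N day_cowedge_linear_left[OF I_cow[OF i] a]])
          (use a in \<open>simp add: t_\<kappa> i G_def\<close>)
    qed (use a in \<open>simp add: \<kappa>_closed G_def\<close>)
  next
    fix H L f p assume a: "H \<in> Obj S" "L \<in> Obj S" "f \<in> arr S X (H \<boxtimes> L)" "p \<in> carrier (PVal P H)"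
    have N: "module K (PVal Q L)" by (rule presheaf_module[OF Q a(2)])
    show "linear_map K (PVal Q L) M (\<lambda>q. \<kappa> H L f p q)"
    proof (rule lin[OF N])
      fix i assume i: "i \<in> I"
      show "linear_map K (PVal Q L) (fst i) (\<lambda>q. t i (\<kappa> H L f p q))"
        by (rule linear_map_cong[OF N day_cowedge_linear_right[OF I_cow[OF i] a]])
          (use a in \<open>simp add: t_\<kappa> i G_def\<close>)
    qed (use a in \<open>simp add: \<kappa>_closed G_def\<close>)
  next
    fix H H' L L' h l f p q
    assume a: "H \<in> Obj S" "H' \<in> Obj S" "L \<in> Obj S" "L' \<in> Obj S" "h \<in> arr S H H'" "l \<in> arr S L L'"
      "f \<in> arr S X (H \<boxtimes> L)" "p \<in> carrier (PVal P H')" "q \<in> carrier (PVal Q L')"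
    have 1: "(H', L', (h \<boxdot> l) \<cdot> f, p, q) \<in> G"
      using a comp_closed[OF X tensor_obj[of H L] tensor_obj[of H' L'] a(7) tensor_closed] by (simp add: G_def)
    have 2: "(H, L, f, PAct P h p, PAct Q l q) \<in> G"
      using a presheaf_closed[OF P] presheaf_closed[OF Q] by (simp add: G_def)
    show "\<kappa> H' L' ((h \<boxdot> l) \<cdot> f) p q = \<kappa> H L f (PAct P h p) (PAct Q l q)"
      by (rule sep[OF \<kappa>_closed[OF 1] \<kappa>_closed[OF 2]])
        (simp add: t_\<kappa>[OF 1] t_\<kappa>[OF 2] day_cowedge_dinatural[OF I_cow a])
  qed
  have "is_coend P Q X M \<kappa>"
  proof (rule coendI[OF M(1) cow])
    fix W :: "('k, 'a) module" and w assume "module K W" "day_cowedge K S P Q X W w"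
    \<comment> \<open>The cowedge is one of the indices, and the map belonging to that index is the
      required lift.\<close>
    then have i: "(W, w) \<in> I" by (simp add: I_def)
    then show "\<exists>t. linear_map K M W t \<and> agree P Q X t \<kappa> w"
      using t_lin[OF i] by (intro exI[of _ "t (W, w)"]) (simp add: t_\<kappa>[OF _ i] G_def)
  next
    fix W :: "('k, 'a) module" and s s' m
    assume W: "module K W" and s: "linear_map K M W s" "linear_map K M W s'" and m: "m \<in> carrier M"
      and eq: "\<forall>H\<in>Obj S. \<forall>L\<in>Obj S. \<forall>f\<in>arr S X (H \<boxtimes> L).
           \<forall>p\<in>carrier (PVal P H). \<forall>q\<in>carrier (PVal Q L). s (\<kappa> H L f p q) = s' (\<kappa> H L f p q)"
    have Nil: "\<pi> [] = \<zero>\<^bsub>M\<^esub>"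
      by (rule sep) (simp_all add: \<pi>_closed t_\<pi> ev_Nil linear_map_zero[OF M(1) I_mod t_lin])
    \<comment> \<open>Together with the value at the empty list, this shows that every element of
      \<open>M\<close> is a finite sum of generators; linear maps are hence determined on
      generators.\<close>
    have Cons: "\<pi> (g # xs) = \<pi> [g] \<oplus>\<^bsub>M\<^esub> \<pi> xs" if "g \<in> G" "xs \<in> lists G" for g xs
    proof (rule sep)
      fix i assume i: "i \<in> I"
      interpret W: module K "fst i" by (rule I_mod[OF i])
      show "t i (\<pi> (g # xs)) = t i (\<pi> [g] \<oplus>\<^bsub>M\<^esub> \<pi> xs)"
        using that i by (simp add: linear_map_add[OF t_lin] \<pi>_closed t_\<pi> ev_Cons ev_Nil val_closed)
    qed (use that in \<open>auto simp: \<pi>_closed\<close>)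
    have "s (\<pi> xs) = s' (\<pi> xs)" if "xs \<in> lists G" for xs
      using that
    proof (induction xs)
      case Nil
      then show ?case unfolding \<open>\<pi> [] = \<zero>\<^bsub>M\<^esub>\<close> by (simp add: linear_map_zero[OF M(1) W] s)
    next
      case (Cons g xs)
      moreover have "s (\<pi> [g]) = s' (\<pi> [g])"
        using eq Cons.hyps unfolding \<kappa>_def G_def by auto
      ultimately show ?case
        using \<open>\<And>g xs. g \<in> G \<Longrightarrow> xs \<in> lists G \<Longrightarrow> \<pi> (g # xs) = \<pi> [g] \<oplus>\<^bsub>M\<^esub> \<pi> xs\<close>[of g xs]
        by (simp add: linear_map_add[OF s(1)] linear_map_add[OF s(2)] \<pi>_closed)
    qed
    then show "s m = s' m" using m M(2) by auto
  qed
  then show ?thesis by blast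
qed

lemma day_cowedge_cong:
  assumes w: "day_cowedge K S P Q X W w" and X: "X \<in> Obj S"
    and P: "is_presheaf K S P" and Q: "is_presheaf K S Q"
    and eq: "\<And>H L f p q. \<lbrakk>H \<in> Obj S; L \<in> Obj S; f \<in> arr S X (H \<boxtimes> L); p \<in> carrier (PVal P H);
      q \<in> carrier (PVal Q L)\<rbrakk> \<Longrightarrow> w H L f p q = w' H L f p q"
  shows "day_cowedge K S P Q X W w'"
proof (rule day_cowedgeI)
  fix H L p q assume a: "H \<in> Obj S" "L \<in> Obj S" "p \<in> carrier (PVal P H)" "q \<in> carrier (PVal Q L)"
  show "linear_map K (Hom S X (H \<boxtimes> L)) W (\<lambda>f. w' H L f p q)"
    by (rule linear_map_cong[OF hom_module[OF X tensor_obj[OF a(1,2)]] day_cowedge_linear_arr[OF w a]])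
      (use a in \<open>simp add: eq\<close>)
next
  fix H L f q assume a: "H \<in> Obj S" "L \<in> Obj S" "f \<in> arr S X (H \<boxtimes> L)" "q \<in> carrier (PVal Q L)"
  show "linear_map K (PVal P H) W (\<lambda>p. w' H L f p q)"
    by (rule linear_map_cong[OF presheaf_module[OF P a(1)] day_cowedge_linear_left[OF w a]])
      (use a in \<open>simp add: eq\<close>)
next
  fix H L f p assume a: "H \<in> Obj S" "L \<in> Obj S" "f \<in> arr S X (H \<boxtimes> L)" "p \<in> carrier (PVal P H)"
  show "linear_map K (PVal Q L) W (\<lambda>q. w' H L f p q)"
    by (rule linear_map_cong[OF presheaf_module[OF Q a(2)] day_cowedge_linear_right[OF w a]])
      (use a in \<open>simp add: eq\<close>)
next
  fix H H' L L' h l f p q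
  assume a: "H \<in> Obj S" "H' \<in> Obj S" "L \<in> Obj S" "L' \<in> Obj S" "h \<in> arr S H H'" "l \<in> arr S L L'"
    "f \<in> arr S X (H \<boxtimes> L)" "p \<in> carrier (PVal P H')" "q \<in> carrier (PVal Q L')"
  have "(h \<boxdot> l) \<cdot> f \<in> arr S X (H' \<boxtimes> L')"
    using a comp_closed[OF X tensor_obj[of H L] tensor_obj[of H' L'] a(7) tensor_closed] by simp
  then show "w' H' L' ((h \<boxdot> l) \<cdot> f) p q = w' H L f (PAct P h p) (PAct Q l q)"
    using day_cowedge_dinatural[OF w a] a presheaf_closed[OF P] presheaf_closed[OF Q] by (simp add: eq)
qed

text \<open>Coends are chosen one object at a time, whereas a Day convolution has a single family
  \<open>\<kappa>\<close> for all objects; this allows the chosen cowedges to be replaced by a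
  common one.\<close>

lemma coend_cong:
  assumes co: "is_coend P Q X M \<kappa>" and X: "X \<in> Obj S"
    and P: "is_presheaf K S P" and Q: "is_presheaf K S Q"
    and eq: "\<And>H L f p q. \<lbrakk>H \<in> Obj S; L \<in> Obj S; f \<in> arr S X (H \<boxtimes> L); p \<in> carrier (PVal P H);
      q \<in> carrier (PVal Q L)\<rbrakk> \<Longrightarrow> \<kappa> H L f p q = \<kappa>' H L f p q"
  shows "is_coend P Q X M \<kappa>'"
proof (rule coendI)
  show "module K M" by (rule coend_module[OF co])
  show "day_cowedge K S P Q X M \<kappa>'"
    by (rule day_cowedge_cong[OF coend_cowedge[OF co] X P Q eq])
next
  fix W :: "('k, 'a) module" and w assume "module K W" "day_cowedge K S P Q X W w"
  then obtain t where "linear_map K M W t"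
    and t: "\<And>H L f p q. \<lbrakk>H \<in> Obj S; L \<in> Obj S; f \<in> arr S X (H \<boxtimes> L); p \<in> carrier (PVal P H); q \<in> carrier (PVal Q L)\<rbrakk>
      \<Longrightarrow> t (\<kappa> H L f p q) = w H L f p q"
    by (rule coend_lift[OF co]) blast
  then show "\<exists>t. linear_map K M W t \<and>
          (\<forall>H\<in>Obj S. \<forall>L\<in>Obj S. \<forall>f\<in>arr S X (H \<boxtimes> L).
             \<forall>p\<in>carrier (PVal P H). \<forall>q\<in>carrier (PVal Q L). t (\<kappa>' H L f p q) = w H L f p q)"
    by (intro exI[of _ t] conjI ballI) (simp_all add: t eq[symmetric])
next
  fix W :: "('k, 'a) module" and t t' m
  assume a: "module K W" "linear_map K M W t" "linear_map K M W t'" and m: "m \<in> carrier M"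
    and tt': "\<forall>H\<in>Obj S. \<forall>L\<in>Obj S. \<forall>f\<in>arr S X (H \<boxtimes> L).
           \<forall>p\<in>carrier (PVal P H). \<forall>q\<in>carrier (PVal Q L). t (\<kappa>' H L f p q) = t' (\<kappa>' H L f p q)"
  show "t m = t' m"
    by (rule coend_unique[OF co a _ m]) (simp add: eq tt')
qed

end

context tensor_category
begin


text \<open>Both sides of additivity in \<open>n\<close>, and of homogeneity, are linear maps out of
  the coend, so it is enough to compare them on generators. Applied to lifts obtained by choice,
  whose dependence on the parameter is not visible otherwise.\<close>

lemma coend_linear_parameter:
  fixes W :: "('k, 'a) module"
  assumes co: "is_coend P Q X M \<kappa>" and N: "module K N" and W: "module K W"
    and T: "\<And>n. n \<in> carrier N \<Longrightarrow> linear_map K M W (T n)"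
    and generators: "\<And>H L f p q. \<lbrakk>H \<in> Obj S; L \<in> Obj S; f \<in> arr S X (H \<boxtimes> L); p \<in> carrier (PVal P H);
      q \<in> carrier (PVal Q L)\<rbrakk> \<Longrightarrow> linear_map K N W (\<lambda>n. T n (\<kappa> H L f p q))"
    and m: "m \<in> carrier M"
  shows "linear_map K N W (\<lambda>n. T n m)"
proof (rule linear_mapI)
  interpret N: module K N by (rule N)
  show "T n m \<in> carrier W" if "n \<in> carrier N" for n
    by (rule linear_map_closed[OF T[OF that] m])
  show "T (n \<oplus>\<^bsub>N\<^esub> n') m = T n m \<oplus>\<^bsub>W\<^esub> T n' m" if n: "n \<in> carrier N" "n' \<in> carrier N" for n n'
    by (rule coend_unique[OF co W T[OF N.a_closed[OF n]] linear_map_sum[OF W T[OF n(1)] T[OF n(2)]] _ m])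
      (rule linear_map_add[OF generators n])
  show "T (d \<odot>\<^bsub>N\<^esub> n) m = d \<odot>\<^bsub>W\<^esub> T n m" if d: "d \<in> carrier K" and n: "n \<in> carrier N" for d n
    by (rule coend_unique[OF co W T[OF N.smult_closed[OF d n]] linear_map_scale[OF W T[OF n] d] _ m])
      (rule linear_map_smult[OF generators d n])
qed

lemma day_convolution_exists:
  assumes inf: "infinite (UNIV :: 'a set)" and P: "is_presheaf K S P" and Q: "is_presheaf K S Q"
  shows "\<exists>R \<kappa>. is_day_convolution K S P Q R \<kappa>"
proof -
  have "\<forall>X. \<exists>c. X \<in> Obj S \<longrightarrow> is_coend P Q X (fst c) (snd c)"
  proof
    fix X show "\<exists>c. X \<in> Obj S \<longrightarrow> is_coend P Q X (fst c) (snd c)"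
      using coend_exists[OF inf _ P Q, of X] by (cases "X \<in> Obj S") auto
  qed
  from choice[OF this] obtain c where c': "\<forall>X. X \<in> Obj S \<longrightarrow> is_coend P Q X (fst (c X)) (snd (c X))"
    by (elim exE)
  have c: "is_coend P Q X (fst (c X)) (snd (c X))" if "X \<in> Obj S" for X
    by (rule mp[OF spec[OF c'] that])
  define M where "M X = fst (c X)" for X
  \<comment> \<open>The object at which the coend is taken is recovered as the source of
    \<open>f\<close>, which makes \<open>\<kappa>\<close> independent of it.\<close>
  define \<kappa> where "\<kappa> H L f p q = snd (c (src f)) H L f p q" for H L f p q
  have co: "is_coend P Q X (M X) \<kappa>" if X: "X \<in> Obj S" for X
    unfolding M_def
    by (rule coend_cong[OF c[OF X] X P Q])
      (use X in \<open>simp add: \<kappa>_def in_arr_iff tensor_obj\<close>)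
  note cow = coend_cowedge[OF co] and modM = coend_module[OF co]
  have ex: "\<exists>t. linear_map K (M Y) (M X) t \<and>
      (\<forall>H\<in>Obj S. \<forall>L\<in>Obj S. \<forall>f\<in>arr S Y (H \<boxtimes> L).
         \<forall>p\<in>carrier (PVal P H). \<forall>q\<in>carrier (PVal Q L). t (\<kappa> H L f p q) = \<kappa> H L (f \<cdot> g) p q)"
    if XY: "X \<in> Obj S" "Y \<in> Obj S" "g \<in> arr S X Y" for X Y g
    by (rule coend_lift[OF co[OF XY(2)] modM[OF XY(1)] day_cowedge_precompose[OF cow[OF XY(1)] XY]]) blast
  \<comment> \<open>Precomposition with \<open>g\<close> turns the cowedge at \<open>X\<close> into
    one at \<open>Y\<close>; its lift is the restriction map along \<open>g\<close>.\<close>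
  define A where "A X Y g = (SOME t. linear_map K (M Y) (M X) t \<and>
      (\<forall>H\<in>Obj S. \<forall>L\<in>Obj S. \<forall>f\<in>arr S Y (H \<boxtimes> L).
         \<forall>p\<in>carrier (PVal P H). \<forall>q\<in>carrier (PVal Q L). t (\<kappa> H L f p q) = \<kappa> H L (f \<cdot> g) p q))" for X Y g
  have A_lin: "linear_map K (M Y) (M X) (A X Y g)"
    and A_\<kappa>: "\<And>H L f p q. \<lbrakk>H \<in> Obj S; L \<in> Obj S; f \<in> arr S Y (H \<boxtimes> L); p \<in> carrier (PVal P H); q \<in> carrier (PVal Q L)\<rbrakk>
      \<Longrightarrow> A X Y g (\<kappa> H L f p q) = \<kappa> H L (f \<cdot> g) p q"
    if XY: "X \<in> Obj S" "Y \<in> Obj S" "g \<in> arr S X Y" for X Y g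
    using someI_ex[OF ex[OF XY]] unfolding A_def[symmetric] by simp_all
  \<comment> \<open>\<open>PAct\<close> receives only the arrow, so its endpoints are read off from
    \<open>src\<close> and \<open>trg\<close>.\<close>
  define R where "R = \<lparr>PVal = M, PAct = (\<lambda>g. A (src g) (trg g) g)\<rparr>"
  have R_val: "PVal R = M" by (simp add: R_def)
  have R_act: "PAct R g = A X Y g" if "X \<in> Obj S" "Y \<in> Obj S" "g \<in> arr S X Y" for X Y g
    using that by (simp add: R_def in_arr_iff)
  have comp: "f \<cdot> g \<in> arr S X (H \<boxtimes> L)"
    if "X \<in> Obj S" "Y \<in> Obj S" "g \<in> arr S X Y" "H \<in> Obj S" "L \<in> Obj S" "f \<in> arr S Y (H \<boxtimes> L)" for X Y f g H L
    using that comp_closed tensor_obj by metis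
  have psh: "is_presheaf K S R"
  proof (rule presheafI)
    show "module K (PVal R X)" if "X \<in> Obj S" for X unfolding R_val by (rule modM[OF that])
    show "linear_map K (PVal R Y) (PVal R X) (PAct R g)" if "X \<in> Obj S" "Y \<in> Obj S" "g \<in> arr S X Y" for X Y g
      unfolding R_val R_act[OF that] by (rule A_lin[OF that])
    show "PAct R (Ident S X) m = m" if X: "X \<in> Obj S" and m: "m \<in> carrier (PVal R X)" for X m
      unfolding R_act[OF X X ident_arr[OF X]]
      by (rule coend_unique[OF co[OF X] modM[OF X] A_lin[OF X X ident_arr[OF X]] linear_map_id])
        (use m X in \<open>simp_all add: R_val A_\<kappa>[OF X X ident_arr[OF X]] comp_ident_right[OF X tensor_obj]\<close>)
    show "PAct R (h \<cdot> g) m = PAct R g (PAct R h m)"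
      if X: "X \<in> Obj S" and Y: "Y \<in> Obj S" and Z: "Z \<in> Obj S" and g: "g \<in> arr S X Y" and h: "h \<in> arr S Y Z"
        and m: "m \<in> carrier (PVal R Z)" for X Y Z g h m
    proof -
      have gh: "h \<cdot> g \<in> arr S X Z" using comp_closed[OF X Y Z g h] .
      show ?thesis
        unfolding R_act[OF X Z gh] R_act[OF X Y g] R_act[OF Y Z h]
      proof (rule coend_unique[OF co[OF Z] modM[OF X] A_lin[OF X Z gh]
            linear_map_compose[OF A_lin[OF Y Z h] A_lin[OF X Y g]]])
        fix H L f p q assume a: "H \<in> Obj S" "L \<in> Obj S" "f \<in> arr S Z (H \<boxtimes> L)"
          "p \<in> carrier (PVal P H)" "q \<in> carrier (PVal Q L)"
        then show "A X Z (h \<cdot> g) (\<kappa> H L f p q) = A X Y g (A Y Z h (\<kappa> H L f p q))"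
          by (simp add: A_\<kappa>[OF X Z gh] A_\<kappa>[OF Y Z h] A_\<kappa>[OF X Y g] comp[OF Y Z h]
              comp_assoc[OF X Y Z tensor_obj[OF a(1,2)] g h a(3)])
      qed (use m in \<open>simp add: R_val\<close>)
    qed
    show "linear_map K (Hom S X Y) (PVal R X) (\<lambda>g. PAct R g m)"
      if X: "X \<in> Obj S" and Y: "Y \<in> Obj S" and m: "m \<in> carrier (PVal R Y)" for X Y m
    proof (rule linear_map_cong[OF hom_module[OF X Y]])
      show "linear_map K (Hom S X Y) (PVal R X) (\<lambda>g. A X Y g m)"
        unfolding R_val
      proof (rule coend_linear_parameter[OF co[OF Y] hom_module[OF X Y] modM[OF X] A_lin[OF X Y]])
        fix H L f p q assume a: "H \<in> Obj S" "L \<in> Obj S" "f \<in> arr S Y (H \<boxtimes> L)"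
          "p \<in> carrier (PVal P H)" "q \<in> carrier (PVal Q L)"
        show "linear_map K (Hom S X Y) (M X) (\<lambda>g. A X Y g (\<kappa> H L f p q))"
          by (rule linear_map_cong[OF hom_module[OF X Y] linear_map_compose[OF
                comp_linear_right[OF X Y tensor_obj[OF a(1,2)] a(3)] day_cowedge_linear_arr[OF cow[OF X] a(1,2,4,5)]]])
            (simp add: A_\<kappa>[OF X Y] a)
      qed (use m in \<open>simp_all add: R_val\<close>)
    qed (simp add: R_act[OF X Y])
  qed
  have "is_day_convolution K S P Q R \<kappa>"
    unfolding is_day_convolution_iff_coend R_val
    by (intro conjI ballI psh co) (auto simp: R_act A_\<kappa>)
  then show ?thesis by blast
qed

lemma day_convolution_presheaf: "is_day_convolution K S P Q R \<kappa> \<Longrightarrow> is_presheaf K S R"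
  by (simp add: is_day_convolution_iff_coend)

lemma day_convolution_coend: "is_day_convolution K S P Q R \<kappa> \<Longrightarrow> X \<in> Obj S \<Longrightarrow> is_coend P Q X (PVal R X) \<kappa>"
  by (simp add: is_day_convolution_iff_coend)

lemma day_convolution_cowedge:
  "is_day_convolution K S P Q R \<kappa> \<Longrightarrow> X \<in> Obj S \<Longrightarrow> day_cowedge K S P Q X (PVal R X) \<kappa>"
  by (rule coend_cowedge[OF day_convolution_coend])

lemma day_convolution_closed:
  "\<lbrakk>is_day_convolution K S P Q R \<kappa>; X \<in> Obj S; H \<in> Obj S; L \<in> Obj S; f \<in> arr S X (H \<boxtimes> L);
    p \<in> carrier (PVal P H); q \<in> carrier (PVal Q L)\<rbrakk> \<Longrightarrow> \<kappa> H L f p q \<in> carrier (PVal R X)"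
  using day_cowedge_closed[OF day_convolution_cowedge] .

lemma day_convolution_act:
  "\<lbrakk>is_day_convolution K S P Q R \<kappa>; X \<in> Obj S; Y \<in> Obj S; g \<in> arr S X Y; H \<in> Obj S; L \<in> Obj S;
    f \<in> arr S Y (H \<boxtimes> L); p \<in> carrier (PVal P H); q \<in> carrier (PVal Q L)\<rbrakk>
    \<Longrightarrow> PAct R g (\<kappa> H L f p q) = \<kappa> H L (f \<cdot> g) p q"
  by (simp add: is_day_convolution_iff_coend)

text \<open>The lifts are taken at each object separately. Naturality follows because both sides are
  linear maps out of a coend, and \<open>w_act\<close> is exactly their agreement on
  generators.\<close>

lemma day_convolution_lift:
  assumes day: "is_day_convolution K S P Q R \<kappa>" and R': "is_presheaf K S R'"
    and w: "\<And>X. X \<in> Obj S \<Longrightarrow> day_cowedge K S P Q X (PVal R' X) (w X)"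
    and w_act: "\<And>X Y g H L f p q. \<lbrakk>X \<in> Obj S; Y \<in> Obj S; g \<in> arr S X Y; H \<in> Obj S; L \<in> Obj S;
      f \<in> arr S Y (H \<boxtimes> L); p \<in> carrier (PVal P H); q \<in> carrier (PVal Q L)\<rbrakk>
      \<Longrightarrow> PAct R' g (w Y H L f p q) = w X H L (f \<cdot> g) p q"
  obtains \<theta> where "presheaf_nat K S R R' \<theta>"
    "\<And>X H L f p q. \<lbrakk>X \<in> Obj S; H \<in> Obj S; L \<in> Obj S; f \<in> arr S X (H \<boxtimes> L);
      p \<in> carrier (PVal P H); q \<in> carrier (PVal Q L)\<rbrakk> \<Longrightarrow> \<theta> X (\<kappa> H L f p q) = w X H L f p q"
proof -
  note co = day_convolution_coend[OF day]
  have "\<forall>X. \<exists>t. X \<in> Obj S \<longrightarrow> linear_map K (PVal R X) (PVal R' X) t \<and>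
    (\<forall>H L f p q. H \<in> Obj S \<and> L \<in> Obj S \<and> f \<in> arr S X (H \<boxtimes> L) \<and> p \<in> carrier (PVal P H) \<and>
      q \<in> carrier (PVal Q L) \<longrightarrow> t (\<kappa> H L f p q) = w X H L f p q)"
  proof
    fix X
    show "\<exists>t. X \<in> Obj S \<longrightarrow> linear_map K (PVal R X) (PVal R' X) t \<and>
      (\<forall>H L f p q. H \<in> Obj S \<and> L \<in> Obj S \<and> f \<in> arr S X (H \<boxtimes> L) \<and> p \<in> carrier (PVal P H) \<and>
      q \<in> carrier (PVal Q L) \<longrightarrow> t (\<kappa> H L f p q) = w X H L f p q)"
    proof (cases "X \<in> Obj S")
      case True
      show ?thesis
        by (rule coend_lift[OF co[OF True] presheaf_module[OF R' True] w[OF True]]) blast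
    qed simp
  qed
  from choice[OF this] obtain \<theta> where \<theta>_spec:
    "\<forall>X. X \<in> Obj S \<longrightarrow> linear_map K (PVal R X) (PVal R' X) (\<theta> X) \<and>
    (\<forall>H L f p q. H \<in> Obj S \<and> L \<in> Obj S \<and> f \<in> arr S X (H \<boxtimes> L) \<and> p \<in> carrier (PVal P H) \<and>
      q \<in> carrier (PVal Q L) \<longrightarrow> \<theta> X (\<kappa> H L f p q) = w X H L f p q)"
    by (elim exE)
  have lin: "linear_map K (PVal R X) (PVal R' X) (\<theta> X)" if "X \<in> Obj S" for X
    using \<theta>_spec that by simp
  have \<theta>: "\<theta> X (\<kappa> H L f p q) = w X H L f p q"
    if "X \<in> Obj S" "H \<in> Obj S" "L \<in> Obj S" "f \<in> arr S X (H \<boxtimes> L)"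
      "p \<in> carrier (PVal P H)" "q \<in> carrier (PVal Q L)" for X H L f p q
    using \<theta>_spec that by simp
  have "presheaf_nat K S R R' \<theta>"
  proof (rule presheaf_natI[OF lin])
    fix X Y g m
    assume X: "X \<in> Obj S" and Y: "Y \<in> Obj S" and g: "g \<in> arr S X Y" and m: "m \<in> carrier (PVal R Y)"
    note R = day_convolution_presheaf[OF day]
    show "\<theta> X (PAct R g m) = PAct R' g (\<theta> Y m)"
    proof (rule coend_unique[OF co[OF Y] presheaf_module[OF R' X]
          linear_map_compose[OF presheaf_linear[OF R X Y g] lin[OF X]]
          linear_map_compose[OF lin[OF Y] presheaf_linear[OF R' X Y g]] _ m])
      fix H L f p q assume a: "H \<in> Obj S" "L \<in> Obj S" "f \<in> arr S Y (H \<boxtimes> L)"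
        "p \<in> carrier (PVal P H)" "q \<in> carrier (PVal Q L)"
      have "f \<cdot> g \<in> arr S X (H \<boxtimes> L)" using comp_closed X Y g a tensor_obj by metis
      then show "\<theta> X (PAct R g (\<kappa> H L f p q)) = PAct R' g (\<theta> Y (\<kappa> H L f p q))"
        using a by (simp add: day_convolution_act[OF day X Y g] \<theta>[OF X] \<theta>[OF Y] w_act[OF X Y g])
    qed
  qed
  then show ?thesis using \<theta> by (rule that)
qed

lemma day_convolution_unique:
  assumes day: "is_day_convolution K S P Q R \<kappa>" and R': "is_presheaf K S R'"
    and \<theta>: "presheaf_nat K S R R' \<theta>" "presheaf_nat K S R R' \<theta>'"
    and eq: "\<And>X H L f p q. \<lbrakk>X \<in> Obj S; H \<in> Obj S; L \<in> Obj S; f \<in> arr S X (H \<boxtimes> L);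
      p \<in> carrier (PVal P H); q \<in> carrier (PVal Q L)\<rbrakk> \<Longrightarrow> \<theta> X (\<kappa> H L f p q) = \<theta>' X (\<kappa> H L f p q)"
    and X: "X \<in> Obj S" and m: "m \<in> carrier (PVal R X)"
  shows "\<theta> X m = \<theta>' X m"
  by (rule coend_unique[OF day_convolution_coend[OF day X] presheaf_module[OF R' X]
        presheaf_nat_linear[OF \<theta>(1) X] presheaf_nat_linear[OF \<theta>(2) X] eq[OF X] m])

end

section \<open>Functoriality and associativity of Day convolution\<close>

text \<open>A copy of \<open>semigroup_category\<close> in which \<open>S\<close> is declared as the
  implicit structure, so that the operations can be written with no index.\<close>

locale structured_semigroup_category = semigroup_category K S
  for K :: "'k ring" and S :: "('o, 'k, 'a, 'z) semicat_scheme" (structure)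
begin

lemma assoc_arr:
  assumes "X \<in> Obj S" "Y \<in> Obj S" "Z \<in> Obj S"
  shows "Assoc S X Y Z \<in> arr S (X \<boxtimes> Y \<boxtimes> Z) (X \<boxtimes> (Y \<boxtimes> Z))"
  using assoc_iso[OF assms] unfolding is_iso_def inverse_arrows_def by blast

lemma arrow_assoc:
  assumes "X \<in> Obj S" "Y \<in> Obj S" "Z \<in> Obj S"
  shows "arrow (Assoc S X Y Z)" "src (Assoc S X Y Z) = X \<boxtimes> Y \<boxtimes> Z"
    "trg (Assoc S X Y Z) = X \<boxtimes> (Y \<boxtimes> Z)"
  using arrowI[OF _ _ assoc_arr[OF assms]] assms tensor_obj by auto

lemma inv_assoc_inverse:
  assumes "X \<in> Obj S" "Y \<in> Obj S" "Z \<in> Obj S"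
  shows "inverse_arrows S (X \<boxtimes> Y \<boxtimes> Z) (X \<boxtimes> (Y \<boxtimes> Z)) (Assoc S X Y Z) (inv_arr S (Assoc S X Y Z))"
  by (rule inv_arr_inverse[OF _ _ assoc_iso[OF assms]]) (simp_all add: assms tensor_obj)

lemma arrow_inv_assoc:
  assumes "X \<in> Obj S" "Y \<in> Obj S" "Z \<in> Obj S"
  shows "arrow (inv_arr S (Assoc S X Y Z))" "src (inv_arr S (Assoc S X Y Z)) = X \<boxtimes> (Y \<boxtimes> Z)"
    "trg (inv_arr S (Assoc S X Y Z)) = X \<boxtimes> Y \<boxtimes> Z"
    "Assoc S X Y Z \<cdot> inv_arr S (Assoc S X Y Z) = Ident S (X \<boxtimes> (Y \<boxtimes> Z))"
    "inv_arr S (Assoc S X Y Z) \<cdot> Assoc S X Y Z = Ident S (X \<boxtimes> Y \<boxtimes> Z)"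
  using inv_assoc_inverse[OF assms] assms tensor_obj unfolding inverse_arrows_def
  by (simp_all add: in_arr_iff)

lemma arrow_inv_assoc_cancel:
  assumes "X \<in> Obj S" "Y \<in> Obj S" "Z \<in> Obj S" "arrow k"
  shows "trg k = X \<boxtimes> (Y \<boxtimes> Z) \<Longrightarrow> Assoc S X Y Z \<cdot> (inv_arr S (Assoc S X Y Z) \<cdot> k) = k"
    "trg k = X \<boxtimes> Y \<boxtimes> Z \<Longrightarrow> inv_arr S (Assoc S X Y Z) \<cdot> (Assoc S X Y Z \<cdot> k) = k"
  using assms arrow_inv_assoc[OF assms(1-3)] arrow_assoc[OF assms(1-3)]
  by (simp_all add: arrow_comp_ident flip: arrow_comp_assoc)

text \<open>The objects are variables tied to the targets by premises, so that the rule matches any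
  form of the objects in \<open>Assoc\<close>.\<close>

lemma arrow_assoc_natural:
  assumes "arrow f" "arrow g" "arrow h" "X = trg f" "Y = trg g" "Z = trg h"
  shows "Assoc S X Y Z \<cdot> (f \<boxdot> g \<boxdot> h) = (f \<boxdot> (g \<boxdot> h)) \<cdot> Assoc S (src f) (src g) (src h)"
  using assoc_natural arrowE assms by metis

lemma arrow_assoc_natural_assoc:
  assumes "arrow f" "arrow g" "arrow h" "X = trg f" "Y = trg g" "Z = trg h"
    "arrow k" "trg k = src f \<boxtimes> src g \<boxtimes> src h"
  shows "Assoc S X Y Z \<cdot> ((f \<boxdot> g \<boxdot> h) \<cdot> k)
    = (f \<boxdot> (g \<boxdot> h)) \<cdot> (Assoc S (src f) (src g) (src h) \<cdot> k)"
proof -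
  have "Assoc S X Y Z \<cdot> ((f \<boxdot> g \<boxdot> h) \<cdot> k) = (Assoc S X Y Z \<cdot> (f \<boxdot> g \<boxdot> h)) \<cdot> k"
    using assms by (simp add: tensor_simps arrow_assoc)
  also have "\<dots> = ((f \<boxdot> (g \<boxdot> h)) \<cdot> Assoc S (src f) (src g) (src h)) \<cdot> k"
    by (simp only: arrow_assoc_natural[OF assms(1-6)])
  also have "\<dots> = (f \<boxdot> (g \<boxdot> h)) \<cdot> (Assoc S (src f) (src g) (src h) \<cdot> k)"
    using assms by (simp add: tensor_simps arrow_assoc)
  finally show ?thesis .
qed

lemmas semigroup_simps = tensor_simps arrow_assoc arrow_inv_assoc arrow_inv_assoc_cancel
lemmas natural_simps = arrow_assoc_natural arrow_assoc_natural_assoc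

end

text \<open>An infinite universe contains the coends of its presheaves, so here \<open>day\<close>
  denotes a genuine Day convolution and not an arbitrary value of \<open>SOME\<close>.\<close>

locale large_semigroup_category = structured_semigroup_category K S
  for K :: "'k ring" and S :: "('o, 'k, 'a, 'z) semicat_scheme" (structure) +
  assumes infinite_universe: "infinite (UNIV :: 'a set)"
begin

lemma day_convolution_day:
  assumes "is_presheaf K S P" "is_presheaf K S Q"
  shows "is_day_convolution K S P Q (day K S P Q) (day_in K S P Q)"
proof -
  have "\<exists>c. (case c of (R, \<kappa>) \<Rightarrow> is_day_convolution K S P Q R \<kappa>)"
    using day_convolution_exists[OF infinite_universe assms] by auto
  from someI_ex[OF this] show ?thesis
    unfolding day_def day_in_def day_choice_def by (simp add: case_prod_unfold)
qed

lemma day_presheaf: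
  "is_presheaf K S P \<Longrightarrow> is_presheaf K S Q \<Longrightarrow> is_presheaf K S (day K S P Q)"
  by (rule day_convolution_presheaf[OF day_convolution_day])

text \<open>Shows that the description defining \<open>day_arr\<close> denotes: the prescribed
  values form a cowedge, which gives existence, and generators determine a transformation, which
  gives uniqueness.\<close>

lemma day_arr_obtain:
  assumes P: "is_presheaf K S P" "is_presheaf K S P'" and Q: "is_presheaf K S Q" "is_presheaf K S Q'"
    and \<theta>: "presheaf_nat K S P P' \<theta>" and \<theta>': "presheaf_nat K S Q Q' \<theta>'"
  obtains \<tau> where "presheaf_nat K S (day K S P Q) (day K S P' Q') \<tau>"
    "day_arr K S (presheaf_arr S P P' \<theta>) (presheaf_arr S Q Q' \<theta>') = presheaf_arr S (day K S P Q) (day K S P' Q') \<tau>"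
    "\<And>X H L f p q. \<lbrakk>X \<in> Obj S; H \<in> Obj S; L \<in> Obj S; f \<in> arr S X (H \<boxtimes> L);
      p \<in> carrier (PVal P H); q \<in> carrier (PVal Q L)\<rbrakk>
      \<Longrightarrow> \<tau> X (day_in K S P Q H L f p q) = day_in K S P' Q' H L f (\<theta> H p) (\<theta>' L q)"
proof -
  note D = day_convolution_day[OF P(1) Q(1)] and D' = day_convolution_day[OF P(2) Q(2)]
  note psh' = day_presheaf[OF P(2) Q(2)]
  note cow = day_convolution_cowedge[OF D']
  obtain \<tau> where \<tau>: "presheaf_nat K S (day K S P Q) (day K S P' Q') \<tau>"
    and \<tau>_in: "\<And>X H L f p q. \<lbrakk>X \<in> Obj S; H \<in> Obj S; L \<in> Obj S; f \<in> arr S X (H \<boxtimes> L);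
      p \<in> carrier (PVal P H); q \<in> carrier (PVal Q L)\<rbrakk>
      \<Longrightarrow> \<tau> X (day_in K S P Q H L f p q) = day_in K S P' Q' H L f (\<theta> H p) (\<theta>' L q)"
  proof (rule day_convolution_lift[OF D psh', where w = "\<lambda>X H L f p q. day_in K S P' Q' H L f (\<theta> H p) (\<theta>' L q)"])
    fix X assume X: "X \<in> Obj S"
    show "day_cowedge K S P Q X (PVal (day K S P' Q') X) (\<lambda>H L f p q. day_in K S P' Q' H L f (\<theta> H p) (\<theta>' L q))"
    proof (rule day_cowedgeI)
      fix H L p q assume a: "H \<in> Obj S" "L \<in> Obj S" "p \<in> carrier (PVal P H)" "q \<in> carrier (PVal Q L)"
      show "linear_map K (Hom S X (H \<boxtimes> L)) (PVal (day K S P' Q') X)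
          (\<lambda>f. day_in K S P' Q' H L f (\<theta> H p) (\<theta>' L q))"
        by (rule day_cowedge_linear_arr[OF cow[OF X]])
          (use a presheaf_nat_closed[OF \<theta>] presheaf_nat_closed[OF \<theta>'] in auto)
    next
      fix H L f q assume a: "H \<in> Obj S" "L \<in> Obj S" "f \<in> arr S X (H \<boxtimes> L)" "q \<in> carrier (PVal Q L)"
      show "linear_map K (PVal P H) (PVal (day K S P' Q') X) (\<lambda>p. day_in K S P' Q' H L f (\<theta> H p) (\<theta>' L q))"
        by (rule linear_map_compose[OF presheaf_nat_linear[OF \<theta> a(1)] day_cowedge_linear_left[OF cow[OF X] a(1-3)]])
          (use a presheaf_nat_closed[OF \<theta>'] in auto)
    next
      fix H L f p assume a: "H \<in> Obj S" "L \<in> Obj S" "f \<in> arr S X (H \<boxtimes> L)" "p \<in> carrier (PVal P H)"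
      show "linear_map K (PVal Q L) (PVal (day K S P' Q') X) (\<lambda>q. day_in K S P' Q' H L f (\<theta> H p) (\<theta>' L q))"
        by (rule linear_map_compose[OF presheaf_nat_linear[OF \<theta>' a(2)] day_cowedge_linear_right[OF cow[OF X] a(1-3)]])
          (use a presheaf_nat_closed[OF \<theta>] in auto)
    next
      fix H H' L L' h l f p q
      assume a: "H \<in> Obj S" "H' \<in> Obj S" "L \<in> Obj S" "L' \<in> Obj S" "h \<in> arr S H H'" "l \<in> arr S L L'"
        "f \<in> arr S X (H \<boxtimes> L)" "p \<in> carrier (PVal P H')" "q \<in> carrier (PVal Q L')"
      show "day_in K S P' Q' H' L' ((h \<boxdot> l) \<cdot> f) (\<theta> H' p) (\<theta>' L' q)
          = day_in K S P' Q' H L f (\<theta> H (PAct P h p)) (\<theta>' L (PAct Q l q))"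
        using day_cowedge_dinatural[OF cow[OF X] a(1-7)] a
        by (simp add: presheaf_nat_natural[OF \<theta> a(1,2,5,8)] presheaf_nat_natural[OF \<theta>' a(3,4,6,9)]
            presheaf_nat_closed[OF \<theta>] presheaf_nat_closed[OF \<theta>'])
    qed
  next
    fix X Y g H L f p q
    assume a: "X \<in> Obj S" "Y \<in> Obj S" "g \<in> arr S X Y" "H \<in> Obj S" "L \<in> Obj S" "f \<in> arr S Y (H \<boxtimes> L)"
      "p \<in> carrier (PVal P H)" "q \<in> carrier (PVal Q L)"
    show "PAct (day K S P' Q') g (day_in K S P' Q' H L f (\<theta> H p) (\<theta>' L q))
        = day_in K S P' Q' H L (f \<cdot> g) (\<theta> H p) (\<theta>' L q)"
      by (rule day_convolution_act[OF D' a(1-6)])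
        (use a presheaf_nat_closed[OF \<theta>] presheaf_nat_closed[OF \<theta>'] in auto)
  qed (rule that)
  have "day_arr K S (presheaf_arr S P P' \<theta>) (presheaf_arr S Q Q' \<theta>') = presheaf_arr S (day K S P Q) (day K S P' Q') \<tau>"
    unfolding day_arr_def Let_def fst_presheaf_arr fst_snd_presheaf_arr
  proof (rule the_equality, intro conjI ballI)
    show "presheaf_arr S (day K S P Q) (day K S P' Q') \<tau> \<in> carrier (presheaf_Hom K S (day K S P Q) (day K S P' Q'))"
      using \<tau> by (rule presheaf_arr_in_Hom)
  next
    fix X H L f p q assume a: "X \<in> Obj S" "H \<in> Obj S" "L \<in> Obj S" "f \<in> arr S X (H \<boxtimes> L)"
      "p \<in> carrier (PVal P H)" "q \<in> carrier (PVal Q L)"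
    then show "component (presheaf_arr S (day K S P Q) (day K S P' Q') \<tau>) X (day_in K S P Q H L f p q)
        = day_in K S P' Q' H L f (component (presheaf_arr S P P' \<theta>) H p) (component (presheaf_arr S Q Q' \<theta>') L q)"
      by (simp add: \<tau>_in day_convolution_closed[OF D])
  next
    fix \<zeta> assume \<zeta>: "\<zeta> \<in> carrier (presheaf_Hom K S (day K S P Q) (day K S P' Q')) \<and>
      (\<forall>X\<in>Obj S. \<forall>H\<in>Obj S. \<forall>L\<in>Obj S. \<forall>f\<in>arr S X (H \<boxtimes> L).
        \<forall>p\<in>carrier (PVal P H). \<forall>q\<in>carrier (PVal Q L).
          component \<zeta> X (day_in K S P Q H L f p q)
            = day_in K S P' Q' H L f (component (presheaf_arr S P P' \<theta>) H p) (component (presheaf_arr S Q Q' \<theta>') L q))"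
    then obtain \<xi> where \<xi>: "\<zeta> = presheaf_arr S (day K S P Q) (day K S P' Q') \<xi>"
      "presheaf_nat K S (day K S P Q) (day K S P' Q') \<xi>"
      by (auto simp: arr_presheaf_Hom)
    show "\<zeta> = presheaf_arr S (day K S P Q) (day K S P' Q') \<tau>"
      unfolding \<xi>(1)
    proof (rule presheaf_arr_eqI, rule day_convolution_unique[OF D psh' \<xi>(2) \<tau>])
      fix X H L f p q assume a: "X \<in> Obj S" "H \<in> Obj S" "L \<in> Obj S" "f \<in> arr S X (H \<boxtimes> L)"
        "p \<in> carrier (PVal P H)" "q \<in> carrier (PVal Q L)"
      then have "component \<zeta> X (day_in K S P Q H L f p q) = day_in K S P' Q' H L f (\<theta> H p) (\<theta>' L q)"
        using conjunct2[OF \<zeta>] by simp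
      then show "\<xi> X (day_in K S P Q H L f p q) = \<tau> X (day_in K S P Q H L f p q)"
        using a by (simp add: \<tau>_in \<xi>(1) day_convolution_closed[OF D])
    qed
  qed
  then show ?thesis using \<tau> \<tau>_in by (intro that)
qed

end

section \<open>The associator of Day convolution\<close>

context structured_semigroup_category
begin

text \<open>The arrow component of the formula that specifies \<open>day_assoc\<close> on
  generators.\<close>

definition reassoc :: "'o \<Rightarrow> 'o \<Rightarrow> 'o \<Rightarrow> 'a \<Rightarrow> 'a \<Rightarrow> 'a" where
  "reassoc A B L g f = Assoc S A B L \<cdot> (g \<boxdot> Ident S L) \<cdot> f"

context
  fixes A B H L X
  assumes obj: "A \<in> Obj S" "B \<in> Obj S" "H \<in> Obj S" "L \<in> Obj S" "X \<in> Obj S"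
begin

lemma reassoc_arr:
  "g \<in> arr S H (A \<boxtimes> B) \<Longrightarrow> f \<in> arr S X (H \<boxtimes> L)
    \<Longrightarrow> reassoc A B L g f \<in> arr S X (A \<boxtimes> (B \<boxtimes> L))"
  using obj by (simp add: reassoc_def in_arr_iff semigroup_simps)

lemma reassoc_linear_right:
  assumes "g \<in> arr S H (A \<boxtimes> B)"
  shows "linear_map K (Hom S X (H \<boxtimes> L)) (Hom S X (A \<boxtimes> (B \<boxtimes> L))) (reassoc A B L g)"
  unfolding reassoc_def
  by (rule comp_linear_right) (use obj assms in \<open>simp_all add: in_arr_iff semigroup_simps\<close>)

lemma reassoc_linear_left:
  assumes "f \<in> arr S X (H \<boxtimes> L)"
  shows "linear_map K (Hom S H (A \<boxtimes> B)) (Hom S X (A \<boxtimes> (B \<boxtimes> L))) (\<lambda>g. reassoc A B L g f)"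
proof -
  have 1: "linear_map K (Hom S H (A \<boxtimes> B)) (Hom S (H \<boxtimes> L) (A \<boxtimes> B \<boxtimes> L)) (\<lambda>g. g \<boxdot> Ident S L)"
    by (rule tensor_linear_left) (use obj in \<open>simp_all add: tensor_obj ident_arr\<close>)
  have 2: "linear_map K (Hom S (H \<boxtimes> L) (A \<boxtimes> B \<boxtimes> L)) (Hom S (H \<boxtimes> L) (A \<boxtimes> (B \<boxtimes> L)))
      (\<lambda>x. Assoc S A B L \<cdot> x)"
    by (rule comp_linear_right) (use obj in \<open>simp_all add: tensor_obj assoc_arr\<close>)
  have 3: "linear_map K (Hom S (H \<boxtimes> L) (A \<boxtimes> (B \<boxtimes> L))) (Hom S X (A \<boxtimes> (B \<boxtimes> L))) (\<lambda>x. x \<cdot> f)"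
    by (rule comp_linear_left) (use obj assms in \<open>simp_all add: tensor_obj\<close>)
  show ?thesis unfolding reassoc_def
    using linear_map_compose[OF linear_map_compose[OF 1 2] 3] .
qed

lemma reassoc_comp:
  assumes "W \<in> Obj S" "k \<in> arr S W X" "g \<in> arr S H (A \<boxtimes> B)" "f \<in> arr S X (H \<boxtimes> L)"
  shows "reassoc A B L g (f \<cdot> k) = reassoc A B L g f \<cdot> k"
  using assms obj by (simp add: reassoc_def in_arr_iff semigroup_simps)

lemma reassoc_natural_left:
  assumes "A' \<in> Obj S" "B' \<in> Obj S" "h \<in> arr S A A'" "l \<in> arr S B B'"
    "g \<in> arr S H (A \<boxtimes> B)" "f \<in> arr S X (H \<boxtimes> L)"
  shows "reassoc A' B' L ((h \<boxdot> l) \<cdot> g) f = (h \<boxdot> (l \<boxdot> Ident S L)) \<cdot> reassoc A B L g f"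
proof -
  have "((h \<boxdot> l) \<cdot> g) \<boxdot> Ident S L = (h \<boxdot> l \<boxdot> Ident S L) \<cdot> (g \<boxdot> Ident S L)"
    using assms obj by (simp add: in_arr_iff semigroup_simps interchange_simps)
  then show ?thesis
    using assms obj by (simp add: reassoc_def in_arr_iff semigroup_simps natural_simps)
qed

text \<open>By interchange \<open>h\<close> is absorbed into \<open>g\<close> while \<open>l\<close>
  is moved to the outside, where it passes the associator by naturality.\<close>

lemma reassoc_natural_right:
  assumes "H' \<in> Obj S" "L' \<in> Obj S" "h \<in> arr S H H'" "l \<in> arr S L L'"
    "g \<in> arr S H' (A \<boxtimes> B)" "f \<in> arr S X (H \<boxtimes> L)"
  shows "reassoc A B L' g ((h \<boxdot> l) \<cdot> f)
    = (Ident S A \<boxdot> (Ident S B \<boxdot> l)) \<cdot> reassoc A B L (g \<cdot> h) f"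
proof -
  have "(g \<boxdot> Ident S L') \<cdot> ((h \<boxdot> l) \<cdot> f)
      = (Ident S A \<boxdot> Ident S B \<boxdot> l) \<cdot> (((g \<cdot> h) \<boxdot> Ident S L) \<cdot> f)"
    using assms obj by (simp add: in_arr_iff semigroup_simps interchange_simps)
  \<comment> \<open>\<open>tensor_ident\<close> is withheld here: once the two identities are fused,
    naturality of the associator no longer matches.\<close>
  moreover have "Assoc S A B L' \<cdot> ((Ident S A \<boxdot> Ident S B \<boxdot> l) \<cdot> (((g \<cdot> h) \<boxdot> Ident S L) \<cdot> f))
      = (Ident S A \<boxdot> (Ident S B \<boxdot> l)) \<cdot> (Assoc S A B L \<cdot> (((g \<cdot> h) \<boxdot> Ident S L) \<cdot> f))"
    using assms obj arrow_assoc_natural_assoc[of "Ident S A" "Ident S B" l A B L' "((g \<cdot> h) \<boxdot> Ident S L) \<cdot> f"]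
    by (simp add: in_arr_iff semigroup_simps del: tensor_ident)
  ultimately show ?thesis
    using assms obj by (simp add: reassoc_def in_arr_iff semigroup_simps del: tensor_ident)
qed

end

end

context tensor_category
begin

text \<open>Uniqueness for coends is applied twice. On a generator of the outer coend both sides are
  linear in its first entry, which ranges over the inner coend.\<close>

lemma day_convolution_unique_nested:
  assumes D1: "is_day_convolution K S P Q D1 \<kappa>1" and D2: "is_day_convolution K S D1 R D2 \<kappa>2"
    and E: "is_presheaf K S E" and \<xi>: "presheaf_nat K S D2 E \<xi>" and \<tau>: "presheaf_nat K S D2 E \<tau>"
    and eq: "\<And>X H L A B f g p q r. \<lbrakk>X \<in> Obj S; H \<in> Obj S; L \<in> Obj S; A \<in> Obj S; B \<in> Obj S;
      f \<in> arr S X (H \<boxtimes> L); g \<in> arr S H (A \<boxtimes> B); p \<in> carrier (PVal P A); q \<in> carrier (PVal Q B);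
      r \<in> carrier (PVal R L)\<rbrakk> \<Longrightarrow> \<xi> X (\<kappa>2 H L f (\<kappa>1 A B g p q) r) = \<tau> X (\<kappa>2 H L f (\<kappa>1 A B g p q) r)"
    and X: "X \<in> Obj S" and m: "m \<in> carrier (PVal D2 X)"
  shows "\<xi> X m = \<tau> X m"
proof (rule day_convolution_unique[OF D2 E \<xi> \<tau> _ X m])
  fix X H L f z r assume a: "X \<in> Obj S" "H \<in> Obj S" "L \<in> Obj S" "f \<in> arr S X (H \<boxtimes> L)"
    "z \<in> carrier (PVal D1 H)" "r \<in> carrier (PVal R L)"
  note lin = day_cowedge_linear_left[OF day_convolution_cowedge[OF D2 a(1)] a(2-4,6)]
  show "\<xi> X (\<kappa>2 H L f z r) = \<tau> X (\<kappa>2 H L f z r)"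
    by (rule coend_unique[OF day_convolution_coend[OF D1 a(2)] presheaf_module[OF E a(1)]
          linear_map_compose[OF lin presheaf_nat_linear[OF \<xi> a(1)]]
          linear_map_compose[OF lin presheaf_nat_linear[OF \<tau> a(1)]] _ a(5)])
      (rule eq[OF a(1-3) _ _ a(4) _ _ _ a(6)])
qed

end

context large_semigroup_category
begin

text \<open>The formula is bilinear data on an iterated coend, so the map is built in two stages:
  with \<open>f\<close> and \<open>r\<close> fixed it is lifted over the inner coend, and the
  resulting maps form a cowedge for the outer one. All conditions of the second stage are checked on
  inner generators.\<close>

lemma day_assoc_obtain:
  assumes P: "is_presheaf K S P" and Q: "is_presheaf K S Q" and R: "is_presheaf K S R"
  obtains \<tau> where "presheaf_nat K S (day K S (day K S P Q) R) (day K S P (day K S Q R)) \<tau>"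
    "day_assoc K S P Q R = presheaf_arr S (day K S (day K S P Q) R) (day K S P (day K S Q R)) \<tau>"
    "\<And>X H L A B f g p q r. \<lbrakk>X \<in> Obj S; H \<in> Obj S; L \<in> Obj S; A \<in> Obj S; B \<in> Obj S;
      f \<in> arr S X (H \<boxtimes> L); g \<in> arr S H (A \<boxtimes> B); p \<in> carrier (PVal P A); q \<in> carrier (PVal Q B);
      r \<in> carrier (PVal R L)\<rbrakk> \<Longrightarrow>
      \<tau> X (day_in K S (day K S P Q) R H L f (day_in K S P Q A B g p q) r)
        = day_in K S P (day K S Q R) A (B \<boxtimes> L) (reassoc A B L g f) p
            (day_in K S Q R B L (Ident S (B \<boxtimes> L)) q r)"
proof -
  define D1 where "D1 = day K S P Q"
  define D2 where "D2 = day K S D1 R"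
  define E1 where "E1 = day K S Q R"
  define E2 where "E2 = day K S P E1"
  define \<kappa>1 where "\<kappa>1 = day_in K S P Q"
  define \<kappa>2 where "\<kappa>2 = day_in K S D1 R"
  define \<mu>1 where "\<mu>1 = day_in K S Q R"
  define \<mu>2 where "\<mu>2 = day_in K S P E1"
  note defs = D1_def D2_def E1_def E2_def \<kappa>1_def \<kappa>2_def \<mu>1_def \<mu>2_def
  have D1: "is_day_convolution K S P Q D1 \<kappa>1" and E1: "is_day_convolution K S Q R E1 \<mu>1"
    unfolding defs by (rule day_convolution_day[OF P Q], rule day_convolution_day[OF Q R])
  note D1_psh = day_convolution_presheaf[OF D1] and E1_psh = day_convolution_presheaf[OF E1]
  have D2: "is_day_convolution K S D1 R D2 \<kappa>2" unfolding D2_def \<kappa>2_def by (rule day_convolution_day[OF D1_psh R])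
  have E2: "is_day_convolution K S P E1 E2 \<mu>2" unfolding E2_def \<mu>2_def by (rule day_convolution_day[OF P E1_psh])
  note E2_psh = day_convolution_presheaf[OF E2]
  note E1_cow = day_convolution_cowedge[OF E1] and E2_cow = day_convolution_cowedge[OF E2]
  note id_BL = ident_arr[OF tensor_obj]
  \<comment> \<open>The generator carried by the identity arrow, that is, the universal pairing of
    \<open>Q\<close> and \<open>R\<close> into their convolution.\<close>
  define \<iota> where "\<iota> B L q r = \<mu>1 B L (Ident S (B \<boxtimes> L)) q r" for B L q r
  have \<iota>_closed: "\<iota> B L q r \<in> carrier (PVal E1 (B \<boxtimes> L))"
    if "B \<in> Obj S" "L \<in> Obj S" "q \<in> carrier (PVal Q B)" "r \<in> carrier (PVal R L)" for B L q r
    unfolding \<iota>_def using that by (intro day_convolution_closed[OF E1] tensor_obj id_BL)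
  have \<iota>_lin_left: "linear_map K (PVal Q B) (PVal E1 (B \<boxtimes> L)) (\<lambda>q. \<iota> B L q r)"
    if "B \<in> Obj S" "L \<in> Obj S" "r \<in> carrier (PVal R L)" for B L r
    unfolding \<iota>_def using that by (intro day_cowedge_linear_left[OF E1_cow] tensor_obj id_BL)
  have \<iota>_lin_right: "linear_map K (PVal R L) (PVal E1 (B \<boxtimes> L)) (\<iota> B L q)"
    if "B \<in> Obj S" "L \<in> Obj S" "q \<in> carrier (PVal Q B)" for B L q
    unfolding \<iota>_def using that by (intro day_cowedge_linear_right[OF E1_cow] tensor_obj id_BL)
  \<comment> \<open>Acting by \<open>b \<boxdot> l\<close> puts that arrow to the right of an
    identity. Moved to the left of it, dinaturality transfers it onto \<open>q\<close> and
    \<open>r\<close>.\<close>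
  have \<iota>_act: "PAct E1 (b \<boxdot> l) (\<iota> B' L' q r) = \<iota> B L (PAct Q b q) (PAct R l r)"
    if a: "B \<in> Obj S" "B' \<in> Obj S" "L \<in> Obj S" "L' \<in> Obj S" "b \<in> arr S B B'" "l \<in> arr S L L'"
      "q \<in> carrier (PVal Q B')" "r \<in> carrier (PVal R L')" for B B' L L' b l q r
  proof -
    have bl: "b \<boxdot> l \<in> arr S (B \<boxtimes> L) (B' \<boxtimes> L')" using a by (intro tensor_closed)
    have "PAct E1 (b \<boxdot> l) (\<iota> B' L' q r) = \<mu>1 B' L' (Ident S (B' \<boxtimes> L') \<cdot> (b \<boxdot> l)) q r"
      unfolding \<iota>_def
      by (rule day_convolution_act[OF E1 tensor_obj[OF a(1,3)] tensor_obj[OF a(2,4)] bl a(2,4) id_BL[OF a(2,4)] a(7,8)])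
    also have "Ident S (B' \<boxtimes> L') \<cdot> (b \<boxdot> l) = (b \<boxdot> l) \<cdot> Ident S (B \<boxtimes> L)"
      using a by (simp add: in_arr_iff semigroup_simps)
    also have "\<mu>1 B' L' \<dots> q r = \<iota> B L (PAct Q b q) (PAct R l r)"
      unfolding \<iota>_def
      by (rule day_cowedge_dinatural[OF E1_cow[OF tensor_obj[OF a(1,3)]] a(1-6) id_BL[OF a(1,3)] a(7,8)])
    finally show ?thesis .
  qed
  define v where "v L f r A B g p q = \<mu>2 A (B \<boxtimes> L) (reassoc A B L g f) p (\<iota> B L q r)" for L f r A B g p q
  have v_cow: "day_cowedge K S P Q H (PVal E2 X) (v L f r)"
    if X: "X \<in> Obj S" and H: "H \<in> Obj S" and L: "L \<in> Obj S" and f: "f \<in> arr S X (H \<boxtimes> L)"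
      and r: "r \<in> carrier (PVal R L)" for X H L f r
  proof (rule day_cowedgeI)
    fix A B p q assume a: "A \<in> Obj S" "B \<in> Obj S" "p \<in> carrier (PVal P A)" "q \<in> carrier (PVal Q B)"
    show "linear_map K (Hom S H (A \<boxtimes> B)) (PVal E2 X) (\<lambda>g. v L f r A B g p q)"
      unfolding v_def
      by (rule linear_map_compose[OF reassoc_linear_left[OF a(1,2) H L X f] day_cowedge_linear_arr[OF E2_cow[OF X]]])
        (use a L r in \<open>simp_all add: tensor_obj \<iota>_closed\<close>)
  next
    fix A B g q assume a: "A \<in> Obj S" "B \<in> Obj S" "g \<in> arr S H (A \<boxtimes> B)" "q \<in> carrier (PVal Q B)"
    show "linear_map K (PVal P A) (PVal E2 X) (\<lambda>p. v L f r A B g p q)"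
      unfolding v_def
      by (rule day_cowedge_linear_left[OF E2_cow[OF X] a(1) _ reassoc_arr[OF a(1,2) H L X a(3) f]])
        (use a L r in \<open>simp_all add: tensor_obj \<iota>_closed\<close>)
  next
    fix A B g p assume a: "A \<in> Obj S" "B \<in> Obj S" "g \<in> arr S H (A \<boxtimes> B)" "p \<in> carrier (PVal P A)"
    show "linear_map K (PVal Q B) (PVal E2 X) (\<lambda>q. v L f r A B g p q)"
      unfolding v_def
      by (rule linear_map_compose[OF \<iota>_lin_left[OF a(2) L r]
            day_cowedge_linear_right[OF E2_cow[OF X] a(1) _ reassoc_arr[OF a(1,2) H L X a(3) f] a(4)]])
        (use a L in \<open>simp add: tensor_obj\<close>)
  next
    fix A A' B B' h b g p q
    assume a: "A \<in> Obj S" "A' \<in> Obj S" "B \<in> Obj S" "B' \<in> Obj S" "h \<in> arr S A A'" "b \<in> arr S B B'"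
      "g \<in> arr S H (A \<boxtimes> B)" "p \<in> carrier (PVal P A')" "q \<in> carrier (PVal Q B')"
    have bL: "b \<boxdot> Ident S L \<in> arr S (B \<boxtimes> L) (B' \<boxtimes> L)"
      using a L by (intro tensor_closed ident_arr)
    have "v L f r A' B' ((h \<boxdot> b) \<cdot> g) p q
        = \<mu>2 A' (B' \<boxtimes> L) ((h \<boxdot> (b \<boxdot> Ident S L)) \<cdot> reassoc A B L g f) p (\<iota> B' L q r)"
      unfolding v_def by (simp add: reassoc_natural_left[OF a(1,3) H L X a(2,4,5,6,7) f])
    also have "\<dots> = \<mu>2 A (B \<boxtimes> L) (reassoc A B L g f) (PAct P h p) (PAct E1 (b \<boxdot> Ident S L) (\<iota> B' L q r))"
      by (rule day_cowedge_dinatural[OF E2_cow[OF X] a(1,2) _ _ a(5) bL reassoc_arr[OF a(1,3) H L X a(7) f] a(8)])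
        (use a L r in \<open>simp_all add: tensor_obj \<iota>_closed\<close>)
    also have "\<dots> = v L f r A B g (PAct P h p) (PAct Q b q)"
      unfolding v_def using \<iota>_act[OF a(3,4) L L a(6) ident_arr[OF L] a(9) r] presheaf_ident[OF R L r] by simp
    finally show "v L f r A' B' ((h \<boxdot> b) \<cdot> g) p q = v L f r A B g (PAct P h p) (PAct Q b q)" .
  qed
  \<comment> \<open>The lift of \<open>v L f r\<close> over the inner coend. \<open>SOME\<close> is
    harmless, since the lift is unique on the carrier.\<close>
  define T where "T X H L f r = (SOME t. linear_map K (PVal D1 H) (PVal E2 X) t \<and>
    (\<forall>A\<in>Obj S. \<forall>B\<in>Obj S. \<forall>g\<in>arr S H (A \<boxtimes> B). \<forall>p\<in>carrier (PVal P A). \<forall>q\<in>carrier (PVal Q B).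
      t (\<kappa>1 A B g p q) = v L f r A B g p q))" for X H L f r
  have T_ex: "\<exists>t. linear_map K (PVal D1 H) (PVal E2 X) t \<and>
    (\<forall>A\<in>Obj S. \<forall>B\<in>Obj S. \<forall>g\<in>arr S H (A \<boxtimes> B). \<forall>p\<in>carrier (PVal P A). \<forall>q\<in>carrier (PVal Q B).
      t (\<kappa>1 A B g p q) = v L f r A B g p q)"
    if a: "X \<in> Obj S" "H \<in> Obj S" "L \<in> Obj S" "f \<in> arr S X (H \<boxtimes> L)" "r \<in> carrier (PVal R L)" for X H L f r
    by (rule coend_lift[OF day_convolution_coend[OF D1 a(2)] presheaf_module[OF E2_psh a(1)] v_cow[OF a]]) blast
  have T_lin: "linear_map K (PVal D1 H) (PVal E2 X) (T X H L f r)"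
    and T_in: "\<And>A B g p q. \<lbrakk>A \<in> Obj S; B \<in> Obj S; g \<in> arr S H (A \<boxtimes> B); p \<in> carrier (PVal P A); q \<in> carrier (PVal Q B)\<rbrakk>
      \<Longrightarrow> T X H L f r (\<kappa>1 A B g p q) = v L f r A B g p q"
    if a: "X \<in> Obj S" "H \<in> Obj S" "L \<in> Obj S" "f \<in> arr S X (H \<boxtimes> L)" "r \<in> carrier (PVal R L)" for X H L f r
    using someI_ex[OF T_ex[OF a]] unfolding T_def[symmetric] by simp_all
  have T_eq: "t z = t' z"
    if "X \<in> Obj S" "H \<in> Obj S" "linear_map K (PVal D1 H) (PVal E2 X) t" "linear_map K (PVal D1 H) (PVal E2 X) t'"
      "z \<in> carrier (PVal D1 H)"
      "\<And>A B g p q. \<lbrakk>A \<in> Obj S; B \<in> Obj S; g \<in> arr S H (A \<boxtimes> B); p \<in> carrier (PVal P A); q \<in> carrier (PVal Q B)\<rbrakk>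
        \<Longrightarrow> t (\<kappa>1 A B g p q) = t' (\<kappa>1 A B g p q)" for X H t t' z
    by (rule coend_unique[OF day_convolution_coend[OF D1 that(2)] presheaf_module[OF E2_psh that(1)] that(3,4,6,5)])
  obtain \<tau> where \<tau>: "presheaf_nat K S D2 E2 \<tau>"
    and \<tau>_in: "\<And>X H L f z r. \<lbrakk>X \<in> Obj S; H \<in> Obj S; L \<in> Obj S; f \<in> arr S X (H \<boxtimes> L);
      z \<in> carrier (PVal D1 H); r \<in> carrier (PVal R L)\<rbrakk> \<Longrightarrow> \<tau> X (\<kappa>2 H L f z r) = T X H L f r z"
  proof (rule day_convolution_lift[OF D2 E2_psh, where w = "\<lambda>X H L f z r. T X H L f r z"])
    fix X assume X: "X \<in> Obj S"
    have modX: "module K (PVal E2 X)" by (rule presheaf_module[OF E2_psh X])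
    show "day_cowedge K S D1 R X (PVal E2 X) (\<lambda>H L f z r. T X H L f r z)"
    proof (rule day_cowedgeI)
      fix H L z r assume a: "H \<in> Obj S" "L \<in> Obj S" "z \<in> carrier (PVal D1 H)" "r \<in> carrier (PVal R L)"
      note Hom = hom_module[OF X tensor_obj[OF a(1,2)]]
      show "linear_map K (Hom S X (H \<boxtimes> L)) (PVal E2 X) (\<lambda>f. T X H L f r z)"
      proof (rule coend_linear_parameter[OF day_convolution_coend[OF D1 a(1)] Hom modX T_lin[OF X a(1,2) _ a(4)] _ a(3)])
        fix A B g p q
        assume b: "A \<in> Obj S" "B \<in> Obj S" "g \<in> arr S H (A \<boxtimes> B)" "p \<in> carrier (PVal P A)" "q \<in> carrier (PVal Q B)"
        have "linear_map K (Hom S X (H \<boxtimes> L)) (PVal E2 X) (\<lambda>f. v L f r A B g p q)"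
          unfolding v_def
          by (rule linear_map_compose[OF reassoc_linear_right[OF b(1,2) a(1,2) X b(3)] day_cowedge_linear_arr[OF E2_cow[OF X]]])
            (use a b in \<open>simp_all add: tensor_obj \<iota>_closed\<close>)
        then show "linear_map K (Hom S X (H \<boxtimes> L)) (PVal E2 X) (\<lambda>f. T X H L f r (\<kappa>1 A B g p q))"
          by (rule linear_map_cong[OF Hom]) (simp add: T_in[OF X a(1,2) _ a(4) b])
      qed
    next
      fix H L f r assume a: "H \<in> Obj S" "L \<in> Obj S" "f \<in> arr S X (H \<boxtimes> L)" "r \<in> carrier (PVal R L)"
      show "linear_map K (PVal D1 H) (PVal E2 X) (\<lambda>z. T X H L f r z)" by (rule T_lin[OF X a])
    next
      fix H L f z assume a: "H \<in> Obj S" "L \<in> Obj S" "f \<in> arr S X (H \<boxtimes> L)" "z \<in> carrier (PVal D1 H)"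
      note RL = presheaf_module[OF R a(2)]
      show "linear_map K (PVal R L) (PVal E2 X) (\<lambda>r. T X H L f r z)"
      proof (rule coend_linear_parameter[OF day_convolution_coend[OF D1 a(1)] RL modX T_lin[OF X a(1-3)] _ a(4)])
        fix A B g p q
        assume b: "A \<in> Obj S" "B \<in> Obj S" "g \<in> arr S H (A \<boxtimes> B)" "p \<in> carrier (PVal P A)" "q \<in> carrier (PVal Q B)"
        have "linear_map K (PVal R L) (PVal E2 X) (\<lambda>r. v L f r A B g p q)"
          unfolding v_def
          by (rule linear_map_compose[OF \<iota>_lin_right[OF b(2) a(2) b(5)]
                day_cowedge_linear_right[OF E2_cow[OF X] b(1) _ reassoc_arr[OF b(1,2) a(1,2) X b(3) a(3)] b(4)]])
            (use a b in \<open>simp add: tensor_obj\<close>)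
        then show "linear_map K (PVal R L) (PVal E2 X) (\<lambda>r. T X H L f r (\<kappa>1 A B g p q))"
          by (rule linear_map_cong[OF RL]) (simp add: T_in[OF X a(1-3) _ b])
      qed
    next
      fix H H' L L' h l f z r
      assume a: "H \<in> Obj S" "H' \<in> Obj S" "L \<in> Obj S" "L' \<in> Obj S" "h \<in> arr S H H'" "l \<in> arr S L L'"
        "f \<in> arr S X (H \<boxtimes> L)" and z: "z \<in> carrier (PVal D1 H')" and r: "r \<in> carrier (PVal R L')"
      have hlf: "(h \<boxdot> l) \<cdot> f \<in> arr S X (H' \<boxtimes> L')"
        using a X by (simp add: in_arr_iff semigroup_simps)
      have lr: "PAct R l r \<in> carrier (PVal R L)" by (rule presheaf_closed[OF R a(3,4,6) r])
      \<comment> \<open>Both sides are linear in \<open>z\<close>, so \<open>z\<close> may be a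
        generator. Then \<open>h\<close> is composed with its arrow \<open>g\<close>, and
        \<open>l\<close> passes through the outer cowedge onto \<open>\<iota>\<close>, where it ends
        up acting on \<open>r\<close>.\<close>
      show "T X H' L' ((h \<boxdot> l) \<cdot> f) r z = T X H L f (PAct R l r) (PAct D1 h z)"
      proof (rule T_eq[OF X a(2) T_lin[OF X a(2,4) hlf r]
            linear_map_compose[OF presheaf_linear[OF D1_psh a(1,2,5)] T_lin[OF X a(1,3,7) lr]] z])
        fix A B g p q
        assume b: "A \<in> Obj S" "B \<in> Obj S" "g \<in> arr S H' (A \<boxtimes> B)" "p \<in> carrier (PVal P A)" "q \<in> carrier (PVal Q B)"
        have gh: "g \<cdot> h \<in> arr S H (A \<boxtimes> B)" using comp_closed[OF a(1,2) tensor_obj[OF b(1,2)] a(5) b(3)] .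
        have Bl: "Ident S B \<boxdot> l \<in> arr S (B \<boxtimes> L) (B \<boxtimes> L')"
          using a b by (intro tensor_closed ident_arr)
        have "T X H' L' ((h \<boxdot> l) \<cdot> f) r (\<kappa>1 A B g p q) = v L' ((h \<boxdot> l) \<cdot> f) r A B g p q"
          by (rule T_in[OF X a(2,4) hlf r b])
        also have "\<dots> = \<mu>2 A (B \<boxtimes> L') ((Ident S A \<boxdot> (Ident S B \<boxdot> l)) \<cdot> reassoc A B L (g \<cdot> h) f) p (\<iota> B L' q r)"
          unfolding v_def reassoc_natural_right[OF b(1,2) a(1,3) X a(2,4,5,6) b(3) a(7)] ..
        also have "\<dots> = \<mu>2 A (B \<boxtimes> L) (reassoc A B L (g \<cdot> h) f) (PAct P (Ident S A) p)
            (PAct E1 (Ident S B \<boxdot> l) (\<iota> B L' q r))"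
          by (rule day_cowedge_dinatural[OF E2_cow[OF X] b(1,1) _ _ ident_arr[OF b(1)] Bl
                reassoc_arr[OF b(1,2) a(1,3) X gh a(7)] b(4)])
            (use a b r in \<open>simp_all add: tensor_obj \<iota>_closed\<close>)
        also have "\<dots> = v L f (PAct R l r) A B (g \<cdot> h) p q"
          unfolding v_def \<iota>_act[OF b(2,2) a(3,4) ident_arr[OF b(2)] a(6) b(5) r]
          by (simp add: presheaf_ident[OF P b(1,4)] presheaf_ident[OF Q b(2,5)])
        also have "\<dots> = T X H L f (PAct R l r) (PAct D1 h (\<kappa>1 A B g p q))"
          unfolding day_convolution_act[OF D1 a(1,2,5) b]
          by (rule T_in[OF X a(1,3,7) lr b(1,2) gh b(4,5), symmetric])
        finally show "T X H' L' ((h \<boxdot> l) \<cdot> f) r (\<kappa>1 A B g p q)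
          = T X H L f (PAct R l r) (PAct D1 h (\<kappa>1 A B g p q))" .
      qed
    qed
  next
    fix X Y k H L f z r
    assume a: "X \<in> Obj S" "Y \<in> Obj S" "k \<in> arr S X Y" "H \<in> Obj S" "L \<in> Obj S" "f \<in> arr S Y (H \<boxtimes> L)"
      and z: "z \<in> carrier (PVal D1 H)" and r: "r \<in> carrier (PVal R L)"
    have fk: "f \<cdot> k \<in> arr S X (H \<boxtimes> L)" using comp_closed[OF a(1,2) tensor_obj[OF a(4,5)] a(3,6)] .
    show "PAct E2 k (T Y H L f r z) = T X H L (f \<cdot> k) r z"
    proof (rule T_eq[OF a(1,4) linear_map_compose[OF T_lin[OF a(2,4-6) r] presheaf_linear[OF E2_psh a(1-3)]]
          T_lin[OF a(1,4,5) fk r] z])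
      fix A B g p q
      assume b: "A \<in> Obj S" "B \<in> Obj S" "g \<in> arr S H (A \<boxtimes> B)" "p \<in> carrier (PVal P A)" "q \<in> carrier (PVal Q B)"
      have "PAct E2 k (v L f r A B g p q) = v L (f \<cdot> k) r A B g p q"
        unfolding v_def reassoc_comp[OF b(1,2) a(4,5,2,1,3) b(3) a(6)]
        by (rule day_convolution_act[OF E2 a(1-3) b(1) _ reassoc_arr[OF b(1,2) a(4,5,2) b(3) a(6)] b(4)])
          (use a b r in \<open>simp_all add: tensor_obj \<iota>_closed\<close>)
      then show "PAct E2 k (T Y H L f r (\<kappa>1 A B g p q)) = T X H L (f \<cdot> k) r (\<kappa>1 A B g p q)"
        by (simp add: T_in[OF a(2,4-6) r b] T_in[OF a(1,4,5) fk r b])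
    qed
  qed (rule that)
  have \<tau>_in': "\<tau> X (\<kappa>2 H L f (\<kappa>1 A B g p q) r) = \<mu>2 A (B \<boxtimes> L) (reassoc A B L g f) p (\<iota> B L q r)"
    if a: "X \<in> Obj S" "H \<in> Obj S" "L \<in> Obj S" and b: "A \<in> Obj S" "B \<in> Obj S" and f: "f \<in> arr S X (H \<boxtimes> L)"
      and c: "g \<in> arr S H (A \<boxtimes> B)" "p \<in> carrier (PVal P A)" "q \<in> carrier (PVal Q B)"
      and r: "r \<in> carrier (PVal R L)" for X H L A B f g p q r
    using \<tau>_in[OF a f day_convolution_closed[OF D1 a(2) b c] r] T_in[OF a f r b c] by (simp add: v_def)
  have "day_assoc K S P Q R = presheaf_arr S D2 E2 \<tau>"
    unfolding day_assoc_def
  proof (rule the_equality, intro conjI ballI, unfold defs[symmetric])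
    show "presheaf_arr S D2 E2 \<tau> \<in> carrier (presheaf_Hom K S D2 E2)"
      using \<tau> by (rule presheaf_arr_in_Hom)
  next
    fix X H L A B f g p q r
    assume a: "X \<in> Obj S" "H \<in> Obj S" "L \<in> Obj S" and b: "A \<in> Obj S" "B \<in> Obj S" and f: "f \<in> arr S X (H \<boxtimes> L)"
      and c: "g \<in> arr S H (A \<boxtimes> B)" "p \<in> carrier (PVal P A)" "q \<in> carrier (PVal Q B)"
      and r: "r \<in> carrier (PVal R L)"
    note z = day_convolution_closed[OF D1 a(2) b c]
    show "component (presheaf_arr S D2 E2 \<tau>) X (\<kappa>2 H L f (\<kappa>1 A B g p q) r)
        = \<mu>2 A (B \<boxtimes> L) (Assoc S A B L \<cdot> (g \<boxdot> Ident S L) \<cdot> f) p (\<mu>1 B L (Ident S (B \<boxtimes> L)) q r)"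
      using \<tau>_in'[OF a b f c r] day_convolution_closed[OF D2 a f z r] a(1) by (simp add: reassoc_def \<iota>_def)
  next
    fix \<zeta> assume \<zeta>: "\<zeta> \<in> carrier (presheaf_Hom K S D2 E2) \<and>
      (\<forall>X\<in>Obj S. \<forall>H\<in>Obj S. \<forall>L\<in>Obj S. \<forall>A\<in>Obj S. \<forall>B\<in>Obj S. \<forall>f\<in>arr S X (H \<boxtimes> L). \<forall>g\<in>arr S H (A \<boxtimes> B).
        \<forall>p\<in>carrier (PVal P A). \<forall>q\<in>carrier (PVal Q B). \<forall>r\<in>carrier (PVal R L).
          component \<zeta> X (\<kappa>2 H L f (\<kappa>1 A B g p q) r)
            = \<mu>2 A (B \<boxtimes> L) (Assoc S A B L \<cdot> (g \<boxdot> Ident S L) \<cdot> f) p (\<mu>1 B L (Ident S (B \<boxtimes> L)) q r))"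
    then obtain \<xi> where \<xi>: "\<zeta> = presheaf_arr S D2 E2 \<xi>" "presheaf_nat K S D2 E2 \<xi>"
      by (auto simp: arr_presheaf_Hom)
    show "\<zeta> = presheaf_arr S D2 E2 \<tau>"
      unfolding \<xi>(1)
    proof (rule presheaf_arr_eqI, rule day_convolution_unique_nested[OF D1 D2 E2_psh \<xi>(2) \<tau>])
      fix X H L A B f g p q r
      assume a: "X \<in> Obj S" "H \<in> Obj S" "L \<in> Obj S" and b: "A \<in> Obj S" "B \<in> Obj S" and f: "f \<in> arr S X (H \<boxtimes> L)"
        and c: "g \<in> arr S H (A \<boxtimes> B)" "p \<in> carrier (PVal P A)" "q \<in> carrier (PVal Q B)"
        and r: "r \<in> carrier (PVal R L)"
      note z = day_convolution_closed[OF D1 a(2) b c]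
      have "component \<zeta> X (\<kappa>2 H L f (\<kappa>1 A B g p q) r) = \<tau> X (\<kappa>2 H L f (\<kappa>1 A B g p q) r)"
        using conjunct2[OF \<zeta>] \<tau>_in'[OF a b f c r] a b f c r by (simp add: reassoc_def \<iota>_def)
      then show "\<xi> X (\<kappa>2 H L f (\<kappa>1 A B g p q) r) = \<tau> X (\<kappa>2 H L f (\<kappa>1 A B g p q) r)"
        using day_convolution_closed[OF D2 a f z r] a(1) by (simp add: \<xi>(1))
    qed
  qed
  then show ?thesis using \<tau> \<tau>_in' unfolding \<iota>_def defs by (intro that)
qed

end

section \<open>A criterion for unit objects\<close>

context tensor_category
begin

lemma day_convolution_iso:
  assumes D: "is_day_convolution K S P Q R \<kappa>" and D': "is_day_convolution K S P Q R' \<kappa>'"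
  obtains \<theta> \<theta>' where "presheaf_nat K S R R' \<theta>" "presheaf_nat K S R' R \<theta>'"
    "\<And>X m. X \<in> Obj S \<Longrightarrow> m \<in> carrier (PVal R X) \<Longrightarrow> \<theta>' X (\<theta> X m) = m"
    "\<And>X m. X \<in> Obj S \<Longrightarrow> m \<in> carrier (PVal R' X) \<Longrightarrow> \<theta> X (\<theta>' X m) = m"
    "\<And>X H L f p q. \<lbrakk>X \<in> Obj S; H \<in> Obj S; L \<in> Obj S; f \<in> arr S X (H \<boxtimes> L);
      p \<in> carrier (PVal P H); q \<in> carrier (PVal Q L)\<rbrakk> \<Longrightarrow> \<theta> X (\<kappa> H L f p q) = \<kappa>' H L f p q"
proof -
  note R = day_convolution_presheaf[OF D] and R' = day_convolution_presheaf[OF D']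
  have lift: "\<exists>\<theta>. presheaf_nat K S R R' \<theta> \<and>
      (\<forall>X H L f p q. X \<in> Obj S \<longrightarrow> H \<in> Obj S \<longrightarrow> L \<in> Obj S \<longrightarrow> f \<in> arr S X (H \<boxtimes> L) \<longrightarrow>
      p \<in> carrier (PVal P H) \<longrightarrow> q \<in> carrier (PVal Q L) \<longrightarrow> \<theta> X (\<kappa> H L f p q) = \<kappa>' H L f p q)"
    if D: "is_day_convolution K S P Q R \<kappa>" and D': "is_day_convolution K S P Q R' \<kappa>'" for R R' \<kappa> \<kappa>'
    by (rule day_convolution_lift[OF D day_convolution_presheaf[OF D'] day_convolution_cowedge[OF D']
          day_convolution_act[OF D']]) blast+
  obtain \<theta> where \<theta>: "presheaf_nat K S R R' \<theta>"
    and \<theta>_in: "\<And>X H L f p q. \<lbrakk>X \<in> Obj S; H \<in> Obj S; L \<in> Obj S; f \<in> arr S X (H \<boxtimes> L);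
      p \<in> carrier (PVal P H); q \<in> carrier (PVal Q L)\<rbrakk> \<Longrightarrow> \<theta> X (\<kappa> H L f p q) = \<kappa>' H L f p q"
    using lift[OF D D'] by blast
  obtain \<theta>' where \<theta>': "presheaf_nat K S R' R \<theta>'"
    and \<theta>'_in: "\<And>X H L f p q. \<lbrakk>X \<in> Obj S; H \<in> Obj S; L \<in> Obj S; f \<in> arr S X (H \<boxtimes> L);
      p \<in> carrier (PVal P H); q \<in> carrier (PVal Q L)\<rbrakk> \<Longrightarrow> \<theta>' X (\<kappa>' H L f p q) = \<kappa> H L f p q"
    using lift[OF D' D] by blast
  show ?thesis
  proof (rule that[OF \<theta> \<theta>' _ _ \<theta>_in])
    show "\<theta>' X (\<theta> X m) = m" if "X \<in> Obj S" "m \<in> carrier (PVal R X)" for X m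
      by (rule day_convolution_unique[OF D R presheaf_nat_compose[OF \<theta> \<theta>'] presheaf_nat_id _ that])
        (simp add: \<theta>_in \<theta>'_in)
    show "\<theta> X (\<theta>' X m) = m" if "X \<in> Obj S" "m \<in> carrier (PVal R' X)" for X m
      by (rule day_convolution_unique[OF D' R' presheaf_nat_compose[OF \<theta>' \<theta>] presheaf_nat_id _ that])
        (simp add: \<theta>_in \<theta>'_in)
  qed
qed

end

context large_semigroup_category
begin

text \<open>If \<open>P\<close> itself is a Day convolution of \<open>U\<close> and
  \<open>P\<close>, its comparison with the chosen one \<open>day K S U P\<close> is an isomorphism
  known on generators, and serves as unitor; likewise on the other side. Naturality and the triangle
  axiom then only need to be checked on generators.\<close>

lemma unit_objectI:
  assumes U: "is_presheaf K S U"
    and l: "\<And>P. is_presheaf K S P \<Longrightarrow> is_day_convolution K S U P P (l P)"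
    and r: "\<And>P. is_presheaf K S P \<Longrightarrow> is_day_convolution K S P U P (r P)"
    and l_natural: "\<And>P Q \<theta> X H L f u p. \<lbrakk>is_presheaf K S P; is_presheaf K S Q; presheaf_nat K S P Q \<theta>;
      X \<in> Obj S; H \<in> Obj S; L \<in> Obj S; f \<in> arr S X (H \<boxtimes> L); u \<in> carrier (PVal U H); p \<in> carrier (PVal P L)\<rbrakk>
      \<Longrightarrow> \<theta> X (l P H L f u p) = l Q H L f u (\<theta> L p)"
    and r_natural: "\<And>P Q \<theta> X H L f p u. \<lbrakk>is_presheaf K S P; is_presheaf K S Q; presheaf_nat K S P Q \<theta>;
      X \<in> Obj S; H \<in> Obj S; L \<in> Obj S; f \<in> arr S X (H \<boxtimes> L); p \<in> carrier (PVal P H); u \<in> carrier (PVal U L)\<rbrakk>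
      \<Longrightarrow> \<theta> X (r P H L f p u) = r Q H L f (\<theta> H p) u"
    and triangle: "\<And>P Q X H L A B f g p u q. \<lbrakk>is_presheaf K S P; is_presheaf K S Q;
      X \<in> Obj S; H \<in> Obj S; L \<in> Obj S; A \<in> Obj S; B \<in> Obj S; f \<in> arr S X (H \<boxtimes> L); g \<in> arr S H (A \<boxtimes> B);
      p \<in> carrier (PVal P A); u \<in> carrier (PVal U B); q \<in> carrier (PVal Q L)\<rbrakk>
      \<Longrightarrow> day_in K S P Q A (B \<boxtimes> L) (reassoc A B L g f) p (l Q B L (Ident S (B \<boxtimes> L)) u q)
        = day_in K S P Q H L f (r P A B g p u) q"
  shows "is_unit_object PSh U"
proof -
  define invs where "invs P Q \<theta> \<theta>' \<longleftrightarrow> presheaf_nat K S P Q \<theta> \<and> presheaf_nat K S Q P \<theta>' \<and>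
    (\<forall>X\<in>Obj S. \<forall>p\<in>carrier (PVal P X). \<theta>' X (\<theta> X p) = p) \<and> (\<forall>X\<in>Obj S. \<forall>p\<in>carrier (PVal Q X). \<theta> X (\<theta>' X p) = p)"
    for P Q :: "('o, 'k, 'a) presheaf" and \<theta> \<theta>'
  have inv_iso: "is_iso PSh P Q (presheaf_arr S P Q \<theta>)" if "invs P Q \<theta> \<theta>'" for P Q \<theta> \<theta>'
    unfolding is_iso_def using that unfolding invs_def
    by (intro exI[of _ "presheaf_arr S Q P \<theta>'"] presheaf_inverse_arrowsI) auto
  have l_ex: "\<exists>\<theta>. (\<exists>\<theta>'. invs (day K S U P) P \<theta> \<theta>') \<and> (\<forall>X H L f u p. X \<in> Obj S \<longrightarrow> H \<in> Obj S \<longrightarrow> L \<in> Obj S \<longrightarrow>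
      f \<in> arr S X (H \<boxtimes> L) \<longrightarrow> u \<in> carrier (PVal U H) \<longrightarrow> p \<in> carrier (PVal P L) \<longrightarrow>
      \<theta> X (day_in K S U P H L f u p) = l P H L f u p)" if P: "is_presheaf K S P" for P
  proof (rule day_convolution_iso[OF day_convolution_day[OF U P] l[OF P]])
    fix \<theta> \<theta>'
    assume \<theta>: "presheaf_nat K S (day K S U P) P \<theta>" "presheaf_nat K S P (day K S U P) \<theta>'"
      "\<And>X m. X \<in> Obj S \<Longrightarrow> m \<in> carrier (PVal (day K S U P) X) \<Longrightarrow> \<theta>' X (\<theta> X m) = m"
      "\<And>X m. X \<in> Obj S \<Longrightarrow> m \<in> carrier (PVal P X) \<Longrightarrow> \<theta> X (\<theta>' X m) = m"
      and \<theta>_in: "\<And>X H L f u p. \<lbrakk>X \<in> Obj S; H \<in> Obj S; L \<in> Obj S; f \<in> arr S X (H \<boxtimes> L);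
        u \<in> carrier (PVal U H); p \<in> carrier (PVal P L)\<rbrakk> \<Longrightarrow> \<theta> X (day_in K S U P H L f u p) = l P H L f u p"
    show ?thesis
      by (intro exI[of _ \<theta>] conjI exI[of _ \<theta>'] allI impI \<theta>_in) (use \<theta> in \<open>simp_all add: invs_def\<close>)
  qed
  have r_ex: "\<exists>\<theta>. (\<exists>\<theta>'. invs (day K S P U) P \<theta> \<theta>') \<and> (\<forall>X H L f p u. X \<in> Obj S \<longrightarrow> H \<in> Obj S \<longrightarrow> L \<in> Obj S \<longrightarrow>
      f \<in> arr S X (H \<boxtimes> L) \<longrightarrow> p \<in> carrier (PVal P H) \<longrightarrow> u \<in> carrier (PVal U L) \<longrightarrow>
      \<theta> X (day_in K S P U H L f p u) = r P H L f p u)" if P: "is_presheaf K S P" for P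
  proof (rule day_convolution_iso[OF day_convolution_day[OF P U] r[OF P]])
    fix \<theta> \<theta>'
    assume \<theta>: "presheaf_nat K S (day K S P U) P \<theta>" "presheaf_nat K S P (day K S P U) \<theta>'"
      "\<And>X m. X \<in> Obj S \<Longrightarrow> m \<in> carrier (PVal (day K S P U) X) \<Longrightarrow> \<theta>' X (\<theta> X m) = m"
      "\<And>X m. X \<in> Obj S \<Longrightarrow> m \<in> carrier (PVal P X) \<Longrightarrow> \<theta> X (\<theta>' X m) = m"
      and \<theta>_in: "\<And>X H L f p u. \<lbrakk>X \<in> Obj S; H \<in> Obj S; L \<in> Obj S; f \<in> arr S X (H \<boxtimes> L);
        p \<in> carrier (PVal P H); u \<in> carrier (PVal U L)\<rbrakk> \<Longrightarrow> \<theta> X (day_in K S P U H L f p u) = r P H L f p u"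
    show ?thesis
      by (intro exI[of _ \<theta>] conjI exI[of _ \<theta>'] allI impI \<theta>_in) (use \<theta> in \<open>simp_all add: invs_def\<close>)
  qed
  define \<Lambda> where "\<Lambda> P = (SOME \<theta>. (\<exists>\<theta>'. invs (day K S U P) P \<theta> \<theta>') \<and> (\<forall>X H L f u p. X \<in> Obj S \<longrightarrow> H \<in> Obj S \<longrightarrow> L \<in> Obj S \<longrightarrow>
      f \<in> arr S X (H \<boxtimes> L) \<longrightarrow> u \<in> carrier (PVal U H) \<longrightarrow> p \<in> carrier (PVal P L) \<longrightarrow>
      \<theta> X (day_in K S U P H L f u p) = l P H L f u p))" for P
  define \<rho> where "\<rho> P = (SOME \<theta>. (\<exists>\<theta>'. invs (day K S P U) P \<theta> \<theta>') \<and> (\<forall>X H L f p u. X \<in> Obj S \<longrightarrow> H \<in> Obj S \<longrightarrow> L \<in> Obj S \<longrightarrow>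
      f \<in> arr S X (H \<boxtimes> L) \<longrightarrow> p \<in> carrier (PVal P H) \<longrightarrow> u \<in> carrier (PVal U L) \<longrightarrow>
      \<theta> X (day_in K S P U H L f p u) = r P H L f p u))" for P
  have \<Lambda>_inv: "\<exists>\<theta>'. invs (day K S U P) P (\<Lambda> P) \<theta>'"
    and \<Lambda>_in: "\<And>X H L f u p. \<lbrakk>X \<in> Obj S; H \<in> Obj S; L \<in> Obj S; f \<in> arr S X (H \<boxtimes> L);
      u \<in> carrier (PVal U H); p \<in> carrier (PVal P L)\<rbrakk> \<Longrightarrow> \<Lambda> P X (day_in K S U P H L f u p) = l P H L f u p"
    if P: "is_presheaf K S P" for P
    using someI_ex[OF l_ex[OF P]] unfolding \<Lambda>_def[symmetric] by simp_all
  have \<rho>_inv: "\<exists>\<theta>'. invs (day K S P U) P (\<rho> P) \<theta>'"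
    and \<rho>_in: "\<And>X H L f p u. \<lbrakk>X \<in> Obj S; H \<in> Obj S; L \<in> Obj S; f \<in> arr S X (H \<boxtimes> L);
      p \<in> carrier (PVal P H); u \<in> carrier (PVal U L)\<rbrakk> \<Longrightarrow> \<rho> P X (day_in K S P U H L f p u) = r P H L f p u"
    if P: "is_presheaf K S P" for P
    using someI_ex[OF r_ex[OF P]] unfolding \<rho>_def[symmetric] by simp_all
  have \<Lambda>_nat: "presheaf_nat K S (day K S U P) P (\<Lambda> P)" and \<rho>_nat: "presheaf_nat K S (day K S P U) P (\<rho> P)"
    if P: "is_presheaf K S P" for P
    using \<Lambda>_inv[OF P] \<rho>_inv[OF P] unfolding invs_def by simp_all
  show ?thesis
    unfolding is_unit_object_def presheaf_category_simps mem_Collect_eq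
  proof (rule conjI[OF U], rule exI[of _ "\<lambda>P. presheaf_arr S (day K S U P) P (\<Lambda> P)"],
      rule exI[of _ "\<lambda>P. presheaf_arr S (day K S P U) P (\<rho> P)"], intro conjI ballI)
    fix P assume "P \<in> {P. is_presheaf K S P}"
    then have P: "is_presheaf K S P" by simp
    show "is_iso PSh (day K S U P) P (presheaf_arr S (day K S U P) P (\<Lambda> P))"
      using \<Lambda>_inv[OF P] by (elim exE) (rule inv_iso)
    show "is_iso PSh (day K S P U) P (presheaf_arr S (day K S P U) P (\<rho> P))"
      using \<rho>_inv[OF P] by (elim exE) (rule inv_iso)
  next
    fix P Q \<phi> assume "P \<in> {P. is_presheaf K S P}" "Q \<in> {P. is_presheaf K S P}" and \<phi>: "\<phi> \<in> carrier (presheaf_Hom K S P Q)"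
    then have P: "is_presheaf K S P" and Q: "is_presheaf K S Q" by simp_all
    obtain \<theta> where \<theta>: "\<phi> = presheaf_arr S P Q \<theta>" "presheaf_nat K S P Q \<theta>"
      using \<phi> by (auto simp: arr_presheaf_Hom)
    note \<theta>_closed = presheaf_nat_closed[OF \<theta>(2)]
    show "presheaf_arr S (day K S U Q) Q (\<Lambda> Q) \<cdot>\<^bsub>PSh\<^esub> day_arr K S (presheaf_arr S U U (\<lambda>X p. p)) \<phi>
        = \<phi> \<cdot>\<^bsub>PSh\<^esub> presheaf_arr S (day K S U P) P (\<Lambda> P)"
    proof (rule day_arr_obtain[OF U U P Q presheaf_nat_id \<theta>(2)])
      fix \<tau> assume \<tau>: "presheaf_nat K S (day K S U P) (day K S U Q) \<tau>"
        and eq: "day_arr K S (presheaf_arr S U U (\<lambda>X p. p)) (presheaf_arr S P Q \<theta>) = presheaf_arr S (day K S U P) (day K S U Q) \<tau>"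
        and \<tau>_in: "\<And>X H L f p q. \<lbrakk>X \<in> Obj S; H \<in> Obj S; L \<in> Obj S; f \<in> arr S X (H \<boxtimes> L);
          p \<in> carrier (PVal U H); q \<in> carrier (PVal P L)\<rbrakk>
          \<Longrightarrow> \<tau> X (day_in K S U P H L f p q) = day_in K S U Q H L f p (\<theta> L q)"
      show ?thesis
        unfolding \<theta>(1) eq presheaf_arr_comp'[OF \<tau>] presheaf_arr_comp'[OF \<Lambda>_nat[OF P]]
        by (rule presheaf_arr_eqI, rule day_convolution_unique[OF day_convolution_day[OF U P] Q
              presheaf_nat_compose[OF \<tau> \<Lambda>_nat[OF Q]] presheaf_nat_compose[OF \<Lambda>_nat[OF P] \<theta>(2)]])
          (simp_all add: \<tau>_in \<Lambda>_in[OF P] \<Lambda>_in[OF Q] \<theta>_closed l_natural[OF P Q \<theta>(2)])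
    qed
    show "presheaf_arr S (day K S Q U) Q (\<rho> Q) \<cdot>\<^bsub>PSh\<^esub> day_arr K S \<phi> (presheaf_arr S U U (\<lambda>X p. p))
        = \<phi> \<cdot>\<^bsub>PSh\<^esub> presheaf_arr S (day K S P U) P (\<rho> P)"
    proof (rule day_arr_obtain[OF P Q U U \<theta>(2) presheaf_nat_id])
      fix \<tau> assume \<tau>: "presheaf_nat K S (day K S P U) (day K S Q U) \<tau>"
        and eq: "day_arr K S (presheaf_arr S P Q \<theta>) (presheaf_arr S U U (\<lambda>X p. p)) = presheaf_arr S (day K S P U) (day K S Q U) \<tau>"
        and \<tau>_in: "\<And>X H L f p q. \<lbrakk>X \<in> Obj S; H \<in> Obj S; L \<in> Obj S; f \<in> arr S X (H \<boxtimes> L);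
          p \<in> carrier (PVal P H); q \<in> carrier (PVal U L)\<rbrakk>
          \<Longrightarrow> \<tau> X (day_in K S P U H L f p q) = day_in K S Q U H L f (\<theta> H p) q"
      show ?thesis
        unfolding \<theta>(1) eq presheaf_arr_comp'[OF \<tau>] presheaf_arr_comp'[OF \<rho>_nat[OF P]]
        by (rule presheaf_arr_eqI, rule day_convolution_unique[OF day_convolution_day[OF P U] Q
              presheaf_nat_compose[OF \<tau> \<rho>_nat[OF Q]] presheaf_nat_compose[OF \<rho>_nat[OF P] \<theta>(2)]])
          (simp_all add: \<tau>_in \<rho>_in[OF P] \<rho>_in[OF Q] \<theta>_closed r_natural[OF P Q \<theta>(2)])
    qed
  next
    fix P Q assume "P \<in> {P. is_presheaf K S P}" "Q \<in> {P. is_presheaf K S P}"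
    then have P: "is_presheaf K S P" and Q: "is_presheaf K S Q" by simp_all
    note UQ = day_presheaf[OF U Q] and PU = day_presheaf[OF P U] and PQ = day_presheaf[OF P Q]
    obtain \<alpha> where \<alpha>: "presheaf_nat K S (day K S (day K S P U) Q) (day K S P (day K S U Q)) \<alpha>"
      "day_assoc K S P U Q = presheaf_arr S (day K S (day K S P U) Q) (day K S P (day K S U Q)) \<alpha>"
      and \<alpha>_in: "\<And>X H L A B f g p q r. \<lbrakk>X \<in> Obj S; H \<in> Obj S; L \<in> Obj S; A \<in> Obj S; B \<in> Obj S;
        f \<in> arr S X (H \<boxtimes> L); g \<in> arr S H (A \<boxtimes> B); p \<in> carrier (PVal P A); q \<in> carrier (PVal U B);
        r \<in> carrier (PVal Q L)\<rbrakk> \<Longrightarrow>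
        \<alpha> X (day_in K S (day K S P U) Q H L f (day_in K S P U A B g p q) r)
          = day_in K S P (day K S U Q) A (B \<boxtimes> L) (reassoc A B L g f) p
              (day_in K S U Q B L (Ident S (B \<boxtimes> L)) q r)"
      by (rule day_assoc_obtain[OF P U Q]) blast
    obtain \<sigma> where \<sigma>: "presheaf_nat K S (day K S P (day K S U Q)) (day K S P Q) \<sigma>"
      "day_arr K S (presheaf_arr S P P (\<lambda>X p. p)) (presheaf_arr S (day K S U Q) Q (\<Lambda> Q))
        = presheaf_arr S (day K S P (day K S U Q)) (day K S P Q) \<sigma>"
      and \<sigma>_in: "\<And>X H L f p q. \<lbrakk>X \<in> Obj S; H \<in> Obj S; L \<in> Obj S; f \<in> arr S X (H \<boxtimes> L);
        p \<in> carrier (PVal P H); q \<in> carrier (PVal (day K S U Q) L)\<rbrakk>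
        \<Longrightarrow> \<sigma> X (day_in K S P (day K S U Q) H L f p q) = day_in K S P Q H L f p (\<Lambda> Q L q)"
      by (rule day_arr_obtain[OF P P UQ Q presheaf_nat_id \<Lambda>_nat[OF Q]]) blast
    obtain \<tau> where \<tau>: "presheaf_nat K S (day K S (day K S P U) Q) (day K S P Q) \<tau>"
      "day_arr K S (presheaf_arr S (day K S P U) P (\<rho> P)) (presheaf_arr S Q Q (\<lambda>X p. p))
        = presheaf_arr S (day K S (day K S P U) Q) (day K S P Q) \<tau>"
      and \<tau>_in: "\<And>X H L f p q. \<lbrakk>X \<in> Obj S; H \<in> Obj S; L \<in> Obj S; f \<in> arr S X (H \<boxtimes> L);
        p \<in> carrier (PVal (day K S P U) H); q \<in> carrier (PVal Q L)\<rbrakk>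
        \<Longrightarrow> \<tau> X (day_in K S (day K S P U) Q H L f p q) = day_in K S P Q H L f (\<rho> P H p) q"
      by (rule day_arr_obtain[OF PU P Q Q \<rho>_nat[OF P] presheaf_nat_id]) blast
    show "day_arr K S (presheaf_arr S P P (\<lambda>X p. p)) (presheaf_arr S (day K S U Q) Q (\<Lambda> Q)) \<cdot>\<^bsub>PSh\<^esub> day_assoc K S P U Q
        = day_arr K S (presheaf_arr S (day K S P U) P (\<rho> P)) (presheaf_arr S Q Q (\<lambda>X p. p))"
      unfolding \<alpha>(2) \<sigma>(2) \<tau>(2) presheaf_arr_comp'[OF \<alpha>(1)]
    proof (rule presheaf_arr_eqI, rule day_convolution_unique_nested[OF day_convolution_day[OF P U]
          day_convolution_day[OF PU Q] PQ presheaf_nat_compose[OF \<alpha>(1) \<sigma>(1)] \<tau>(1)])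
      \<comment> \<open>Going through the associator and the left unitor produces the left side of
        \<open>triangle\<close>; the right unitor produces its right side.\<close>
      fix X H L A B f g p u q
      assume a: "X \<in> Obj S" "H \<in> Obj S" "L \<in> Obj S" and b: "A \<in> Obj S" "B \<in> Obj S" and f: "f \<in> arr S X (H \<boxtimes> L)"
        and c: "g \<in> arr S H (A \<boxtimes> B)" "p \<in> carrier (PVal P A)" "u \<in> carrier (PVal U B)"
        and q: "q \<in> carrier (PVal Q L)"
      note BL = tensor_obj[OF b(2) a(3)]
      note id_BL = ident_arr[OF BL]
      have "\<sigma> X (\<alpha> X (day_in K S (day K S P U) Q H L f (day_in K S P U A B g p u) q))
          = \<sigma> X (day_in K S P (day K S U Q) A (B \<boxtimes> L) (reassoc A B L g f) p
              (day_in K S U Q B L (Ident S (B \<boxtimes> L)) u q))"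
        by (simp only: \<alpha>_in[OF a b f c q])
      also have "\<dots> = day_in K S P Q A (B \<boxtimes> L) (reassoc A B L g f) p
          (\<Lambda> Q (B \<boxtimes> L) (day_in K S U Q B L (Ident S (B \<boxtimes> L)) u q))"
        by (rule \<sigma>_in[OF a(1) b(1) BL reassoc_arr[OF b a(2,3,1) c(1) f] c(2)
              day_convolution_closed[OF day_convolution_day[OF U Q] BL b(2) a(3) id_BL c(3) q]])
      also have "\<dots> = day_in K S P Q H L f (r P A B g p u) q"
        unfolding \<Lambda>_in[OF Q BL b(2) a(3) id_BL c(3) q] by (rule triangle[OF P Q a b f c q])
      also have "\<dots> = \<tau> X (day_in K S (day K S P U) Q H L f (day_in K S P U A B g p u) q)"
        unfolding \<tau>_in[OF a f day_convolution_closed[OF day_convolution_day[OF P U] a(2) b c] q] \<rho>_in[OF P a(2) b c] ..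
      finally show "\<sigma> X (\<alpha> X (day_in K S (day K S P U) Q H L f (day_in K S P U A B g p u) q))
        = \<tau> X (day_in K S (day K S P U) Q H L f (day_in K S P U A B g p u) q)" .
    qed
  qed
qed

text \<open>\<open>day K S U V\<close> is isomorphic to \<open>U\<close> because \<open>V\<close> is
  a unit, and to \<open>V\<close> because \<open>U\<close> is one.\<close>

lemma unit_object_unique:
  assumes "is_unit_object PSh U" "is_unit_object PSh V"
  shows "isomorphic PSh U V"
proof -
  have UV: "is_presheaf K S U" "is_presheaf K S V"
    using assms unfolding is_unit_object_def by simp_all
  have iso: "isomorphic PSh (day K S W P) P" "isomorphic PSh (day K S P W) P"
    if W: "is_unit_object PSh W" and P: "is_presheaf K S P" for W P
  proof -
    obtain lu \<rho> where "\<forall>X\<in>Obj PSh. is_iso PSh (W \<boxtimes>\<^bsub>PSh\<^esub> X) X (lu X) \<and> is_iso PSh (X \<boxtimes>\<^bsub>PSh\<^esub> W) X (\<rho> X)"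
      using W unfolding is_unit_object_def by (elim conjE exE)
    from bspec[OF this, of P] P
    have "is_iso PSh (day K S W P) P (lu P)" "is_iso PSh (day K S P W) P (\<rho> P)" by simp_all
    then show "isomorphic PSh (day K S W P) P" "isomorphic PSh (day K S P W) P"
      unfolding isomorphic_def by - (rule exI, assumption)+
  qed
  show ?thesis
    by (rule presheaf_isomorphic_trans[OF presheaf_isomorphic_sym[OF iso(2)[OF assms(2) UV(1)]] iso(1)[OF assms(1) UV(2)]])
qed

end

section \<open>Left units from coequalizers\<close>

text \<open>Here \<open>c\<close> is the counit \<open>\<epsilon>\<^sup>r\<close> with a non-natural section \<open>s\<close>, and \<open>q\<close> is the coequalizer of \<open>e\<close> and
  \<open>e'\<close> with a non-natural section \<open>\<sigma>\<close>. No associator is assumed, and \<open>\<sigma>_q\<close> is symmetric in \<open>e\<close> and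
  \<open>e'\<close>, because the locale is also instantiated with the reversed tensor product and \<open>\<epsilon>\<^sup>l\<close>, where \<open>e\<close>
  and \<open>e'\<close> are exchanged.\<close>

locale left_unit = tensor_category K S
  for K :: "'k ring" and S :: "('o, 'k, 'a, 'z) semicat_scheme" (structure) +
  fixes T :: 'o and c s :: "'o \<Rightarrow> 'a" and e e' :: 'a
    and U :: "('o, 'k, 'a) presheaf" and q \<sigma> :: "'o \<Rightarrow> 'a \<Rightarrow> 'a"
  assumes T: "T \<in> Obj S"
    and c_arr: "X \<in> Obj S \<Longrightarrow> c X \<in> arr S (T \<boxtimes> X) X"
    and c_natural: "\<lbrakk>X \<in> Obj S; Y \<in> Obj S; f \<in> arr S X Y\<rbrakk> \<Longrightarrow> c Y \<cdot> (Ident S T \<boxdot> f) = f \<cdot> c X"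
    and s_arr: "X \<in> Obj S \<Longrightarrow> s X \<in> arr S X (T \<boxtimes> X)"
    and c_s: "X \<in> Obj S \<Longrightarrow> c X \<cdot> s X = Ident S X"
    and e_arr: "e \<in> arr S (T \<boxtimes> T) T" and e'_arr: "e' \<in> arr S (T \<boxtimes> T) T"
    and reassociation: "L \<in> Obj S \<Longrightarrow> \<exists>\<beta> \<beta>'. \<beta> \<in> arr S (T \<boxtimes> T \<boxtimes> L) (T \<boxtimes> (T \<boxtimes> L)) \<and>
      \<beta>' \<in> arr S (T \<boxtimes> (T \<boxtimes> L)) (T \<boxtimes> T \<boxtimes> L) \<and> \<beta> \<cdot> \<beta>' = Ident S (T \<boxtimes> (T \<boxtimes> L)) \<and>
      e \<boxdot> Ident S L = c (T \<boxtimes> L) \<cdot> \<beta> \<and> e' \<boxdot> Ident S L = (Ident S T \<boxdot> c L) \<cdot> \<beta>"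
    and U: "is_presheaf K S U"
    and q_closed: "\<lbrakk>H \<in> Obj S; a \<in> arr S H T\<rbrakk> \<Longrightarrow> q H a \<in> carrier (PVal U H)"
    and q_natural: "\<lbrakk>H \<in> Obj S; H' \<in> Obj S; h \<in> arr S H' H; a \<in> arr S H T\<rbrakk>
      \<Longrightarrow> PAct U h (q H a) = q H' (a \<cdot> h)"
    and q_coequalizes: "q (T \<boxtimes> T) e = q (T \<boxtimes> T) e'"
    and \<sigma>_linear: "H \<in> Obj S \<Longrightarrow> linear_map K (PVal U H) (Hom S H T) (\<sigma> H)"
    and q_\<sigma>: "\<lbrakk>H \<in> Obj S; u \<in> carrier (PVal U H)\<rbrakk> \<Longrightarrow> q H (\<sigma> H u) = u"
    and \<sigma>_q: "\<lbrakk>H \<in> Obj S; a \<in> arr S H T\<rbrakk> \<Longrightarrow> \<exists>h\<in>arr S H (T \<boxtimes> T).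
      a = e \<cdot> h \<and> \<sigma> H (q H a) = e' \<cdot> h \<or> a = e' \<cdot> h \<and> \<sigma> H (q H a) = e \<cdot> h"
begin

lemma c_simps: "X \<in> Obj S \<Longrightarrow> arrow (c X)" "X \<in> Obj S \<Longrightarrow> src (c X) = T \<boxtimes> X" "X \<in> Obj S \<Longrightarrow> trg (c X) = X"
  using c_arr T by (simp_all add: in_arr_iff tensor_obj)

lemma s_simps: "X \<in> Obj S \<Longrightarrow> arrow (s X)" "X \<in> Obj S \<Longrightarrow> src (s X) = X" "X \<in> Obj S \<Longrightarrow> trg (s X) = T \<boxtimes> X"
  using s_arr T by (simp_all add: in_arr_iff tensor_obj)

lemma e_simps: "arrow e" "src e = T \<boxtimes> T" "trg e = T" "arrow e'" "src e' = T \<boxtimes> T" "trg e' = T"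
  using e_arr e'_arr T by (simp_all add: in_arr_iff tensor_obj)

lemma \<sigma>_closed: "H \<in> Obj S \<Longrightarrow> u \<in> carrier (PVal U H) \<Longrightarrow> \<sigma> H u \<in> arr S H T"
  by (rule linear_map_closed[OF \<sigma>_linear])

lemmas unit_simps = T c_simps s_simps e_simps tensor_simps in_arr_iff

text \<open>Up to \<open>\<beta>\<close> the two arrows are \<open>c (T \<boxtimes> L)\<close> and
  \<open>Ident S T \<boxdot> c L\<close>; naturality of \<open>c\<close> at the arrow
  \<open>c L\<close> says that \<open>c L\<close> equalizes them from the left.\<close>

lemma c_coequalizes:
  assumes L: "L \<in> Obj S"
  shows "c L \<cdot> (e \<boxdot> Ident S L) = c L \<cdot> (e' \<boxdot> Ident S L)"
proof -
  obtain \<beta> where \<beta>: "\<beta> \<in> arr S (T \<boxtimes> T \<boxtimes> L) (T \<boxtimes> (T \<boxtimes> L))"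
    and e: "e \<boxdot> Ident S L = c (T \<boxtimes> L) \<cdot> \<beta>" and e': "e' \<boxdot> Ident S L = (Ident S T \<boxdot> c L) \<cdot> \<beta>"
    using reassociation[OF L] by (elim exE conjE)
  have "c L \<cdot> (c (T \<boxtimes> L) \<cdot> \<beta>) = (c L \<cdot> c (T \<boxtimes> L)) \<cdot> \<beta>"
    using \<beta> L by (simp add: unit_simps)
  also have "c L \<cdot> c (T \<boxtimes> L) = c L \<cdot> (Ident S T \<boxdot> c L)"
    using c_natural[OF tensor_obj[OF T L] L c_arr[OF L]] by simp
  also have "\<dots> \<cdot> \<beta> = c L \<cdot> ((Ident S T \<boxdot> c L) \<cdot> \<beta>)"
    using \<beta> L by (simp add: unit_simps)
  finally show ?thesis unfolding e e' .
qed

text \<open>The arrows \<open>a\<close> and \<open>\<sigma> H (q H a)\<close> arise from one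
  \<open>h\<close> by composition with \<open>e\<close> and \<open>e'\<close> in some order, and
  \<open>c L\<close> does not see the difference. This makes the action below independent of the
  representative.\<close>

lemma c_\<sigma>_q:
  assumes H: "H \<in> Obj S" and L: "L \<in> Obj S" and a: "a \<in> arr S H T"
  shows "c L \<cdot> (\<sigma> H (q H a) \<boxdot> Ident S L) = c L \<cdot> (a \<boxdot> Ident S L)"
proof -
  obtain h where h: "h \<in> arr S H (T \<boxtimes> T)"
    and alt: "a = e \<cdot> h \<and> \<sigma> H (q H a) = e' \<cdot> h \<or> a = e' \<cdot> h \<and> \<sigma> H (q H a) = e \<cdot> h"
    using \<sigma>_q[OF H a] by (elim bexE)
  have split: "(x \<cdot> h) \<boxdot> Ident S L = (x \<boxdot> Ident S L) \<cdot> (h \<boxdot> Ident S L)"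
    if "x \<in> arr S (T \<boxtimes> T) T" for x
    using that h H L by (simp add: unit_simps interchange_simps)
  have "c L \<cdot> ((e \<cdot> h) \<boxdot> Ident S L) = (c L \<cdot> (e \<boxdot> Ident S L)) \<cdot> (h \<boxdot> Ident S L)"
    unfolding split[OF e_arr] using h H L by (simp add: unit_simps)
  also have "\<dots> = c L \<cdot> ((e' \<cdot> h) \<boxdot> Ident S L)"
    unfolding c_coequalizes[OF L] split[OF e'_arr] using h H L by (simp add: unit_simps)
  finally show ?thesis using alt by auto
qed

text \<open>The arrow through which a class \<open>u\<close> in \<open>U\<close> acts on
  \<open>L\<close>, computed from the representative \<open>\<sigma> H u\<close>. Using the linear
  section instead of an arbitrary representative makes linearity in \<open>u\<close>
  immediate.\<close>

definition action :: "'o \<Rightarrow> 'a \<Rightarrow> 'o \<Rightarrow> 'a" where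
  "action H u L = c L \<cdot> (\<sigma> H u \<boxdot> Ident S L)"

lemma action_arr: "\<lbrakk>H \<in> Obj S; L \<in> Obj S; u \<in> carrier (PVal U H)\<rbrakk> \<Longrightarrow> action H u L \<in> arr S (H \<boxtimes> L) L"
  using \<sigma>_closed[of H u] by (simp add: action_def unit_simps)

lemma action_linear:
  assumes H: "H \<in> Obj S" and L: "L \<in> Obj S"
  shows "linear_map K (PVal U H) (Hom S (H \<boxtimes> L) L) (\<lambda>u. action H u L)"
  unfolding action_def
  by (rule linear_map_compose[OF linear_map_compose[OF \<sigma>_linear[OF H] tensor_linear_left[OF H T L L ident_arr[OF L]]]
        comp_linear_right])
    (use H L T c_arr in \<open>simp_all add: tensor_obj\<close>)

lemma action_q:
  "\<lbrakk>H \<in> Obj S; L \<in> Obj S; a \<in> arr S H T\<rbrakk> \<Longrightarrow> action H (q H a) L = c L \<cdot> (a \<boxdot> Ident S L)"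
  unfolding action_def by (rule c_\<sigma>_q)

text \<open>\<open>PAct U h u\<close> is represented by \<open>\<sigma> H' u \<cdot> h\<close>, so
  \<open>h\<close> slides into the representative, and \<open>l\<close> passes \<open>c\<close> by
  naturality.\<close>

lemma action_dinatural:
  assumes obj: "H \<in> Obj S" "H' \<in> Obj S" "L \<in> Obj S" "L' \<in> Obj S" and h: "h \<in> arr S H H'" and l: "l \<in> arr S L L'"
    and u: "u \<in> carrier (PVal U H')"
  shows "action H' u L' \<cdot> (h \<boxdot> l) = l \<cdot> action H (PAct U h u) L"
proof -
  note \<sigma>u = \<sigma>_closed[OF obj(2) u]
  have "PAct U h u = q H (\<sigma> H' u \<cdot> h)"
    using q_natural[OF obj(2,1) h \<sigma>u] by (simp add: q_\<sigma>[OF obj(2) u])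
  then have "l \<cdot> action H (PAct U h u) L = l \<cdot> (c L \<cdot> ((\<sigma> H' u \<cdot> h) \<boxdot> Ident S L))"
    using action_q[OF obj(1,3) comp_closed[OF obj(1,2) T h \<sigma>u]] by simp
  also have "\<dots> = (l \<cdot> c L) \<cdot> ((\<sigma> H' u \<cdot> h) \<boxdot> Ident S L)"
    using obj h l \<sigma>u by (simp add: unit_simps)
  also have "l \<cdot> c L = c L' \<cdot> (Ident S T \<boxdot> l)"
    using c_natural[OF obj(3,4) l] by simp
  also have "\<dots> \<cdot> ((\<sigma> H' u \<cdot> h) \<boxdot> Ident S L) = action H' u L' \<cdot> (h \<boxdot> l)"
    using obj h l \<sigma>u by (simp add: action_def unit_simps interchange_simps)
  finally show ?thesis by simp
qed

definition unit_in :: "('o, 'k, 'a) presheaf \<Rightarrow> 'o \<Rightarrow> 'o \<Rightarrow> 'a \<Rightarrow> 'a \<Rightarrow> 'a \<Rightarrow> 'a" where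
  "unit_in P H L f u p = PAct P (action H u L \<cdot> f) p"

lemma unit_in_natural:
  assumes "presheaf_nat K S P Q \<theta>" "X \<in> Obj S" "H \<in> Obj S" "L \<in> Obj S" "f \<in> arr S X (H \<boxtimes> L)"
    "u \<in> carrier (PVal U H)" "p \<in> carrier (PVal P L)"
  shows "\<theta> X (unit_in P H L f u p) = unit_in Q H L f u (\<theta> L p)"
  unfolding unit_in_def
  by (rule presheaf_nat_natural[OF assms(1,2,4)])
    (use assms comp_closed[OF assms(2) tensor_obj[OF assms(3,4)] assms(4)] action_arr in auto)

text \<open>The point is that the candidate lift agrees with \<open>w\<close> on all generators. In
  the value at a generator, the section \<open>s X\<close> introduces an extra factor T; it is
  removed again after the counit has been moved from one factor T to the other, which is allowed
  because \<open>q\<close> coequalizes \<open>e\<close> and \<open>e'\<close>.\<close>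

lemma day_convolution_left_unit:
  assumes P: "is_presheaf K S P"
  shows "is_day_convolution K S U P P (unit_in P)"
  unfolding is_day_convolution_iff_coend
proof (intro conjI ballI P)
  fix X Y g H L f u p
  assume a: "X \<in> Obj S" "Y \<in> Obj S" "g \<in> arr S X Y" "H \<in> Obj S" "L \<in> Obj S" "f \<in> arr S Y (H \<boxtimes> L)"
    "u \<in> carrier (PVal U H)" "p \<in> carrier (PVal P L)"
  note HL = tensor_obj[OF a(4,5)] and act = action_arr[OF a(4,5,7)]
  show "PAct P g (unit_in P H L f u p) = unit_in P H L (f \<cdot> g) u p"
    unfolding unit_in_def comp_assoc[OF a(1,2) HL a(5,3,6) act, symmetric]
    by (rule presheaf_comp[OF P a(1,2,5,3) comp_closed[OF a(2) HL a(5,6) act] a(8), symmetric])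
next
  fix X assume X: "X \<in> Obj S"
  have cow: "day_cowedge K S U P X (PVal P X) (unit_in P)"
  proof (rule day_cowedgeI)
    fix H L u p assume a: "H \<in> Obj S" "L \<in> Obj S" "u \<in> carrier (PVal U H)" "p \<in> carrier (PVal P L)"
    show "linear_map K (Hom S X (H \<boxtimes> L)) (PVal P X) (\<lambda>f. unit_in P H L f u p)"
      unfolding unit_in_def
      by (rule linear_map_compose[OF comp_linear_right[OF X tensor_obj[OF a(1,2)] a(2) action_arr[OF a(1-3)]]
            presheaf_linear_arr[OF P X a(2,4)]])
  next
    fix H L f p assume a: "H \<in> Obj S" "L \<in> Obj S" "f \<in> arr S X (H \<boxtimes> L)" "p \<in> carrier (PVal P L)"
    show "linear_map K (PVal U H) (PVal P X) (\<lambda>u. unit_in P H L f u p)"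
      unfolding unit_in_def
      by (rule linear_map_compose[OF linear_map_compose[OF action_linear[OF a(1,2)]
              comp_linear_left[OF X tensor_obj[OF a(1,2)] a(2,3)]] presheaf_linear_arr[OF P X a(2,4)]])
  next
    fix H L f u assume a: "H \<in> Obj S" "L \<in> Obj S" "f \<in> arr S X (H \<boxtimes> L)" "u \<in> carrier (PVal U H)"
    show "linear_map K (PVal P L) (PVal P X) (\<lambda>p. unit_in P H L f u p)"
      unfolding unit_in_def
      by (rule presheaf_linear[OF P X a(2) comp_closed[OF X tensor_obj[OF a(1,2)] a(2,3) action_arr[OF a(1,2,4)]]])
  next
    fix H H' L L' h l f u p
    assume a: "H \<in> Obj S" "H' \<in> Obj S" "L \<in> Obj S" "L' \<in> Obj S" "h \<in> arr S H H'" "l \<in> arr S L L'"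
      "f \<in> arr S X (H \<boxtimes> L)" and u: "u \<in> carrier (PVal U H')" and p: "p \<in> carrier (PVal P L')"
    have hu: "PAct U h u \<in> carrier (PVal U H)" by (rule presheaf_closed[OF U a(1,2,5) u])
    note act = action_arr[OF a(2,4) u] action_arr[OF a(1,3) hu]
    have "action H' u L' \<cdot> ((h \<boxdot> l) \<cdot> f) = (action H' u L' \<cdot> (h \<boxdot> l)) \<cdot> f"
      using a X act by (simp add: unit_simps)
    also have "\<dots> = l \<cdot> (action H (PAct U h u) L \<cdot> f)"
      unfolding action_dinatural[OF a(1-6) u] using a X act by (simp add: unit_simps)
    finally show "unit_in P H' L' ((h \<boxdot> l) \<cdot> f) u p = unit_in P H L f (PAct U h u) (PAct P l p)"
      unfolding unit_in_def
      using presheaf_comp[OF P X a(3,4) comp_closed[OF X tensor_obj[OF a(1,3)] a(3,7) act(2)] a(6) p] by simp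
  qed
  \<comment> \<open>The class of the identity of T. It generates \<open>U\<close>: every
    \<open>u\<close> equals \<open>PAct U (\<sigma> H u) i\<close>.\<close>
  define i where "i = q T (Ident S T)"
  have i: "i \<in> carrier (PVal U T)" unfolding i_def by (rule q_closed[OF T ident_arr[OF T]])
  have i_act: "PAct U a i = q H a" if "H \<in> Obj S" "a \<in> arr S H T" for H a
    unfolding i_def using q_natural[OF T that ident_arr[OF T]] comp_ident_left[OF that(1) T that(2)] by simp
  have action_i: "action T i L = c L" if "L \<in> Obj S" for L
    unfolding i_def using action_q[OF T that ident_arr[OF T]] that by (simp add: unit_simps)
  \<comment> \<open>Every element of \<open>P\<close> at \<open>X\<close> is thus the image of a
    single generator. This forces the formula for the lift and proves its uniqueness.\<close>
  have unit_in_i: "unit_in P T X (s X) i p = p" if "p \<in> carrier (PVal P X)" for p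
    unfolding unit_in_def action_i[OF X] c_s[OF X] by (rule presheaf_ident[OF P X that])
  show "is_coend U P X (PVal P X) (unit_in P)"
  proof (rule coendI[OF presheaf_module[OF P X] cow])
    fix W :: "('k, 'a) module" and w
    assume W: "module K W" and w: "day_cowedge K S U P X W w"
    show "\<exists>t. linear_map K (PVal P X) W t \<and>
          (\<forall>H\<in>Obj S. \<forall>L\<in>Obj S. \<forall>f\<in>arr S X (H \<boxtimes> L).
             \<forall>u\<in>carrier (PVal U H). \<forall>p\<in>carrier (PVal P L). t (unit_in P H L f u p) = w H L f u p)"
    proof (intro exI[of _ "\<lambda>p. w T X (s X) i p"] conjI ballI)
      show "linear_map K (PVal P X) W (\<lambda>p. w T X (s X) i p)"
        by (rule day_cowedge_linear_right[OF w T X s_arr[OF X] i])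
    next
      fix H L f u p
      assume a: "H \<in> Obj S" "L \<in> Obj S" "f \<in> arr S X (H \<boxtimes> L)" "u \<in> carrier (PVal U H)" "p \<in> carrier (PVal P L)"
      note \<sigma>u = \<sigma>_closed[OF a(1,4)] and idT = ident_arr[OF T] and idL = ident_arr[OF a(2)]
      note TL = tensor_obj[OF T a(2)] and TT = tensor_obj[OF T T]
      have iT: "PAct U (Ident S T) i = i" and pL: "PAct P (Ident S L) p = p"
        using presheaf_ident[OF U T i] presheaf_ident[OF P a(2,5)] .
      \<comment> \<open>The arrow \<open>f\<close> with the class \<open>u\<close> replaced by its
        representative: the action of \<open>u\<close> along \<open>f\<close> is then
        \<open>c L \<cdot> g\<close>.\<close>
      define g where "g = (\<sigma> H u \<boxdot> Ident S L) \<cdot> f"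
      have g: "g \<in> arr S X (T \<boxtimes> L)" unfolding g_def using a \<sigma>u X by (simp add: unit_simps)
      have cg: "c L \<cdot> g \<in> arr S X L" by (rule comp_closed[OF X TL a(2) g c_arr[OF a(2)]])
      obtain \<beta> \<beta>' where \<beta>: "\<beta> \<in> arr S (T \<boxtimes> T \<boxtimes> L) (T \<boxtimes> (T \<boxtimes> L))"
        "\<beta>' \<in> arr S (T \<boxtimes> (T \<boxtimes> L)) (T \<boxtimes> T \<boxtimes> L)" "\<beta> \<cdot> \<beta>' = Ident S (T \<boxtimes> (T \<boxtimes> L))"
        and e: "e \<boxdot> Ident S L = c (T \<boxtimes> L) \<cdot> \<beta>" and e': "e' \<boxdot> Ident S L = (Ident S T \<boxdot> c L) \<cdot> \<beta>"
        using reassociation[OF a(2)] by (elim exE conjE)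
      \<comment> \<open>Carries two factors T in front of \<open>L\<close>: the outer one from the
        section \<open>s X\<close>, the inner one from \<open>g\<close>. The counit at the inner
        factor is what \<open>unit_in\<close> applies; the aim is to apply it at the outer one
        instead.\<close>
      define y where "y = (Ident S T \<boxdot> g) \<cdot> s X"
      have y: "y \<in> arr S X (T \<boxtimes> (T \<boxtimes> L))" unfolding y_def using g a X by (simp add: unit_simps)
      have \<beta>'y: "\<beta>' \<cdot> y \<in> arr S X (T \<boxtimes> T \<boxtimes> L)" using \<beta>(2) y a X by (simp add: unit_simps)
      have \<beta>\<beta>'y: "\<beta> \<cdot> (\<beta>' \<cdot> y) = y"
      proof -
        have "\<beta> \<cdot> (\<beta>' \<cdot> y) = (\<beta> \<cdot> \<beta>') \<cdot> y" using \<beta>(1,2) y a X by (simp add: unit_simps)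
        then show ?thesis unfolding \<beta>(3) using y a X by (simp add: unit_simps)
      qed
      have "unit_in P H L f u p = PAct P (c L \<cdot> g) p"
        unfolding unit_in_def action_def g_def using a \<sigma>u X by (simp add: unit_simps)
      then have "w T X (s X) i (unit_in P H L f u p) = w T X (s X) (PAct U (Ident S T) i) (PAct P (c L \<cdot> g) p)"
        unfolding iT by simp
      also have "\<dots> = w T L ((Ident S T \<boxdot> (c L \<cdot> g)) \<cdot> s X) i p"
        by (rule day_cowedge_dinatural[OF w T T X a(2) idT cg s_arr[OF X] i a(5), symmetric])
      also have "(Ident S T \<boxdot> (c L \<cdot> g)) \<cdot> s X = (Ident S T \<boxdot> c L) \<cdot> (\<beta> \<cdot> (\<beta>' \<cdot> y))"
        unfolding \<beta>\<beta>'y unfolding y_def using g a X by (simp add: unit_simps interchange_simps)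
      also have "\<dots> = (e' \<boxdot> Ident S L) \<cdot> (\<beta>' \<cdot> y)"
        unfolding e' using \<beta>(1,2) y a X by (simp add: unit_simps)
      also have "w T L \<dots> i p = w (T \<boxtimes> T) L (\<beta>' \<cdot> y) (PAct U e' i) (PAct P (Ident S L) p)"
        by (rule day_cowedge_dinatural[OF w TT T a(2,2) e'_arr idL \<beta>'y i a(5)])
      \<comment> \<open>The exchange of the two factors: dinaturality has moved \<open>e'\<close>
        onto the generator \<open>i\<close>, where it may be replaced by \<open>e\<close>.\<close>
      also have "PAct U e' i = PAct U e i"
        unfolding i_act[OF TT e'_arr] i_act[OF TT e_arr] q_coequalizes ..
      also have "w (T \<boxtimes> T) L (\<beta>' \<cdot> y) (PAct U e i) (PAct P (Ident S L) p) = w T L ((e \<boxdot> Ident S L) \<cdot> (\<beta>' \<cdot> y)) i p"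
        by (rule day_cowedge_dinatural[OF w TT T a(2,2) e_arr idL \<beta>'y i a(5), symmetric])
      also have "(e \<boxdot> Ident S L) \<cdot> (\<beta>' \<cdot> y) = c (T \<boxtimes> L) \<cdot> (\<beta> \<cdot> (\<beta>' \<cdot> y))"
        unfolding e using \<beta>(1,2) y a X by (simp add: unit_simps)
      also have "\<dots> = (c (T \<boxtimes> L) \<cdot> (Ident S T \<boxdot> g)) \<cdot> s X"
        unfolding \<beta>\<beta>'y unfolding y_def using g a X by (simp add: unit_simps)
      \<comment> \<open>Now the counit meets the factor that the section introduced; by naturality
        \<open>g\<close> moves out and \<open>c_s\<close> cancels the pair.\<close>
      also have "\<dots> = g \<cdot> (c X \<cdot> s X)"
        unfolding c_natural[OF X TL g] using g a X by (simp add: unit_simps)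
      also have "\<dots> = (\<sigma> H u \<boxdot> Ident S L) \<cdot> f"
        unfolding c_s[OF X] comp_ident_right[OF X TL g] by (rule g_def)
      \<comment> \<open>A last use of dinaturality moves the representative from the arrow back onto
        \<open>i\<close>, where it yields \<open>u\<close>.\<close>
      also have "w T L \<dots> i p = w H L f (PAct U (\<sigma> H u) i) (PAct P (Ident S L) p)"
        by (rule day_cowedge_dinatural[OF w a(1) T a(2,2) \<sigma>u idL a(3) i a(5)])
      also have "PAct U (\<sigma> H u) i = u" unfolding i_act[OF a(1) \<sigma>u] by (rule q_\<sigma>[OF a(1,4)])
      finally show "w T X (s X) i (unit_in P H L f u p) = w H L f u p" unfolding pL .
    qed
  next
    fix W :: "('k, 'a) module" and t t' p
    assume eq: "\<forall>H\<in>Obj S. \<forall>L\<in>Obj S. \<forall>f\<in>arr S X (H \<boxtimes> L). \<forall>u\<in>carrier (PVal U H).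
      \<forall>p\<in>carrier (PVal P L). t (unit_in P H L f u p) = t' (unit_in P H L f u p)"
      and p: "p \<in> carrier (PVal P X)"
    then have "t (unit_in P T X (s X) i p) = t' (unit_in P T X (s X) i p)"
      using T X s_arr[OF X] i by blast
    then show "t p = t' p" unfolding unit_in_i[OF p] .
  qed
qed

end


section \<open>The reversed tensor product\<close>

text \<open>The field \<open>Assoc\<close> is left unchanged and is therefore not an associator for
  the reversed product; only the axioms of \<open>tensor_category\<close> are transferred.\<close>

definition rev_tensor :: "('o, 'k, 'a, 'z) semicat_scheme \<Rightarrow> ('o, 'k, 'a, 'z) semicat_scheme" where
  "rev_tensor S = S\<lparr>TObj := (\<lambda>X Y. Y \<boxtimes>\<^bsub>S\<^esub> X), TArr := (\<lambda>f g. g \<boxdot>\<^bsub>S\<^esub> f)\<rparr>"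

lemma rev_tensor_simps [simp]:
  "Obj (rev_tensor S) = Obj S" "Hom (rev_tensor S) = Hom S" "Comp (rev_tensor S) = Comp S"
  "Ident (rev_tensor S) = Ident S" "TObj (rev_tensor S) = (\<lambda>X Y. TObj S Y X)" "TArr (rev_tensor S) = (\<lambda>f g. TArr S g f)"
  by (simp_all add: rev_tensor_def)

lemma is_presheaf_rev_tensor [simp]: "is_presheaf K (rev_tensor S) P = is_presheaf K S P"
  by (simp add: is_presheaf_def)

context tensor_category
begin

lemma tensor_category_rev_tensor: "tensor_category K (rev_tensor S)"
proof (intro tensor_category.intro linear_category.intro linear_category_axioms.intro
    tensor_category_axioms.intro, unfold rev_tensor_simps)
  show "field K" by unfold_locales
next
  fix X Y X' Y' f
  assume "X \<in> Obj S" "Y \<in> Obj S" "X' \<in> Obj S" "Y' \<in> Obj S" "f \<in> arr S X Y" "f \<in> arr S X' Y'"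
  then show "X = X' \<and> Y = Y'" by (rule hom_disjoint)
qed (rule hom_module ident_arr comp_ident_right comp_ident_left comp_linear_left comp_linear_right comp_assoc
    tensor_obj tensor_ident tensor_comp tensor_linear_left tensor_linear_right; assumption)+

lemma day_cowedge_rev_tensor:
  "day_cowedge K (rev_tensor S) Q P X W (\<lambda>L H f q p. w H L f p q) \<longleftrightarrow> day_cowedge K S P Q X W w"
proof -
  interpret R: tensor_category K "rev_tensor S" by (rule tensor_category_rev_tensor)
  show ?thesis
  proof
    assume w: "day_cowedge K S P Q X W w"
    show "day_cowedge K (rev_tensor S) Q P X W (\<lambda>L H f q p. w H L f p q)"
      by (rule R.day_cowedgeI, unfold rev_tensor_simps)
        (rule day_cowedge_linear_arr[OF w] day_cowedge_linear_right[OF w] day_cowedge_linear_left[OF w]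
          day_cowedge_dinatural[OF w]; assumption)+
  next
    assume w: "day_cowedge K (rev_tensor S) Q P X W (\<lambda>L H f q p. w H L f p q)"
    show "day_cowedge K S P Q X W w"
      by (rule day_cowedgeI)
        (rule R.day_cowedge_linear_arr[OF w, unfolded rev_tensor_simps] R.day_cowedge_linear_right[OF w, unfolded rev_tensor_simps]
          R.day_cowedge_linear_left[OF w, unfolded rev_tensor_simps] R.day_cowedge_dinatural[OF w, unfolded rev_tensor_simps]; assumption)+
  qed
qed

lemma day_convolution_rev_tensor:
  assumes "is_day_convolution K (rev_tensor S) Q P R (\<lambda>L H f q p. \<kappa> H L f p q)"
  shows "is_day_convolution K S P Q R \<kappa>"
proof -
  interpret R: tensor_category K "rev_tensor S" by (rule tensor_category_rev_tensor)
  note D = assms[unfolded R.is_day_convolution_iff_coend, unfolded rev_tensor_simps is_presheaf_rev_tensor]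
  have co: "is_coend P Q X (PVal R X) \<kappa>" if X: "X \<in> Obj S" for X
  proof -
    have R: "R.is_coend Q P X (PVal R X) (\<lambda>L H f q p. \<kappa> H L f p q)" using D X by simp
    show ?thesis
    proof (rule coendI)
      show "module K (PVal R X)" by (rule R.coend_module[OF R])
      show "day_cowedge K S P Q X (PVal R X) \<kappa>"
        using R.coend_cowedge[OF R] by (simp only: day_cowedge_rev_tensor)
    next
      fix W :: "('k, 'a) module" and w assume W: "module K W" and w: "day_cowedge K S P Q X W w"
      obtain t where "linear_map K (PVal R X) W t"
        and t: "\<And>L H f q p. \<lbrakk>L \<in> Obj S; H \<in> Obj S; f \<in> arr S X (H \<boxtimes> L); q \<in> carrier (PVal Q L);
          p \<in> carrier (PVal P H)\<rbrakk> \<Longrightarrow> t (\<kappa> H L f p q) = w H L f p q"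
        by (rule R.coend_lift[OF R W day_cowedge_rev_tensor[THEN iffD2, OF w], unfolded rev_tensor_simps]) blast
      then show "\<exists>t. linear_map K (PVal R X) W t \<and>
          agree P Q X t \<kappa> w"
        by (intro exI[of _ t] conjI ballI) simp_all
    next
      fix W :: "('k, 'a) module" and t t' m
      assume W: "module K W" "linear_map K (PVal R X) W t" "linear_map K (PVal R X) W t'" and m: "m \<in> carrier (PVal R X)"
        and eq: "agree P Q X t \<kappa> (\<lambda>H L f p q. t' (\<kappa> H L f p q))"
      show "t m = t' m"
        by (rule R.coend_unique[OF R W _ m, unfolded rev_tensor_simps]) (use eq in simp)
    qed
  qed
  show ?thesis
    unfolding is_day_convolution_iff_coend
    by (intro conjI ballI co) (use D in simp_all)
qed

end

section \<open>Split counits\<close>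

lemma linear_map_image_module:
  assumes "module K M" "module K N" "linear_map K M N t"
  shows "module K (N\<lparr>carrier := t ` carrier M\<rparr>)"
proof (rule module_restrict_carrier[OF assms(2)])
  interpret M: module K M by fact
  note closed = linear_map_closed[OF assms(3)]
  show "t ` carrier M \<subseteq> carrier N" using closed by auto
  show "\<zero>\<^bsub>N\<^esub> \<in> t ` carrier M" using linear_map_zero[OF assms] by (intro image_eqI[of _ _ "\<zero>\<^bsub>M\<^esub>"]) auto
  show "x \<oplus>\<^bsub>N\<^esub> y \<in> t ` carrier M" if "x \<in> t ` carrier M" "y \<in> t ` carrier M" for x y
    using that by (auto simp: linear_map_add[OF assms(3), symmetric])
  show "c \<odot>\<^bsub>N\<^esub> x \<in> t ` carrier M" if "c \<in> carrier K" "x \<in> t ` carrier M" for c x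
    using that by (auto simp: linear_map_smult[OF assms(3), symmetric])
qed

lemma linear_map_into:
  assumes "linear_map K M N t" "\<And>x. x \<in> carrier M \<Longrightarrow> t x \<in> A"
  shows "linear_map K M (N\<lparr>carrier := A\<rparr>) t"
  using assms unfolding linear_map_def by auto

text \<open>Here T is \<open>F \<boxtimes> Fd\<close>, and the axioms record what is used of the
  adjunction: naturality and module compatibility of both counits, and in
  \<open>\<epsilon>_middle\<close> the counit half of (IV). The families \<open>sl\<close> and
  \<open>sr\<close> are pointwise sections of the counits.\<close>

locale split_counits = large_semigroup_category K S
  for K :: "'k ring" and S :: "('o, 'k, 'a, 'z) semicat_scheme" (structure) +
  fixes T :: 'o and \<epsilon>l \<epsilon>r sl sr :: "'o \<Rightarrow> 'a"
  assumes T: "T \<in> Obj S"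
    and \<epsilon>l_arr: "X \<in> Obj S \<Longrightarrow> \<epsilon>l X \<in> arr S (X \<boxtimes> T) X"
    and \<epsilon>r_arr: "X \<in> Obj S \<Longrightarrow> \<epsilon>r X \<in> arr S (T \<boxtimes> X) X"
    and \<epsilon>l_natural: "\<lbrakk>X \<in> Obj S; Y \<in> Obj S; f \<in> arr S X Y\<rbrakk> \<Longrightarrow> \<epsilon>l Y \<cdot> (f \<boxdot> Ident S T) = f \<cdot> \<epsilon>l X"
    and \<epsilon>r_natural: "\<lbrakk>X \<in> Obj S; Y \<in> Obj S; f \<in> arr S X Y\<rbrakk> \<Longrightarrow> \<epsilon>r Y \<cdot> (Ident S T \<boxdot> f) = f \<cdot> \<epsilon>r X"
    and \<epsilon>l_module: "\<lbrakk>X \<in> Obj S; Y \<in> Obj S\<rbrakk> \<Longrightarrow> \<epsilon>l (X \<boxtimes> Y) = (Ident S X \<boxdot> \<epsilon>l Y) \<cdot> Assoc S X Y T"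
    and \<epsilon>r_module: "\<lbrakk>X \<in> Obj S; Y \<in> Obj S\<rbrakk> \<Longrightarrow> \<epsilon>r (X \<boxtimes> Y) \<cdot> Assoc S T X Y = \<epsilon>r X \<boxdot> Ident S Y"
    and \<epsilon>_middle: "\<lbrakk>X \<in> Obj S; Y \<in> Obj S\<rbrakk> \<Longrightarrow> (Ident S X \<boxdot> \<epsilon>r Y) \<cdot> Assoc S X T Y = \<epsilon>l X \<boxdot> Ident S Y"
    and sl_arr: "X \<in> Obj S \<Longrightarrow> sl X \<in> arr S X (X \<boxtimes> T)"
    and sr_arr: "X \<in> Obj S \<Longrightarrow> sr X \<in> arr S X (T \<boxtimes> X)"
    and \<epsilon>l_sl: "X \<in> Obj S \<Longrightarrow> \<epsilon>l X \<cdot> sl X = Ident S X"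
    and \<epsilon>r_sr: "X \<in> Obj S \<Longrightarrow> \<epsilon>r X \<cdot> sr X = Ident S X"
begin

lemma TT: "T \<boxtimes> T \<in> Obj S"
  by (rule tensor_obj[OF T T])

lemma counit_simps [simp]:
  assumes "X \<in> Obj S"
  shows "arrow (\<epsilon>l X)" "src (\<epsilon>l X) = X \<boxtimes> T" "trg (\<epsilon>l X) = X"
    "arrow (\<epsilon>r X)" "src (\<epsilon>r X) = T \<boxtimes> X" "trg (\<epsilon>r X) = X"
    "arrow (sl X)" "src (sl X) = X" "trg (sl X) = X \<boxtimes> T"
    "arrow (sr X)" "src (sr X) = X" "trg (sr X) = T \<boxtimes> X"
  using \<epsilon>l_arr[OF assms] \<epsilon>r_arr[OF assms] sl_arr[OF assms] sr_arr[OF assms] assms T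
  by (simp_all add: in_arr_iff tensor_obj)

lemmas split_simps = T semigroup_simps in_arr_iff

definition coeq_map :: "'o \<Rightarrow> 'a \<Rightarrow> 'a" where
  "coeq_map H a = \<epsilon>l T \<cdot> (Ident S T \<boxdot> a)"

text \<open>For \<open>u = coeq_map H a\<close> this is \<open>\<epsilon>l T \<cdot> h\<close> with
  the arrow \<open>h\<close> of \<open>coeq_section_map\<close>. The formula mentions only
  \<open>u\<close>, so it is linear and involves no choice of \<open>a\<close>.\<close>

definition coeq_section :: "'o \<Rightarrow> 'a \<Rightarrow> 'a" where
  "coeq_section H u = u \<cdot> sr H"

text \<open>Taking an image inside a hom-space, and not a quotient of one, keeps the values in the
  universe and lets them inherit their module structure.\<close>

definition coeq :: "('o, 'k, 'a) presheaf" where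
  "coeq = \<lparr>PVal = (\<lambda>H. (Hom S (T \<boxtimes> H) T)\<lparr>carrier := coeq_map H ` arr S H T\<rparr>),
    PAct = (\<lambda>h u. u \<cdot> (Ident S T \<boxdot> h))\<rparr>"

lemma coeq_sel:
  "PVal coeq H = (Hom S (T \<boxtimes> H) T)\<lparr>carrier := coeq_map H ` arr S H T\<rparr>"
  "carrier (PVal coeq H) = coeq_map H ` arr S H T"
  "PAct coeq h = (\<lambda>u. u \<cdot> (Ident S T \<boxdot> h))"
  by (simp_all add: coeq_def)

lemma coeq_map_arr: "H \<in> Obj S \<Longrightarrow> a \<in> arr S H T \<Longrightarrow> coeq_map H a \<in> arr S (T \<boxtimes> H) T"
  by (simp add: coeq_map_def split_simps)

lemma coeq_map_linear_Hom:
  assumes "H \<in> Obj S"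
  shows "linear_map K (Hom S H T) (Hom S (T \<boxtimes> H) T) (coeq_map H)"
  unfolding coeq_map_def
  by (rule linear_map_compose[OF tensor_linear_right[OF T T assms T ident_arr[OF T]]
        comp_linear_right[OF tensor_obj[OF T assms] TT T \<epsilon>l_arr[OF T]]])

lemma coeq_map_natural:
  assumes "H \<in> Obj S" "H' \<in> Obj S" "h \<in> arr S H' H" "a \<in> arr S H T"
  shows "coeq_map H a \<cdot> (Ident S T \<boxdot> h) = coeq_map H' (a \<cdot> h)"
  using assms by (simp add: coeq_map_def split_simps interchange_simps)

lemma coeq_presheaf: "is_presheaf K S coeq"
proof (rule presheafI)
  show "module K (PVal coeq H)" if H: "H \<in> Obj S" for H
    unfolding coeq_sel
    by (rule linear_map_image_module[OF hom_module[OF H T] hom_module[OF tensor_obj[OF T H] T] coeq_map_linear_Hom[OF H]])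
  have sub: "coeq_map H ` arr S H T \<subseteq> arr S (T \<boxtimes> H) T" if "H \<in> Obj S" for H
    using coeq_map_arr[OF that] by auto
  have closed: "u \<cdot> (Ident S T \<boxdot> h) \<in> coeq_map H' ` arr S H' T"
    if "H' \<in> Obj S" "H \<in> Obj S" "h \<in> arr S H' H" "u \<in> coeq_map H ` arr S H T" for H H' h u
    using that coeq_map_natural[OF that(2,1,3)] comp_closed[OF that(1,2) T that(3)] by auto
  show "linear_map K (PVal coeq H) (PVal coeq H') (PAct coeq h)"
    if H: "H' \<in> Obj S" "H \<in> Obj S" "h \<in> arr S H' H" for H' H h
    unfolding coeq_sel
  proof (rule linear_map_into)
    have "linear_map K (Hom S (T \<boxtimes> H) T) (Hom S (T \<boxtimes> H') T) (\<lambda>u. u \<cdot> (Ident S T \<boxdot> h))"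
      by (rule comp_linear_left) (use H T in \<open>auto intro: tensor_obj ident_arr\<close>)
    then show "linear_map K ((Hom S (T \<boxtimes> H) T)\<lparr>carrier := coeq_map H ` arr S H T\<rparr>) (Hom S (T \<boxtimes> H') T) (\<lambda>u. u \<cdot> (Ident S T \<boxdot> h))"
      by (rule linear_map_restrict_carrier) (rule sub[OF H(2)])
  next
    fix u assume "u \<in> carrier ((Hom S (T \<boxtimes> H) T)\<lparr>carrier := coeq_map H ` arr S H T\<rparr>)"
    then show "u \<cdot> (Ident S T \<boxdot> h) \<in> coeq_map H' ` arr S H' T"
      using closed[OF H] by simp
  qed
  show "linear_map K (Hom S H' H) (PVal coeq H') (\<lambda>h. PAct coeq h u)"
    if H: "H' \<in> Obj S" "H \<in> Obj S" and u: "u \<in> carrier (PVal coeq H)" for H' H u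
  proof -
    have u': "u \<in> coeq_map H ` arr S H T" "u \<in> arr S (T \<boxtimes> H) T"
      using u sub[OF H(2)] by (auto simp: coeq_sel)
    show ?thesis unfolding coeq_sel
    proof (rule linear_map_into)
      show "linear_map K (Hom S H' H) (Hom S (T \<boxtimes> H') T) (\<lambda>h. u \<cdot> (Ident S T \<boxdot> h))"
        by (rule linear_map_compose[OF tensor_linear_right[OF T T H ident_arr[OF T]]
              comp_linear_right[OF tensor_obj[OF T H(1)] tensor_obj[OF T H(2)] T u'(2)]])
    qed (rule closed[OF H _ u'(1)])
  qed
  show "PAct coeq (Ident S H) u = u" if "H \<in> Obj S" "u \<in> carrier (PVal coeq H)" for H u
  proof -
    have "u \<in> arr S (T \<boxtimes> H) T" by (rule subsetD[OF sub[OF that(1)] that(2)[unfolded coeq_sel(2)]])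
    then show ?thesis unfolding coeq_sel(3) using that(1) by (simp add: split_simps)
  qed
  show "PAct coeq (g \<cdot> f) u = PAct coeq f (PAct coeq g u)"
    if H: "X \<in> Obj S" "Y \<in> Obj S" "Z \<in> Obj S" "f \<in> arr S X Y" "g \<in> arr S Y Z" "u \<in> carrier (PVal coeq Z)" for X Y Z f g u
  proof -
    have "u \<in> arr S (T \<boxtimes> Z) T" by (rule subsetD[OF sub[OF H(3)] H(6)[unfolded coeq_sel(2)]])
    then show ?thesis unfolding coeq_sel(3) using H(1-5) by (simp add: split_simps interchange_simps)
  qed
qed

lemma coeq_map_closed: "\<lbrakk>H \<in> Obj S; a \<in> arr S H T\<rbrakk> \<Longrightarrow> coeq_map H a \<in> carrier (PVal coeq H)"
  unfolding coeq_sel(2) by (rule imageI)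

lemma coeq_map_act:
  "\<lbrakk>H \<in> Obj S; H' \<in> Obj S; h \<in> arr S H' H; a \<in> arr S H T\<rbrakk> \<Longrightarrow> PAct coeq h (coeq_map H a) = coeq_map H' (a \<cdot> h)"
  unfolding coeq_sel(3) by (rule coeq_map_natural)

text \<open>By \<open>\<epsilon>_middle\<close> the left side becomes \<epsilon>l at T after
  \<epsilon>l tensored with T; naturality of \<epsilon>l and its module property turn this into the
  right side. The associator picked up on both sides is invertible.\<close>

lemma coeq_map_coequalizes: "coeq_map (T \<boxtimes> T) (\<epsilon>r T) = coeq_map (T \<boxtimes> T) (\<epsilon>l T)"
proof -
  have "(\<epsilon>l T \<cdot> (Ident S T \<boxdot> \<epsilon>r T)) \<cdot> Assoc S T T T = \<epsilon>l T \<cdot> (\<epsilon>l T \<boxdot> Ident S T)"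
    using \<epsilon>_middle[OF T T] TT by (simp add: split_simps)
  also have "\<dots> = \<epsilon>l T \<cdot> \<epsilon>l (T \<boxtimes> T)"
    by (rule \<epsilon>l_natural[OF TT T \<epsilon>l_arr[OF T]])
  also have "\<dots> = (\<epsilon>l T \<cdot> (Ident S T \<boxdot> \<epsilon>l T)) \<cdot> Assoc S T T T"
    using \<epsilon>l_module[OF T T] TT by (simp add: split_simps)
  finally have "(\<epsilon>l T \<cdot> (Ident S T \<boxdot> \<epsilon>r T)) \<cdot> Assoc S T T T \<cdot> inv_arr S (Assoc S T T T)
      = (\<epsilon>l T \<cdot> (Ident S T \<boxdot> \<epsilon>l T)) \<cdot> Assoc S T T T \<cdot> inv_arr S (Assoc S T T T)"
    by simp
  then show ?thesis unfolding coeq_map_def by (simp add: split_simps)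
qed

lemma coeq_map_coequalizes':
  assumes "H \<in> Obj S" "h \<in> arr S H (T \<boxtimes> T)"
  shows "coeq_map H (\<epsilon>r T \<cdot> h) = coeq_map H (\<epsilon>l T \<cdot> h)"
  using coeq_map_natural[OF TT assms \<epsilon>r_arr[OF T]] coeq_map_natural[OF TT assms \<epsilon>l_arr[OF T]]
  by (simp add: coeq_map_coequalizes)

text \<open>This is where the splitting enters: up to the two maps of the coequalizer diagram, \<open>a\<close> is
  recovered from its image.\<close>

lemma coeq_section_map:
  assumes H: "H \<in> Obj S" and a: "a \<in> arr S H T"
  shows "\<exists>h\<in>arr S H (T \<boxtimes> T). a = \<epsilon>r T \<cdot> h \<and> coeq_section H (coeq_map H a) = \<epsilon>l T \<cdot> h"
proof (intro bexI[of _ "(Ident S T \<boxdot> a) \<cdot> sr H"] conjI)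
  have "\<epsilon>r T \<cdot> ((Ident S T \<boxdot> a) \<cdot> sr H) = (\<epsilon>r T \<cdot> (Ident S T \<boxdot> a)) \<cdot> sr H"
    using H a by (simp add: split_simps)
  also have "\<dots> = a \<cdot> (\<epsilon>r H \<cdot> sr H)"
    unfolding \<epsilon>r_natural[OF H T a] using H a by (simp add: split_simps)
  also have "\<dots> = a" unfolding \<epsilon>r_sr[OF H] by (rule comp_ident_right[OF H T a])
  finally show "a = \<epsilon>r T \<cdot> ((Ident S T \<boxdot> a) \<cdot> sr H)" by simp
  show "coeq_section H (coeq_map H a) = \<epsilon>l T \<cdot> ((Ident S T \<boxdot> a) \<cdot> sr H)"
    using H a by (simp add: coeq_section_def coeq_map_def split_simps)
  show "(Ident S T \<boxdot> a) \<cdot> sr H \<in> arr S H (T \<boxtimes> T)"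
    using H a by (simp add: split_simps)
qed

lemma coeq_section_linear:
  assumes H: "H \<in> Obj S"
  shows "linear_map K (PVal coeq H) (Hom S H T) (coeq_section H)"
  unfolding coeq_sel coeq_section_def
  by (rule linear_map_restrict_carrier[OF comp_linear_left[OF H tensor_obj[OF T H] T sr_arr[OF H]]])
    (use coeq_map_arr[OF H] in auto)

lemma coeq_map_section:
  assumes H: "H \<in> Obj S" and u: "u \<in> carrier (PVal coeq H)"
  shows "coeq_map H (coeq_section H u) = u"
proof -
  obtain a where a: "a \<in> arr S H T" "u = coeq_map H a" using u by (auto simp: coeq_sel)
  obtain h where "h \<in> arr S H (T \<boxtimes> T)" "a = \<epsilon>r T \<cdot> h" "coeq_section H (coeq_map H a) = \<epsilon>l T \<cdot> h"
    using coeq_section_map[OF H a(1)] by blast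
  then show ?thesis using coeq_map_coequalizes'[OF H] a(2) by metis
qed

lemma left_unit_coeq: "left_unit K S T \<epsilon>r sr (\<epsilon>r T) (\<epsilon>l T) coeq coeq_map coeq_section"
proof
  fix L assume L: "L \<in> Obj S"
  show "\<exists>\<beta> \<beta>'. \<beta> \<in> arr S (T \<boxtimes> T \<boxtimes> L) (T \<boxtimes> (T \<boxtimes> L)) \<and>
      \<beta>' \<in> arr S (T \<boxtimes> (T \<boxtimes> L)) (T \<boxtimes> T \<boxtimes> L) \<and> \<beta> \<cdot> \<beta>' = Ident S (T \<boxtimes> (T \<boxtimes> L)) \<and>
      \<epsilon>r T \<boxdot> Ident S L = \<epsilon>r (T \<boxtimes> L) \<cdot> \<beta> \<and> \<epsilon>l T \<boxdot> Ident S L = (Ident S T \<boxdot> \<epsilon>r L) \<cdot> \<beta>"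
    by (intro exI[of _ "Assoc S T T L"] exI[of _ "inv_arr S (Assoc S T T L)"])
      (simp add: \<epsilon>_middle[OF T L] \<epsilon>r_module[OF T L] split_simps L)
next
  fix H a assume "H \<in> Obj S" "a \<in> arr S H T"
  then show "\<exists>h\<in>arr S H (T \<boxtimes> T). a = \<epsilon>r T \<cdot> h \<and> coeq_section H (coeq_map H a) = \<epsilon>l T \<cdot> h \<or>
      a = \<epsilon>l T \<cdot> h \<and> coeq_section H (coeq_map H a) = \<epsilon>r T \<cdot> h"
    using coeq_section_map by blast
qed (fact T \<epsilon>r_arr[OF T] \<epsilon>l_arr[OF T] coeq_presheaf coeq_map_coequalizes
    | rule \<epsilon>r_arr \<epsilon>r_natural sr_arr \<epsilon>r_sr coeq_map_closed coeq_map_act coeq_section_linear coeq_map_section; assumption)+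

text \<open>In the reversed order \<epsilon>l is the counit acting from the left, the arrow
  \<open>\<beta>\<close> is the inverse of the associator, and the two arrows of the pair trade
  places. The presheaf and its section stay the same, so both unit structures live on one
  object.\<close>

lemma left_unit_rev_coeq: "left_unit K (rev_tensor S) T \<epsilon>l sl (\<epsilon>l T) (\<epsilon>r T) coeq coeq_map coeq_section"
proof (intro left_unit.intro left_unit_axioms.intro tensor_category_rev_tensor,
    unfold rev_tensor_simps is_presheaf_rev_tensor)
  fix L assume L: "L \<in> Obj S"
  have "\<epsilon>l (L \<boxtimes> T) \<cdot> inv_arr S (Assoc S L T T) = Ident S L \<boxdot> \<epsilon>l T"
    using L TT by (simp add: \<epsilon>l_module[OF L T] split_simps)
  moreover have "(\<epsilon>l L \<boxdot> Ident S T) \<cdot> inv_arr S (Assoc S L T T) = Ident S L \<boxdot> \<epsilon>r T"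
    using L TT by (simp add: \<epsilon>_middle[OF L T, symmetric] split_simps)
  ultimately show "\<exists>\<beta> \<beta>'. \<beta> \<in> arr S (L \<boxtimes> (T \<boxtimes> T)) (L \<boxtimes> T \<boxtimes> T) \<and>
      \<beta>' \<in> arr S (L \<boxtimes> T \<boxtimes> T) (L \<boxtimes> (T \<boxtimes> T)) \<and> \<beta> \<cdot> \<beta>' = Ident S (L \<boxtimes> T \<boxtimes> T) \<and>
      Ident S L \<boxdot> \<epsilon>l T = \<epsilon>l (L \<boxtimes> T) \<cdot> \<beta> \<and> Ident S L \<boxdot> \<epsilon>r T = (\<epsilon>l L \<boxdot> Ident S T) \<cdot> \<beta>"
    by (intro exI[of _ "inv_arr S (Assoc S L T T)"] exI[of _ "Assoc S L T T"]) (simp add: split_simps L)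
next
  fix H a assume "H \<in> Obj S" "a \<in> arr S H T"
  then show "\<exists>h\<in>arr S H (T \<boxtimes> T). a = \<epsilon>l T \<cdot> h \<and> coeq_section H (coeq_map H a) = \<epsilon>r T \<cdot> h \<or>
      a = \<epsilon>r T \<cdot> h \<and> coeq_section H (coeq_map H a) = \<epsilon>l T \<cdot> h"
    using coeq_section_map by blast
qed (fact T \<epsilon>r_arr[OF T] \<epsilon>l_arr[OF T] coeq_presheaf coeq_map_coequalizes[symmetric]
    | rule \<epsilon>l_arr \<epsilon>l_natural sl_arr \<epsilon>l_sl coeq_map_closed coeq_map_act coeq_section_linear coeq_map_section; assumption)+

theorem unit_object_coeq: "is_unit_object PSh coeq"
proof -
  interpret L: left_unit K S T \<epsilon>r sr "\<epsilon>r T" "\<epsilon>l T" coeq coeq_map coeq_section by (rule left_unit_coeq)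
  interpret R: left_unit K "rev_tensor S" T \<epsilon>l sl "\<epsilon>l T" "\<epsilon>r T" coeq coeq_map coeq_section by (rule left_unit_rev_coeq)
  show ?thesis
  proof (rule unit_objectI[where l = L.unit_in and r = "\<lambda>P H L f p u. R.unit_in P L H f u p"])
    show "is_presheaf K S coeq" by (rule coeq_presheaf)
    show "is_day_convolution K S coeq P P (L.unit_in P)" if "is_presheaf K S P" for P
      by (rule L.day_convolution_left_unit[OF that])
    show "is_day_convolution K S P coeq P (\<lambda>H L f p u. R.unit_in P L H f u p)" if "is_presheaf K S P" for P
      by (rule day_convolution_rev_tensor) (use R.day_convolution_left_unit that in simp)
  next
    fix P Q \<theta> X H L f u p
    assume "presheaf_nat K S P Q \<theta>" "X \<in> Obj S" "H \<in> Obj S" "L \<in> Obj S" "f \<in> arr S X (H \<boxtimes> L)"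
      "u \<in> carrier (PVal coeq H)" "p \<in> carrier (PVal P L)"
    then show "\<theta> X (L.unit_in P H L f u p) = L.unit_in Q H L f u (\<theta> L p)"
      by (rule L.unit_in_natural)
  next
    fix P Q \<theta> X H L f p u
    assume \<theta>: "presheaf_nat K S P Q \<theta>" and a: "X \<in> Obj S" "H \<in> Obj S" "L \<in> Obj S" "f \<in> arr S X (H \<boxtimes> L)"
      "p \<in> carrier (PVal P H)" "u \<in> carrier (PVal coeq L)"
    have "presheaf_nat K (rev_tensor S) P Q \<theta>"
      using \<theta> by (simp add: presheaf_nat_def)
    then show "\<theta> X (R.unit_in P L H f u p) = R.unit_in Q L H f u (\<theta> H p)"
      using a by (intro R.unit_in_natural) simp_all
  next
    fix P Q X H L A B f g p u q
    assume P: "is_presheaf K S P" and Q: "is_presheaf K S Q"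
      and a: "X \<in> Obj S" "H \<in> Obj S" "L \<in> Obj S" and b: "A \<in> Obj S" "B \<in> Obj S"
      and f: "f \<in> arr S X (H \<boxtimes> L)" and g: "g \<in> arr S H (A \<boxtimes> B)"
      and p: "p \<in> carrier (PVal P A)" and u: "u \<in> carrier (PVal coeq B)" and q: "q \<in> carrier (PVal Q L)"
    note D = day_convolution_cowedge[OF day_convolution_day[OF P Q] a(1)]
    \<comment> \<open>A single representative of \<open>u\<close> describes both unit structures:
      \<open>u\<close> acts on \<open>L\<close> from the left through \<open>k\<close>, and on
      \<open>A\<close> from the right through \<open>k'\<close>.\<close>
    define v where "v = coeq_section B u"
    have v: "v \<in> arr S B T" unfolding v_def by (rule L.\<sigma>_closed[OF b(2) u])
    define k where "k = \<epsilon>r L \<cdot> (v \<boxdot> Ident S L)"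
    define k' where "k' = \<epsilon>l A \<cdot> (Ident S A \<boxdot> v) \<cdot> g"
    have k: "k \<in> arr S (B \<boxtimes> L) L" unfolding k_def using v a b by (simp add: split_simps)
    have k': "k' \<in> arr S H A" unfolding k'_def using v g a b by (simp add: split_simps)
    have l: "L.unit_in Q B L (Ident S (B \<boxtimes> L)) u q = PAct Q k q"
      unfolding L.unit_in_def L.action_def v_def[symmetric] k_def[symmetric]
      using comp_ident_right[OF tensor_obj[OF b(2) a(3)] a(3) k] by simp
    have r: "R.unit_in P B A g u p = PAct P k' p"
      unfolding R.unit_in_def R.action_def v_def[symmetric] k'_def by simp
    \<comment> \<open>The triangle axiom at the level of arrows. Once \<open>v\<close> has produced
      a factor T between \<open>A\<close> and \<open>L\<close>, axiom (IV), here
      \<open>\<epsilon>_middle\<close>, says that it may be cancelled against either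
      neighbour.\<close>
    have "(Ident S A \<boxdot> k) \<cdot> reassoc A B L g f
        = (Ident S A \<boxdot> \<epsilon>r L) \<cdot> ((Ident S A \<boxdot> (v \<boxdot> Ident S L)) \<cdot> (Assoc S A B L \<cdot> ((g \<boxdot> Ident S L) \<cdot> f)))"
      unfolding k_def reassoc_def using v f g a b by (simp add: split_simps interchange_simps)
    also have "(Ident S A \<boxdot> (v \<boxdot> Ident S L)) \<cdot> (Assoc S A B L \<cdot> ((g \<boxdot> Ident S L) \<cdot> f))
        = Assoc S A T L \<cdot> ((Ident S A \<boxdot> v \<boxdot> Ident S L) \<cdot> ((g \<boxdot> Ident S L) \<cdot> f))"
      using v f g a b arrow_assoc_natural_assoc[of "Ident S A" v "Ident S L" A T L "(g \<boxdot> Ident S L) \<cdot> f"]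
      by (simp add: split_simps)
    also have "(Ident S A \<boxdot> \<epsilon>r L) \<cdot> \<dots>
        = ((Ident S A \<boxdot> \<epsilon>r L) \<cdot> Assoc S A T L) \<cdot> ((Ident S A \<boxdot> v \<boxdot> Ident S L) \<cdot> ((g \<boxdot> Ident S L) \<cdot> f))"
      using v f g a b by (simp add: split_simps)
    also have "\<dots> = (k' \<boxdot> Ident S L) \<cdot> f"
      unfolding \<epsilon>_middle[OF b(1) a(3)] k'_def using v f g a b by (simp add: split_simps interchange_simps)
    finally have arrows: "(Ident S A \<boxdot> k) \<cdot> reassoc A B L g f = (k' \<boxdot> Ident S L) \<cdot> f" .
    \<comment> \<open>Dinaturality moves \<open>k\<close> into the arrow and, after the identity
      \<open>arrows\<close>, moves \<open>k'\<close> out onto \<open>p\<close>.\<close>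
    have "day_in K S P Q A (B \<boxtimes> L) (reassoc A B L g f) p (PAct Q k q)
        = day_in K S P Q A (B \<boxtimes> L) (reassoc A B L g f) (PAct P (Ident S A) p) (PAct Q k q)"
      by (simp add: presheaf_ident[OF P b(1) p])
    also have "\<dots> = day_in K S P Q A L ((Ident S A \<boxdot> k) \<cdot> reassoc A B L g f) p q"
      by (rule day_cowedge_dinatural[OF D b(1,1) tensor_obj[OF b(2) a(3)] a(3) ident_arr[OF b(1)] k
            reassoc_arr[OF b a(2,3,1) g f] p q, symmetric])
    also have "\<dots> = day_in K S P Q H L f (PAct P k' p) (PAct Q (Ident S L) q)"
      unfolding arrows by (rule day_cowedge_dinatural[OF D a(2) b(1) a(3,3) k' ident_arr[OF a(3)] f p q])
    also have "\<dots> = day_in K S P Q H L f (PAct P k' p) q"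
      by (simp add: presheaf_ident[OF Q a(3) q])
    finally show "day_in K S P Q A (B \<boxtimes> L) (reassoc A B L g f) p (L.unit_in Q B L (Ident S (B \<boxtimes> L)) u q)
        = day_in K S P Q H L f (R.unit_in P B A g u p) q"
      unfolding l r .
  qed
qed

text \<open>\<open>W\<close> allows for another bracketing of T tensored with itself. A map out of
  Hom(-, T) that coequalizes the pair is unchanged by passing from \<open>a\<close> to
  \<open>coeq_section X (coeq_map X a)\<close>, hence factors through the image.\<close>

lemma coequalizer_coeq:
  assumes W: "W \<in> Obj S" and \<alpha>: "\<alpha> \<in> arr S W (T \<boxtimes> T)" and \<alpha>': "\<alpha>' \<in> arr S (T \<boxtimes> T) W"
    and \<alpha>\<alpha>': "\<alpha> \<cdot> \<alpha>' = Ident S (T \<boxtimes> T)"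
  shows "is_coequalizer PSh (yoneda S W) (yoneda S T) (yoneda_arr S W T (\<epsilon>r T \<cdot> \<alpha>)) (yoneda_arr S W T (\<epsilon>l T \<cdot> \<alpha>))
    coeq (presheaf_arr S (yoneda S T) coeq coeq_map)"
proof -
  have yo: "presheaf_nat K S (yoneda S W) (yoneda S T) (\<lambda>Z g. k \<cdot> g)" if "k \<in> arr S W T" for k
    by (rule presheaf_natI)
      (use that W T in \<open>simp_all add: yoneda_def comp_linear_right comp_assoc[of _ _ W T, symmetric]\<close>)
  have r\<alpha>: "\<epsilon>r T \<cdot> \<alpha> \<in> arr S W T" and l\<alpha>: "\<epsilon>l T \<cdot> \<alpha> \<in> arr S W T"
    using comp_closed[OF W TT T \<alpha>] \<epsilon>r_arr[OF T] \<epsilon>l_arr[OF T] by auto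
  have q: "presheaf_nat K S (yoneda S T) coeq coeq_map"
  proof (rule presheaf_natI)
    show "linear_map K (PVal (yoneda S T) X) (PVal coeq X) (coeq_map X)" if "X \<in> Obj S" for X
      unfolding coeq_sel yoneda_def by (simp add: linear_map_into[OF coeq_map_linear_Hom[OF that]])
    show "coeq_map X (PAct (yoneda S T) f p) = PAct coeq f (coeq_map Y p)"
      if "X \<in> Obj S" "Y \<in> Obj S" "f \<in> arr S X Y" "p \<in> carrier (PVal (yoneda S T) Y)" for X Y f p
      using coeq_map_act[OF that(2,1,3)] that(4) by (simp add: yoneda_def)
  qed
  have q_comp: "presheaf_arr S (yoneda S T) coeq coeq_map \<cdot>\<^bsub>PSh\<^esub> yoneda_arr S W T k
      = presheaf_arr S (yoneda S W) coeq (\<lambda>Z g. coeq_map Z (k \<cdot> g))" if "k \<in> arr S W T" for k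
    unfolding yoneda_arr_def by (rule presheaf_arr_comp'[OF yo[OF that]])
  show ?thesis
    unfolding is_coequalizer_def
  proof (intro conjI ballI impI)
    show "coeq \<in> Obj PSh" using coeq_presheaf by simp
    show "presheaf_arr S (yoneda S T) coeq coeq_map \<in> arr PSh (yoneda S T) coeq"
      using q by auto
    show "yoneda_arr S W T (\<epsilon>r T \<cdot> \<alpha>) \<in> arr PSh (yoneda S W) (yoneda S T)"
      "yoneda_arr S W T (\<epsilon>l T \<cdot> \<alpha>) \<in> arr PSh (yoneda S W) (yoneda S T)"
      unfolding yoneda_arr_def using yo[OF r\<alpha>] yo[OF l\<alpha>] by auto
    show "presheaf_arr S (yoneda S T) coeq coeq_map \<cdot>\<^bsub>PSh\<^esub> yoneda_arr S W T (\<epsilon>r T \<cdot> \<alpha>)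
        = presheaf_arr S (yoneda S T) coeq coeq_map \<cdot>\<^bsub>PSh\<^esub> yoneda_arr S W T (\<epsilon>l T \<cdot> \<alpha>)"
      unfolding q_comp[OF r\<alpha>] q_comp[OF l\<alpha>]
    proof (rule presheaf_arr_eqI)
      fix X g assume X: "X \<in> Obj S" and "g \<in> carrier (PVal (yoneda S W) X)"
      then have g: "g \<in> arr S X W" by (simp add: yoneda_def)
      show "coeq_map X (\<epsilon>r T \<cdot> \<alpha> \<cdot> g) = coeq_map X (\<epsilon>l T \<cdot> \<alpha> \<cdot> g)"
        using coeq_map_coequalizes'[OF X comp_closed[OF X W TT g \<alpha>]]
          comp_assoc[OF X W TT T g \<alpha> \<epsilon>r_arr[OF T]] comp_assoc[OF X W TT T g \<alpha> \<epsilon>l_arr[OF T]] by simp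
    qed
  next
    fix Z h assume "Z \<in> Obj PSh" and h: "h \<in> arr PSh (yoneda S T) Z"
      and eq: "h \<cdot>\<^bsub>PSh\<^esub> yoneda_arr S W T (\<epsilon>r T \<cdot> \<alpha>) = h \<cdot>\<^bsub>PSh\<^esub> yoneda_arr S W T (\<epsilon>l T \<cdot> \<alpha>)"
    then have Z: "is_presheaf K S Z" by simp
    obtain \<eta> where \<eta>: "h = presheaf_arr S (yoneda S T) Z \<eta>" "presheaf_nat K S (yoneda S T) Z \<eta>"
      using h by (auto simp: arr_presheaf_Hom)
    have \<eta>_natural: "\<eta> X (a \<cdot> f) = PAct Z f (\<eta> Y a)" if "X \<in> Obj S" "Y \<in> Obj S" "f \<in> arr S X Y" "a \<in> arr S Y T" for X Y f a
      using presheaf_nat_natural[OF \<eta>(2) that(1-3)] that(4) by (simp add: yoneda_def)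
    \<comment> \<open>The hypothesis speaks of arrows into \<open>W\<close>; the right inverse
      \<open>\<alpha>'\<close> of \<open>\<alpha>\<close> lets every arrow into
      \<open>T \<boxtimes> T\<close> factor through \<open>W\<close>.\<close>
    have \<eta>_coeq: "\<eta> X (\<epsilon>r T \<cdot> x) = \<eta> X (\<epsilon>l T \<cdot> x)" if X: "X \<in> Obj S" and x: "x \<in> arr S X (T \<boxtimes> T)" for X x
    proof -
      have arrs: "presheaf_arr S (yoneda S W) Z (\<lambda>X g. \<eta> X (\<epsilon>r T \<cdot> \<alpha> \<cdot> g)) = presheaf_arr S (yoneda S W) Z (\<lambda>X g. \<eta> X (\<epsilon>l T \<cdot> \<alpha> \<cdot> g))"
        using eq unfolding \<eta>(1) yoneda_arr_def presheaf_arr_comp'[OF yo[OF r\<alpha>]] presheaf_arr_comp'[OF yo[OF l\<alpha>]] .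
      have "\<alpha>' \<cdot> x \<in> carrier (PVal (yoneda S W) X)"
        using comp_closed[OF X TT W x \<alpha>'] by (simp add: yoneda_def)
      from presheaf_arr_eqD[OF arrs X this]
      have "\<eta> X (\<epsilon>r T \<cdot> \<alpha> \<cdot> (\<alpha>' \<cdot> x)) = \<eta> X (\<epsilon>l T \<cdot> \<alpha> \<cdot> (\<alpha>' \<cdot> x))"
        .
      moreover have "\<alpha> \<cdot> (\<alpha>' \<cdot> x) = x"
        using comp_assoc[OF X TT W TT x \<alpha>' \<alpha>] comp_ident_left[OF X TT x] by (simp add: \<alpha>\<alpha>')
      ultimately show ?thesis
        using comp_assoc[OF X W TT T comp_closed[OF X TT W x \<alpha>'] \<alpha> \<epsilon>r_arr[OF T]]
          comp_assoc[OF X W TT T comp_closed[OF X TT W x \<alpha>'] \<alpha> \<epsilon>l_arr[OF T]] by simp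
    qed
    have \<eta>_section: "\<eta> X (coeq_section X (coeq_map X a)) = \<eta> X a" if X: "X \<in> Obj S" and a: "a \<in> arr S X T" for X a
    proof -
      obtain x where "x \<in> arr S X (T \<boxtimes> T)" "a = \<epsilon>r T \<cdot> x" "coeq_section X (coeq_map X a) = \<epsilon>l T \<cdot> x"
        using coeq_section_map[OF X a] by blast
      then show ?thesis using \<eta>_coeq[OF X] by metis
    qed
    define \<mu> where "\<mu> X u = \<eta> X (coeq_section X u)" for X u
    have \<mu>: "presheaf_nat K S coeq Z \<mu>"
    proof (rule presheaf_natI)
      fix X assume X: "X \<in> Obj S"
      have "linear_map K (Hom S X T) (PVal Z X) (\<eta> X)"
        using presheaf_nat_linear[OF \<eta>(2) X] by (simp add: yoneda_def)
      then show "linear_map K (PVal coeq X) (PVal Z X) (\<mu> X)"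
        unfolding \<mu>_def by (rule linear_map_compose[OF coeq_section_linear[OF X]])
    next
      fix X Y f u assume X: "X \<in> Obj S" and Y: "Y \<in> Obj S" and f: "f \<in> arr S X Y" and "u \<in> carrier (PVal coeq Y)"
      then obtain a where a: "a \<in> arr S Y T" and u: "u = coeq_map Y a" by (auto simp: coeq_sel)
      show "\<mu> X (PAct coeq f u) = PAct Z f (\<mu> Y u)"
        unfolding \<mu>_def u coeq_map_act[OF Y X f a]
        by (simp add: \<eta>_section[OF Y a] \<eta>_section[OF X comp_closed[OF X Y T f a]] \<eta>_natural[OF X Y f a])
    qed
    show "\<exists>!u. u \<in> arr PSh coeq Z \<and> u \<cdot>\<^bsub>PSh\<^esub> presheaf_arr S (yoneda S T) coeq coeq_map = h"
    proof (rule ex1I[of _ "presheaf_arr S coeq Z \<mu>"])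
      have "presheaf_arr S (yoneda S T) Z (\<lambda>X p. \<mu> X (coeq_map X p)) = h"
        unfolding \<eta>(1) by (rule presheaf_arr_eqI) (simp add: \<mu>_def \<eta>_section yoneda_def)
      then show "presheaf_arr S coeq Z \<mu> \<in> arr PSh coeq Z \<and>
          presheaf_arr S coeq Z \<mu> \<cdot>\<^bsub>PSh\<^esub> presheaf_arr S (yoneda S T) coeq coeq_map = h"
        using \<mu> by (auto simp: presheaf_arr_comp'[OF q])
    next
      \<comment> \<open>\<open>coeq\<close> is by definition the image of \<open>coeq_map\<close>,
        so a map out of it is determined by its composite with \<open>coeq_map\<close>.\<close>
      fix m assume m: "m \<in> arr PSh coeq Z \<and> m \<cdot>\<^bsub>PSh\<^esub> presheaf_arr S (yoneda S T) coeq coeq_map = h"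
      then obtain \<nu> where \<nu>: "m = presheaf_arr S coeq Z \<nu>" by (auto simp: arr_presheaf_Hom)
      have eq: "presheaf_arr S (yoneda S T) Z (\<lambda>X p. \<nu> X (coeq_map X p)) = presheaf_arr S (yoneda S T) Z \<eta>"
        using m unfolding \<nu> \<eta>(1) presheaf_arr_comp'[OF q] by simp
      show "m = presheaf_arr S coeq Z \<mu>"
        unfolding \<nu>
      proof (rule presheaf_arr_eqI)
        fix X u assume X: "X \<in> Obj S" and "u \<in> carrier (PVal coeq X)"
        then obtain a where a: "a \<in> arr S X T" and u: "u = coeq_map X a" by (auto simp: coeq_sel)
        have "\<nu> X (coeq_map X a) = \<eta> X a"
          by (rule presheaf_arr_eqD[OF eq X]) (simp add: yoneda_def a)
        then show "\<nu> X u = \<mu> X u" unfolding u \<mu>_def by (simp add: \<eta>_section[OF X a])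
      qed
    qed
  qed
qed

end

section \<open>Sections of the counits of an adjunction\<close>

context structured_semigroup_category
begin

lemma adjunction_counits:
  assumes "adjunction S F Fd \<eta>l \<eta>r \<epsilon>l \<epsilon>r"
  defines "T \<equiv> F \<boxtimes> Fd"
  shows "F \<in> Obj S" "Fd \<in> Obj S"
    "\<And>X. X \<in> Obj S \<Longrightarrow> \<epsilon>l X \<in> arr S (X \<boxtimes> T) X"
    "\<And>X. X \<in> Obj S \<Longrightarrow> \<epsilon>r X \<in> arr S (T \<boxtimes> X) X"
    "\<And>X Y f. \<lbrakk>X \<in> Obj S; Y \<in> Obj S; f \<in> arr S X Y\<rbrakk> \<Longrightarrow> \<epsilon>l Y \<cdot> (f \<boxdot> Ident S T) = f \<cdot> \<epsilon>l X"
    "\<And>X Y f. \<lbrakk>X \<in> Obj S; Y \<in> Obj S; f \<in> arr S X Y\<rbrakk> \<Longrightarrow> \<epsilon>r Y \<cdot> (Ident S T \<boxdot> f) = f \<cdot> \<epsilon>r X"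
    "\<And>X Y. \<lbrakk>X \<in> Obj S; Y \<in> Obj S\<rbrakk> \<Longrightarrow> \<epsilon>l (X \<boxtimes> Y) = (Ident S X \<boxdot> \<epsilon>l Y) \<cdot> Assoc S X Y T"
    "\<And>X Y. \<lbrakk>X \<in> Obj S; Y \<in> Obj S\<rbrakk> \<Longrightarrow> \<epsilon>r (X \<boxtimes> Y) \<cdot> Assoc S T X Y = \<epsilon>r X \<boxdot> Ident S Y"
    "\<And>X Y. \<lbrakk>X \<in> Obj S; Y \<in> Obj S\<rbrakk> \<Longrightarrow> (Ident S X \<boxdot> \<epsilon>r Y) \<cdot> Assoc S X T Y = \<epsilon>l X \<boxdot> Ident S Y"
proof -
  note adj = assms(1)[unfolded adjunction_def left_module_trans_def right_module_trans_def nat_trans_def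
      id_func_def left_tensor_def right_tensor_def func.simps, folded T_def]
  show F: "F \<in> Obj S" and Fd: "Fd \<in> Obj S" using adj by simp_all
  then have T: "T \<in> Obj S" unfolding T_def by (rule tensor_obj)
  show l: "\<And>X. X \<in> Obj S \<Longrightarrow> \<epsilon>l X \<in> arr S (X \<boxtimes> T) X"
    and r: "\<And>X. X \<in> Obj S \<Longrightarrow> \<epsilon>r X \<in> arr S (T \<boxtimes> X) X"
    and "\<And>X Y f. \<lbrakk>X \<in> Obj S; Y \<in> Obj S; f \<in> arr S X Y\<rbrakk> \<Longrightarrow> \<epsilon>l Y \<cdot> (f \<boxdot> Ident S T) = f \<cdot> \<epsilon>l X"
    and "\<And>X Y f. \<lbrakk>X \<in> Obj S; Y \<in> Obj S; f \<in> arr S X Y\<rbrakk> \<Longrightarrow> \<epsilon>r Y \<cdot> (Ident S T \<boxdot> f) = f \<cdot> \<epsilon>r X"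
    and "\<And>X Y. \<lbrakk>X \<in> Obj S; Y \<in> Obj S\<rbrakk> \<Longrightarrow> (Ident S X \<boxdot> \<epsilon>r Y) \<cdot> Assoc S X T Y = \<epsilon>l X \<boxdot> Ident S Y"
    using adj by simp_all
  fix X Y assume XY: "X \<in> Obj S" "Y \<in> Obj S"
  have "Ident S (X \<boxtimes> Y) \<cdot> \<epsilon>l (X \<boxtimes> Y) = (Ident S X \<boxdot> \<epsilon>l Y) \<cdot> Assoc S X Y T"
    using adj XY by simp
  then show "\<epsilon>l (X \<boxtimes> Y) = (Ident S X \<boxdot> \<epsilon>l Y) \<cdot> Assoc S X Y T"
    using l[of "X \<boxtimes> Y"] XY T by (simp add: semigroup_simps in_arr_iff)
  have "\<epsilon>r (X \<boxtimes> Y) \<cdot> Assoc S T X Y = Ident S (X \<boxtimes> Y) \<cdot> (\<epsilon>r X \<boxdot> Ident S Y)"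
    using adj XY by simp
  then show "\<epsilon>r (X \<boxtimes> Y) \<cdot> Assoc S T X Y = \<epsilon>r X \<boxdot> Ident S Y"
    using r[of X] XY T by (simp add: semigroup_simps in_arr_iff)
qed

lemma adjunction_units:
  assumes "adjunction S F Fd \<eta>l \<eta>r \<epsilon>l \<epsilon>r"
  shows "\<And>X. X \<in> Obj S \<Longrightarrow> \<eta>r X \<in> arr S X (Fd \<boxtimes> F \<boxtimes> X)"
    and "\<And>X. X \<in> Obj S \<Longrightarrow> \<epsilon>r (F \<boxtimes> X) \<cdot> inv_arr S (Assoc S F Fd (F \<boxtimes> X))
      \<cdot> (Ident S F \<boxdot> (Assoc S Fd F X \<cdot> \<eta>r X)) = Ident S (F \<boxtimes> X)"
    and "\<epsilon>l Fd \<cdot> Assoc S Fd F Fd \<cdot> \<eta>r Fd = Ident S Fd"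
  using assms
  unfolding adjunction_def right_module_trans_def functor_adjunction_def nat_trans_def id_func_def left_tensor_def
  by simp_all

text \<open>The objects at which a natural transformation to the identity splits are closed under
  finite direct sums and retracts.\<close>

lemma section_direct_sum:
  assumes T: "T \<in> Obj S"
    and c: "\<And>X. X \<in> Obj S \<Longrightarrow> c X \<in> arr S (T \<boxtimes> X) X"
    and c_natural: "\<And>X Y f. \<lbrakk>X \<in> Obj S; Y \<in> Obj S; f \<in> arr S X Y\<rbrakk> \<Longrightarrow> c Y \<cdot> (Ident S T \<boxdot> f) = f \<cdot> c X"
    and sections: "\<And>X. X \<in> set Xs \<Longrightarrow> X \<in> Obj S \<and> (\<exists>j\<in>arr S X (T \<boxtimes> X). c X \<cdot> j = Ident S X)"
    and sum: "is_direct_sum S Xs D" and summand: "is_direct_summand S Y D" and Y: "Y \<in> Obj S"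
  shows "\<exists>s\<in>arr S Y (T \<boxtimes> Y). c Y \<cdot> s = Ident S Y"
proof -
  have D: "D \<in> Obj S" using sum unfolding is_direct_sum_def by (elim conjE)
  obtain \<iota> \<pi> where \<iota>\<pi>: "\<forall>i<length Xs. \<iota> i \<in> arr S (Xs ! i) D \<and> \<pi> i \<in> arr S D (Xs ! i)"
    and id: "(\<Oplus>\<^bsub>Hom S D D\<^esub>i\<in>{..<length Xs}. \<iota> i \<cdot> \<pi> i) = Ident S D"
    using sum unfolding is_direct_sum_def by (elim conjE exE)
  obtain i r where ir: "i \<in> arr S Y D" "r \<in> arr S D Y" "r \<cdot> i = Ident S Y"
    using summand unfolding is_direct_summand_def by (elim bexE)
  have TD: "T \<boxtimes> D \<in> Obj S" by (rule tensor_obj[OF T D])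
  interpret DD: module K "Hom S D D" by (rule hom_module[OF D D])
  interpret DTD: module K "Hom S D (T \<boxtimes> D)" by (rule hom_module[OF D TD])
  have "\<forall>X. \<exists>j. X \<in> set Xs \<longrightarrow> j \<in> arr S X (T \<boxtimes> X) \<and> c X \<cdot> j = Ident S X"
    using sections by blast
  from choice[OF this] obtain j where
    "\<forall>X. X \<in> set Xs \<longrightarrow> j X \<in> arr S X (T \<boxtimes> X) \<and> c X \<cdot> j X = Ident S X" by (elim exE)
  then have j: "j X \<in> arr S X (T \<boxtimes> X)" "c X \<cdot> j X = Ident S X" if "X \<in> set Xs" for X
    using that by simp_all
  \<comment> \<open>The section on the k-th summand, transported to \<open>D\<close>. By naturality
    \<open>c D\<close> turns it into \<open>\<iota> k \<cdot> \<pi> k\<close>, and these sum to the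
    identity.\<close>
  define t where "t k = (Ident S T \<boxdot> \<iota> k) \<cdot> (j (Xs ! k) \<cdot> \<pi> k)" for k
  have t: "t k \<in> arr S D (T \<boxtimes> D)" and ct: "c D \<cdot> t k = \<iota> k \<cdot> \<pi> k" if k: "k < length Xs" for k
  proof -
    have X: "Xs ! k \<in> set Xs" "Xs ! k \<in> Obj S" using k sections by auto
    have \<iota>k: "\<iota> k \<in> arr S (Xs ! k) D" and \<pi>k: "\<pi> k \<in> arr S D (Xs ! k)" using \<iota>\<pi> k by auto
    note typing = X(2) D T \<iota>k \<pi>k j(1)[OF X(1)] c[OF X(2)] c[OF D]
    show "t k \<in> arr S D (T \<boxtimes> D)"
      unfolding t_def using typing by (simp add: semigroup_simps in_arr_iff)
    have "c D \<cdot> t k = (c D \<cdot> (Ident S T \<boxdot> \<iota> k)) \<cdot> (j (Xs ! k) \<cdot> \<pi> k)"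
      unfolding t_def using typing by (simp add: semigroup_simps in_arr_iff)
    also have "\<dots> = \<iota> k \<cdot> ((c (Xs ! k) \<cdot> j (Xs ! k)) \<cdot> \<pi> k)"
      unfolding c_natural[OF X(2) D \<iota>k] using typing by (simp add: semigroup_simps in_arr_iff)
    also have "\<dots> = \<iota> k \<cdot> \<pi> k"
      unfolding j(2)[OF X(1)] using typing by (simp add: semigroup_simps in_arr_iff)
    finally show "c D \<cdot> t k = \<iota> k \<cdot> \<pi> k" .
  qed
  define sD where "sD = (\<Oplus>\<^bsub>Hom S D (T \<boxtimes> D)\<^esub>k\<in>{..<length Xs}. t k)"
  have sD: "sD \<in> arr S D (T \<boxtimes> D)"
    unfolding sD_def using t by (intro DTD.finsum_closed) auto
  have "c D \<cdot> sD = (\<Oplus>\<^bsub>Hom S D D\<^esub>k\<in>{..<length Xs}. c D \<cdot> t k)"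
    unfolding sD_def
    by (rule linear_map_finsum[OF hom_module[OF D TD] hom_module[OF D D] comp_linear_right[OF D TD D c[OF D]]])
      (use t in auto)
  also have "\<dots> = (\<Oplus>\<^bsub>Hom S D D\<^esub>k\<in>{..<length Xs}. \<iota> k \<cdot> \<pi> k)"
    using ct comp_closed[OF D TD D t c[OF D]] by (intro DD.finsum_cong') auto
  finally have csD: "c D \<cdot> sD = Ident S D" unfolding id .
  note typing = T D Y sD ir(1,2) c[OF D] c[OF Y]
  show ?thesis
  proof (intro bexI[of _ "(Ident S T \<boxdot> r) \<cdot> (sD \<cdot> i)"])
    show "(Ident S T \<boxdot> r) \<cdot> (sD \<cdot> i) \<in> arr S Y (T \<boxtimes> Y)"
      using typing by (simp add: semigroup_simps in_arr_iff)
    have "c Y \<cdot> ((Ident S T \<boxdot> r) \<cdot> (sD \<cdot> i)) = (c Y \<cdot> (Ident S T \<boxdot> r)) \<cdot> (sD \<cdot> i)"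
      using typing by (simp add: semigroup_simps in_arr_iff)
    also have "\<dots> = r \<cdot> ((c D \<cdot> sD) \<cdot> i)"
      unfolding c_natural[OF D Y ir(2)] using typing by (simp add: semigroup_simps in_arr_iff)
    also have "\<dots> = Ident S Y"
      unfolding csD comp_ident_left[OF Y D ir(1)] by (rule ir(3))
    finally show "c Y \<cdot> ((Ident S T \<boxdot> r) \<cdot> (sD \<cdot> i)) = Ident S Y" .
  qed
qed

text \<open>One triangle identity of (II) says that \<epsilon>r splits at every object
  \<open>F \<boxtimes> X\<close>; by liberality every object is a retract of a direct sum of such
  objects.\<close>

lemma liberal_right_section:
  assumes adj: "adjunction S F Fd \<eta>l \<eta>r \<epsilon>l \<epsilon>r" and lib: "liberal K S S (left_tensor S F)" and Y: "Y \<in> Obj S"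
  shows "\<exists>s\<in>arr S Y (F \<boxtimes> Fd \<boxtimes> Y). \<epsilon>r Y \<cdot> s = Ident S Y"
proof -
  note cu = adjunction_counits[OF adj] and un = adjunction_units[OF adj]
  have T: "F \<boxtimes> Fd \<in> Obj S" by (rule tensor_obj[OF cu(1,2)])
  obtain Xs D where Xs: "set Xs \<subseteq> Obj S" and D: "is_direct_sum S (map (FObj (left_tensor S F)) Xs) D" "is_direct_summand S Y D"
    using lib Y unfolding liberal_def by blast
  show ?thesis
  proof (rule section_direct_sum[OF T cu(4,6) _ D Y])
    fix Z assume "Z \<in> set (map (FObj (left_tensor S F)) Xs)"
    then obtain X where X: "X \<in> Obj S" and Z: "Z = F \<boxtimes> X" using Xs by (auto simp: left_tensor_def)
    have FX: "F \<boxtimes> X \<in> Obj S" by (rule tensor_obj[OF cu(1) X])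
    define j where "j = inv_arr S (Assoc S F Fd (F \<boxtimes> X)) \<cdot> (Ident S F \<boxdot> (Assoc S Fd F X \<cdot> \<eta>r X))"
    note typing = cu(1,2) X FX cu(4)[OF FX] un(1)[OF X]
    have "j \<in> arr S (F \<boxtimes> X) (F \<boxtimes> Fd \<boxtimes> (F \<boxtimes> X))"
      unfolding j_def using typing by (simp add: semigroup_simps in_arr_iff)
    moreover have "\<epsilon>r (F \<boxtimes> X) \<cdot> j = Ident S (F \<boxtimes> X)"
      unfolding j_def un(2)[OF X, symmetric] using typing by (simp add: semigroup_simps in_arr_iff)
    ultimately show "Z \<in> Obj S \<and> (\<exists>j\<in>arr S Z (F \<boxtimes> Fd \<boxtimes> Z). \<epsilon>r Z \<cdot> j = Ident S Z)"
      unfolding Z using FX by blast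
  qed
qed

text \<open>The mate of a section \<open>G \<rightarrow> FF\<^sup>\<diamond>G\<close> at a left dual \<open>G\<close> of \<open>A\<close> is a section
  \<open>A \<rightarrow> A(GA) \<rightarrow> A(FF\<^sup>\<diamond>GA) \<rightarrow> AFF\<^sup>\<diamond>\<close> of the other counit.\<close>

lemma left_section_of_right_section:
  assumes adj: "adjunction S F Fd \<eta>l \<eta>r \<epsilon>l \<epsilon>r" and dual: "adjunction S G A \<zeta>l \<zeta>r \<delta>l \<delta>r"
    and s: "s \<in> arr S G (F \<boxtimes> Fd \<boxtimes> G)" "\<epsilon>r G \<cdot> s = Ident S G"
  shows "\<exists>m\<in>arr S A (A \<boxtimes> (F \<boxtimes> Fd)). \<epsilon>l A \<cdot> m = Ident S A"
proof -
  note cu = adjunction_counits[OF adj]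
  note cu' = adjunction_counits[OF dual] and un' = adjunction_units[OF dual]
  define T where "T = F \<boxtimes> Fd"
  have T: "T \<in> Obj S" unfolding T_def by (rule tensor_obj[OF cu(1,2)])
  note cu = cu[folded T_def] and s = s[folded T_def]
  note G = cu'(1) and A = cu'(2)
  have AT: "A \<boxtimes> T \<in> Obj S" and GA: "G \<boxtimes> A \<in> Obj S" by (rule tensor_obj[OF A T], rule tensor_obj[OF G A])
  note typing = T G A AT GA s(1) cu(3)[OF A] cu(4)[OF G] cu'(3)[OF AT] cu'(3)[OF A] un'(1)[OF A]
  \<comment> \<open>The unit of the dual pair at \<open>A\<close>, with \<open>s\<close> inserted at
    its middle factor \<open>G\<close>, rebracketed so that \<epsilon>l at \<open>A\<close> can be
    applied to the first two factors.\<close>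
  define n where "n = (inv_arr S (Assoc S A T G) \<boxdot> Ident S A) \<cdot> (((Ident S A \<boxdot> s) \<boxdot> Ident S A) \<cdot> \<zeta>r A)"
  have n: "n \<in> arr S A (A \<boxtimes> T \<boxtimes> G \<boxtimes> A)"
    unfolding n_def using typing by (simp add: semigroup_simps in_arr_iff del: tensor_ident)
  \<comment> \<open>By (IV) the counit on the right of \<open>A\<close> may be read as the counit on
    the left of \<open>G\<close>, where it cancels \<open>s\<close>.\<close>
  have "(\<epsilon>l A \<boxdot> Ident S G \<boxdot> Ident S A) \<cdot> n
      = (((Ident S A \<boxdot> \<epsilon>r G) \<cdot> Assoc S A T G) \<boxdot> Ident S A) \<cdot> n"
    unfolding cu(9)[OF A G] ..
  also have "\<dots> = ((Ident S A \<boxdot> (\<epsilon>r G \<cdot> s)) \<boxdot> Ident S A) \<cdot> \<zeta>r A"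
    unfolding n_def using typing by (simp add: semigroup_simps in_arr_iff interchange_simps)
  also have "\<dots> = \<zeta>r A"
    unfolding s(2) using typing by (simp add: semigroup_simps in_arr_iff)
  finally have \<epsilon>n: "(\<epsilon>l A \<boxdot> Ident S G \<boxdot> Ident S A) \<cdot> n = \<zeta>r A" .
  have assoc: "(\<epsilon>l A \<boxdot> (Ident S G \<boxdot> Ident S A)) \<cdot> (Assoc S (A \<boxtimes> T) G A \<cdot> n)
      = Assoc S A G A \<cdot> ((\<epsilon>l A \<boxdot> Ident S G \<boxdot> Ident S A) \<cdot> n)"
    using typing n arrow_assoc_natural_assoc[of "\<epsilon>l A" "Ident S G" "Ident S A" A G A n]
    by (simp add: semigroup_simps in_arr_iff del: tensor_ident)
  show ?thesis unfolding T_def[symmetric]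
  proof (intro bexI[of _ "\<delta>l (A \<boxtimes> T) \<cdot> (Assoc S (A \<boxtimes> T) G A \<cdot> n)"])
    show "\<delta>l (A \<boxtimes> T) \<cdot> (Assoc S (A \<boxtimes> T) G A \<cdot> n) \<in> arr S A (A \<boxtimes> T)"
      using typing n by (simp add: semigroup_simps in_arr_iff)
    have "\<epsilon>l A \<cdot> (\<delta>l (A \<boxtimes> T) \<cdot> (Assoc S (A \<boxtimes> T) G A \<cdot> n))
        = (\<epsilon>l A \<cdot> \<delta>l (A \<boxtimes> T)) \<cdot> (Assoc S (A \<boxtimes> T) G A \<cdot> n)"
      using typing n by (simp add: semigroup_simps in_arr_iff)
    \<comment> \<open>Naturality of \<delta>l brings \<epsilon>l next to \<open>n\<close>. What
      remains is the second identity of (III) for the pair \<open>G\<close>,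
      \<open>A\<close>.\<close>
    also have "\<epsilon>l A \<cdot> \<delta>l (A \<boxtimes> T) = \<delta>l A \<cdot> (\<epsilon>l A \<boxdot> (Ident S G \<boxdot> Ident S A))"
      unfolding tensor_ident[OF G A] by (rule cu'(5)[OF AT A cu(3)[OF A], symmetric])
    also have "\<dots> \<cdot> (Assoc S (A \<boxtimes> T) G A \<cdot> n)
        = \<delta>l A \<cdot> ((\<epsilon>l A \<boxdot> (Ident S G \<boxdot> Ident S A)) \<cdot> (Assoc S (A \<boxtimes> T) G A \<cdot> n))"
      using typing n by (simp add: semigroup_simps in_arr_iff)
    also have "\<dots> = \<delta>l A \<cdot> Assoc S A G A \<cdot> \<zeta>r A"
      unfolding assoc \<epsilon>n using typing by (simp add: semigroup_simps in_arr_iff)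
    also have "\<dots> = Ident S A" by (rule un'(3))
    finally show "\<epsilon>l A \<cdot> (\<delta>l (A \<boxtimes> T) \<cdot> (Assoc S (A \<boxtimes> T) G A \<cdot> n)) = Ident S A" .
  qed
qed

text \<open>Rigidity provides a left dual \<open>G\<close> of \<open>A\<close>, and \<epsilon>r
  already splits at \<open>G\<close> by liberality.\<close>

lemma rigid_left_section:
  assumes adj: "adjunction S F Fd \<eta>l \<eta>r \<epsilon>l \<epsilon>r" and lib: "liberal K S S (left_tensor S F)"
    and rigid: "rigid S" and A: "A \<in> Obj S"
  shows "\<exists>m\<in>arr S A (A \<boxtimes> (F \<boxtimes> Fd)). \<epsilon>l A \<cdot> m = Ident S A"
proof -
  obtain G \<zeta>l \<zeta>r \<delta>l \<delta>r where dual: "adjunction S G A \<zeta>l \<zeta>r \<delta>l \<delta>r"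
    using rigid A unfolding rigid_def is_right_dual_def by meson
  obtain s where "s \<in> arr S G (F \<boxtimes> Fd \<boxtimes> G)" "\<epsilon>r G \<cdot> s = Ident S G"
    using liberal_right_section[OF adj lib adjunction_counits(1)[OF dual]] by (elim bexE)
  then show ?thesis by (rule left_section_of_right_section[OF adj dual])
qed

end

theorem theorem3p9:
  fixes K :: "'k ring"
    and S :: "('o, 'k, 'u) semicat"
    and F Fd :: 'o
    and \<eta>l \<eta>r \<epsilon>l \<epsilon>r :: "'o \<Rightarrow> 'u"
  defines "PSh \<equiv> presheaf_category K S"
    and "FF \<equiv> F \<boxtimes>\<^bsub>S\<^esub> Fd"
    and "FFFF \<equiv> F \<boxtimes>\<^bsub>S\<^esub> Fd \<boxtimes>\<^bsub>S\<^esub> F \<boxtimes>\<^bsub>S\<^esub> Fd"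
    and "e1 \<equiv> \<epsilon>r F \<boxdot>\<^bsub>S\<^esub> Ident S Fd"
    and "e2 \<equiv> (Ident S F \<boxdot>\<^bsub>S\<^esub> \<epsilon>l Fd)
               \<cdot>\<^bsub>S\<^esub> Assoc S F Fd (F \<boxtimes>\<^bsub>S\<^esub> Fd) \<cdot>\<^bsub>S\<^esub> Assoc S (F \<boxtimes>\<^bsub>S\<^esub> Fd) F Fd"
  assumes "semigroup_category K S"
    and "rigid S"
    and "infinite (UNIV :: 'u set)"
    and "adjunction S F Fd \<eta>l \<eta>r \<epsilon>l \<epsilon>r"
    and "liberal K S S (left_tensor S F)"
  shows "(\<exists>U. is_unit_object PSh U) \<and>
    (\<exists>C q. is_coequalizer PSh (yoneda S FFFF) (yoneda S FF)
             (yoneda_arr S FFFF FF e1) (yoneda_arr S FFFF FF e2) C q) \<and>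
    (\<forall>U C q. is_unit_object PSh U \<and>
       is_coequalizer PSh (yoneda S FFFF) (yoneda S FF)
         (yoneda_arr S FFFF FF e1) (yoneda_arr S FFFF FF e2) C q
       \<longrightarrow> isomorphic PSh U C)"
proof -
  interpret semigroup_category K S by fact
  interpret large_semigroup_category K S by unfold_locales fact
  note cu = adjunction_counits[OF assms(9), folded FF_def]
  have FF: "FF \<in> Obj S" unfolding FF_def by (rule tensor_obj[OF cu(1,2)])
  \<comment> \<open>Sections exist at each object; choosing them one by one suffices for
    \<open>split_counits\<close>, which places no naturality condition on them.\<close>
  define sr where "sr X = (SOME s. s \<in> arr S X (FF \<boxtimes>\<^bsub>S\<^esub> X) \<and> \<epsilon>r X \<cdot>\<^bsub>S\<^esub> s = Ident S X)" for X
  define sl where "sl X = (SOME s. s \<in> arr S X (X \<boxtimes>\<^bsub>S\<^esub> FF) \<and> \<epsilon>l X \<cdot>\<^bsub>S\<^esub> s = Ident S X)" for X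
  have sr: "sr X \<in> arr S X (FF \<boxtimes>\<^bsub>S\<^esub> X) \<and> \<epsilon>r X \<cdot>\<^bsub>S\<^esub> sr X = Ident S X" if "X \<in> Obj S" for X
    unfolding sr_def FF_def
    by (rule someI_ex) (use liberal_right_section[OF assms(9,10) that] in blast)
  have sl: "sl X \<in> arr S X (X \<boxtimes>\<^bsub>S\<^esub> FF) \<and> \<epsilon>l X \<cdot>\<^bsub>S\<^esub> sl X = Ident S X" if "X \<in> Obj S" for X
    unfolding sl_def FF_def
    by (rule someI_ex) (use rigid_left_section[OF assms(9,10,7) that] in blast)
  interpret split_counits K S FF \<epsilon>l \<epsilon>r sl sr
    by unfold_locales (use cu FF sr sl in simp_all)
  \<comment> \<open>\<open>FFFF\<close> is bracketed to the left, as (FF F) Fd; this associator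
    identifies it with FF tensored with itself.\<close>
  define \<alpha> where "\<alpha> = Assoc S FF F Fd"
  have \<alpha>: "\<alpha> \<in> arr S FFFF (FF \<boxtimes>\<^bsub>S\<^esub> FF)"
    unfolding \<alpha>_def FFFF_def using assoc_arr[OF FF cu(1,2)] by (simp only: FF_def)
  have \<alpha>': "inv_arr S \<alpha> \<in> arr S (FF \<boxtimes>\<^bsub>S\<^esub> FF) FFFF" "\<alpha> \<cdot>\<^bsub>S\<^esub> inv_arr S \<alpha> = Ident S (FF \<boxtimes>\<^bsub>S\<^esub> FF)"
    using inv_assoc_inverse[OF FF cu(1,2)] unfolding inverse_arrows_def \<alpha>_def FFFF_def by (simp_all add: FF_def)
  have FFFF: "FFFF \<in> Obj S" unfolding FFFF_def by (intro tensor_obj cu(1,2))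
  \<comment> \<open>The module property of \<epsilon>r at \<open>F\<close> and \<open>Fd\<close>
    identifies the first map of the pair with \<epsilon>r at FF; that of \<epsilon>l does the same
    for the second map below.\<close>
  have e1: "e1 = \<epsilon>r FF \<cdot>\<^bsub>S\<^esub> \<alpha>"
    using cu(8)[OF cu(1,2)] unfolding e1_def \<alpha>_def by (simp add: FF_def)
  have e2: "e2 = \<epsilon>l FF \<cdot>\<^bsub>S\<^esub> \<alpha>"
    using cu(7)[OF cu(1,2)] unfolding e2_def \<alpha>_def by (simp add: FF_def)
  have unit: "is_unit_object PSh coeq"
    unfolding PSh_def by (rule unit_object_coeq)
  have coequalizer: "is_coequalizer PSh (yoneda S FFFF) (yoneda S FF)
      (yoneda_arr S FFFF FF e1) (yoneda_arr S FFFF FF e2) coeq (presheaf_arr S (yoneda S FF) coeq coeq_map)"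
    unfolding PSh_def e1 e2 by (rule coequalizer_coeq[OF FFFF \<alpha> \<alpha>'])
  show ?thesis
  proof (intro conjI allI impI; (elim conjE)?)
    show "\<exists>U. is_unit_object PSh U" using unit by (rule exI)
    show "\<exists>C q. is_coequalizer PSh (yoneda S FFFF) (yoneda S FF)
        (yoneda_arr S FFFF FF e1) (yoneda_arr S FFFF FF e2) C q"
      by (intro exI) (rule coequalizer)
  next
    fix U C q
    assume "is_unit_object PSh U" and "is_coequalizer PSh (yoneda S FFFF) (yoneda S FF)
      (yoneda_arr S FFFF FF e1) (yoneda_arr S FFFF FF e2) C q"
    then have "isomorphic PSh U coeq" "isomorphic PSh coeq C"
      using unit_object_unique presheaf_coequalizer_unique unit coequalizer unfolding PSh_def by blast+
    then show "isomorphic PSh U C"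
      unfolding PSh_def by (rule presheaf_isomorphic_trans)
  qed
qed

end
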